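(* Let $T>0$ and assume $(\mathbf{a1})$, $(\mathbf{a2})$, $(\mathbf{a3})$, $(\mathbf{h1})$, $(\mathbf{h2})$ (stated in the context). With $h(x,\mu,z)=\min_{a\in\mathbb R^{d_\alpha}}(f(x,\mu,a)\cdot z+g(x,\mu,a))$, the Bellman equation $$\partial_tv(t,m)+\int_{\mathbb R^{d_x}}h(x,m,\partial_mv(t,m)(x))\,dm(x)=0,\qquad v(T,m)=\int_{\mathbb R^{d_x}}k(x,m)\,dm(x)$$ on $[0,T]\times\mathcal P_2(\mathbb R^{d_x})$ has at most one solution $v(t,m)$ with the following regularity: $v$ is differentiable in $t\in[0,T]$ and $L$-differentiable in $m\in\mathcal P_2(\mathbb R^{d_x})$ with $\partial_tv(t,m)$ and $\partial_mv(t,m)(x)$ continuous in their corresponding arguments; $\partial_tv(t,m)$ is differentiable in $t\in[0,T]$ and $L$-differentiable in $m$; and $\partial_mv(t,m)(x)$ is differentiable in $t\in[0,T]$, $x\in\mathbb R^{d_x}$ and $L$-differentiable in $m$.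
   Context: **Notation.** $\mathcal P_2(\mathbb R^d)$: Borel probability measures on $\mathbb R^d$ with finite second moment; $W_p$: $p$-Wasserstein metric; $\|\mu\|_p=(\int|x|^pd\mu)^{1/p}$; $\delta_0$: Dirac mass at $0$; $\|\cdot\|$: operator norm of (multi)linear maps; $a\vee b=\max\{a,b\}$. $\partial_m$ and $\partial_\mu$ both denote the $L$-derivative. **Derivatives in measure.** $h:\mathcal P_2(\mathbb R^d)\to\mathbb R$ has linear functional derivative $\frac{\delta h}{\delta\mu}(\mu)(x)$ if this function is jointly continuous, $|\frac{\delta h}{\delta\mu}(\mu)(x)|\le c(\mu)(1+|x|^2)$ with $c$ bounded on bounded sets, and $h(\nu_1)-h(\nu_2)=\int_0^1\int\frac{\delta h}{\delta\mu}(\theta\nu_1+(1-\theta)\nu_2)(x)\,d(\nu_1-\nu_2)(x)d\theta$; normalization $\int\frac{\delta h}{\delta\mu}(\mu)d\mu=0$. A second-order linear functional derivative $\frac{\delta^2h}{\delta\mu^2}(\mu)(x,\tilde x)$ is jointly continuous, bounded by $c(\mu)(1+|x|^2+|\tilde x|^2)$, has zero $\mu$-integral in each variable, and satisfies $h(\nu_1)-h(\nu_2)=\int\frac{\delta h}{\delta\mu}(\nu_2)d(\nu_1-\nu_2)+\int_0^1\int_0^1\iint\theta\frac{\delta^2h}{\delta\mu^2}(\nu_2+\lambda\theta(\nu_1-\nu_2))(x,\tilde x)d(\nu_1-\nu_2)(x)d(\nu_1-\nu_2)(\tilde x)d\lambda d\theta$. $h$ is second-order regularly differentiable if both exist and $\partial_x\partial_x\frac{\delta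 h}{\delta\mu}$, $\partial_x\partial_{\tilde x}\frac{\delta^2h}{\delta\mu^2}$ are jointly continuous and bounded by $c(\mu)$. $h$ is $L$-differentiable at $\mu$ if the lift $X\mapsto h(\mathrm{Law}(X))$ on square-integrable random vectors is Fréchet differentiable at some $X$ with law $\mu$; the derivative is represented by $\partial_\mu h(\mu)(X)$, and $\partial_\mu h(\mu)(x)=\partial_x\frac{\delta h}{\delta\mu}(\mu)(x)$ for regularly differentiable $h$. Also $\partial_\mu\partial_\mu h(\mu)(\tilde x,\hat x)=\partial_{\tilde x}\partial_{\hat x}\frac{\delta^2h}{\delta\mu^2}(\mu)(\tilde x,\hat x)$. For vector-valued maps everything is componentwise. **(a1)** $f:\mathbb R^{d_x}\times\mathcal P_2(\mathbb R^{d_x})\times\mathbb R^{d_\alpha}\to\mathbb R^{d_x}$ is twice differentiable in $x,\alpha$, second-order regularly differentiable in $\mu$, with jointly continuous derivatives, and for constants $\lambda_f,\Lambda_f,\bar l_f,\mathrm{Lip}_f>0$ and all arguments: (i) $\sum_{i,j}(\xi_i\partial_\alpha f_i)\cdot(\xi_j\partial_\alpha f_j)\ge\lambda_f|\xi|^2$ for $\xi\in\mathbb R^{d_x}$; (ii) $\|\partial_\alpha f\|\vee\|\partial_\mu f(x,\mu,\alpha)(\tilde x)\|\vee\|\partial_xf\|\le\Lambda_f$; (iii) each of $\partial_\mu\partial_\mu f(x,\mu,\alpha)(\tilde x,\hat x)$, $\partial_\alpha\partial_\alpha f$, $\partial_\mu\partial_\alpha f(\cdot)(\tilde x)$, $\partial_\alpha\partial_xf$,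 $\partial_x\partial_xf$, $\partial_{\tilde x}\partial_\mu f(\cdot)(\tilde x)$, $\partial_x\partial_\mu f(\cdot)(\tilde x)$ has norm at most $\bar l_f/(1+|x|+\|\mu\|_1)$; (iv) each of these is jointly Lipschitz with constant $\mathrm{Lip}_f/(1+\max\{|x|,|x'|\}+\max\{\|\mu\|_1,\|\mu'\|_1\})$ with respect to $|x-x'|+W_2(\mu,\mu')+|\alpha-\alpha'|$ (plus $|\tilde x-\tilde x'|$, $|\hat x-\hat x'|$ when these variables occur). **(a2)** $g:\mathbb R^{d_x}\times\mathcal P_2(\mathbb R^{d_x})\times\mathbb R^{d_\alpha}\to\mathbb R$ is twice differentiable in $x,\alpha$, second-order regularly differentiable in $\mu$, with jointly Lipschitz second-order derivatives, and for constants $\lambda_g,\Lambda_g,\bar l_g>0$, $l_g\ge0$: (i) $\xi^\top\partial_\alpha\partial_\alpha g\,\xi\ge\lambda_g|\xi|^2$; (ii) with $G(x,\mu,\alpha):=g(x,\mu,\alpha)+\int\frac{\delta}{\delta\mu}g(\tilde x,\mu,\alpha)(x)d\mu(\tilde x)$: $\xi^\top\partial_x\partial_xG\,\xi\ge\lambda_g|\xi|^2$ and $\int(G(x,\mu',\alpha)-G(x,\mu,\alpha))d(\mu'-\mu)(x)\ge-l_g|\int y\,d(\mu-\mu')(y)|^2$ for all $\mu,\mu',\alpha$, with $l_g\le\frac12\lambda_g$; (iii) the norms of $\partial_\mu\partial_\mu g(\cdot)(\tilde x,\hat x)$, $\partial_\alpha\partial_\alpha g$, $\partial_x\partial_\mu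 g(\cdot)(\tilde x)$, $\partial_x\partial_xg$, $\partial_{\tilde x}\partial_\mu g(\cdot)(\tilde x)$ are $\le\Lambda_g$, and those of $\partial_x\partial_\alpha g$, $\partial_\alpha\partial_\mu g(\cdot)(\tilde x)$ are $\le\bar l_g$. **(a3)** $k:\mathbb R^{d_x}\times\mathcal P_2(\mathbb R^{d_x})\to\mathbb R$ is twice differentiable in $x$, second-order regularly differentiable in $\mu$, with jointly Lipschitz second-order derivatives, and for constants $\lambda_k,\Lambda_k>0$, $l_k\ge0$: (i) with $K(x,\mu):=k(x,\mu)+\int\frac{\delta}{\delta\mu}k(\tilde x,\mu)(x)d\mu(\tilde x)$: $\xi^\top\partial_x\partial_xK\,\xi\ge\lambda_k|\xi|^2$ and $\int(K(x,\mu')-K(x,\mu))d(\mu'-\mu)(x)\ge-l_k|\int y\,d(\mu-\mu')(y)|^2$, with $l_k\le\frac12\lambda_k$; (ii) the norms of $\partial_\mu\partial_\mu k(\cdot)(\tilde x,\hat x)$, $\partial_x\partial_\mu k(\cdot)(\tilde x)$, $\partial_x\partial_xk$, $\partial_{\tilde x}\partial_\mu k(\cdot)(\tilde x)$ are $\le\Lambda_k$. **Constants.** $\bar L_k=3\Lambda_k$; $\lambda_z=\frac{\lambda_f^2}{\Lambda_g+\lambda_g/20}$, $\lambda_x=\frac{17}{20}\lambda_g$, $\bar\lambda_k=\frac14\lambda_k$, $\bar\lambda_z=\frac12\lambda_z$, $\bar\lambda_x=\frac1{40}\lambda_g$; $\kappa_1=\min\{\frac{\lambda_k}4,\frac{\lambda_z}2,\frac{\lambda_g}{40}\}$,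 $\kappa_2=\min\{\frac{\lambda_k}4,\frac{\lambda_z}4,\frac{\lambda_g}5\}$; $L_1^*=\max\{\frac{4\Lambda_k^2}{\lambda_k},\frac1{\lambda_z}(2\Lambda_g+\frac3{20}\lambda_g),\frac1{\lambda_x}(\frac52\Lambda_f+2\Lambda_g+\frac3{20}\lambda_g)\}$; $L_4^*=\max\{\frac{\Lambda_k^2}{\kappa_1\lambda_k},\frac1{4\kappa_1\lambda_x}(\frac{25}{16}\Lambda_f^2+(2\Lambda_g+\frac15\lambda_g)^2)\}$; $L_5^*=\max\{\frac{9\Lambda_k^2}{4\kappa_2\bar\lambda_k},\frac{25\Lambda_f^2}{64\kappa_2\bar\lambda_z},\frac1{4\kappa_2\bar\lambda_x}(\frac{25}{16}\Lambda_f^2+9(\frac1{10}\lambda_g+\Lambda_g)^2)\}$; $L_6^*=\max\{\frac{27\Lambda_k^2}{\bar\lambda_k},\frac{\Lambda_g+\lambda_g/10}{\bar\lambda_x},\frac{\Lambda_g+\lambda_g/10}{\bar\lambda_z},\frac{12\Lambda_k^2}{\lambda_k},\frac{2\Lambda_g+\lambda_g/5}{\lambda_x},\frac{6\Lambda_k^2}{\bar\lambda_k},\frac{2\Lambda_g+3\lambda_g/20}{\bar\lambda_x},\frac{\frac{15}4\Lambda_f+7\Lambda_g+\frac{13}{20}\lambda_g}{\bar\lambda_z}\}$; $L_0^*=d_x\max\{L_1^*,\sqrt{(L_4^*(2+L_5^* )+1)L_1^*L_6^*}\}$. **(h1)** $f(0,\delta_0,0)=0$, $\partial_xg(0,\delta_0,0)=0$,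 $\partial_\alpha g(0,\delta_0,0)=0$, $\partial_\mu g(0,\delta_0,0)(0)=0$, $\partial_xk(0,\delta_0)=0$, $\partial_\mu k(0,\delta_0)(0)=0$. **(h2)** $8\bar l_g\le\lambda_g$ and $\bar l_f\le\frac{\lambda_g}{40\max\{\bar L_k,L_0^*\}}$. *)

theory Defs
  imports "HOL-Probability.Probability"
begin

section \<open>Probability measures with finite second moment\<close>

definition P2 :: "'x::euclidean_space measure set" where
  "P2 = {\<mu>. sets \<mu> = sets borel \<and> prob_space \<mu> \<and> integrable \<mu> (\<lambda>x. (norm x)\<^sup>2)}"

definition couplings :: "'x::euclidean_space measure \<Rightarrow> 'x measure \<Rightarrow> ('x \<times> 'x) measure set" where
  "couplings \<mu> \<nu> = {\<pi>. sets \<pi> = sets borel \<and> distr \<pi> borel fst = \<mu> \<and> distr \<pi> borel snd = \<nu>}"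

definition wasserstein :: "real \<Rightarrow> 'x::euclidean_space measure \<Rightarrow> 'x measure \<Rightarrow> real" where
  "wasserstein p \<mu> \<nu> =
     (INF \<pi>\<in>couplings \<mu> \<nu>. \<integral>z. norm (fst z - snd z) powr p \<partial>\<pi>) powr (1 / p)"

abbreviation W2 :: "'x::euclidean_space measure \<Rightarrow> 'x measure \<Rightarrow> real" where
  "W2 \<equiv> wasserstein 2"

definition mnorm :: "real \<Rightarrow> 'x::euclidean_space measure \<Rightarrow> real" where
  "mnorm p \<mu> = (\<integral>x. norm x powr p \<partial>\<mu>) powr (1 / p)"

abbreviation dirac0 :: "'x::euclidean_space measure" where
  "dirac0 \<equiv> return borel 0"

text \<open>Joint continuity and joint Lipschitz continuity on \<open>P2 \<times> S\<close>; \<open>P2\<close> carries the metric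
  \<open>W2\<close>, and the remaining variables are collected in one (product) metric space.\<close>

definition jcont ::
  "'z::metric_space set \<Rightarrow> ('x::euclidean_space measure \<Rightarrow> 'z \<Rightarrow> 'y::metric_space) \<Rightarrow> bool" where
  "jcont S F \<longleftrightarrow> (\<forall>\<mu>\<in>P2. \<forall>z\<in>S. \<forall>e>0. \<exists>d>0. \<forall>\<nu>\<in>P2. \<forall>w\<in>S.
     W2 \<mu> \<nu> < d \<longrightarrow> dist z w < d \<longrightarrow> dist (F \<mu> z) (F \<nu> w) < e)"

definition jlipschitz ::
  "('x::euclidean_space measure \<Rightarrow> 'z::metric_space \<Rightarrow> 'y::metric_space) \<Rightarrow> bool" where
  "jlipschitz F \<longleftrightarrow> (\<exists>C. \<forall>\<mu>\<in>P2. \<forall>\<nu>\<in>P2. \<forall>z w.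
     dist (F \<mu> z) (F \<nu> w) \<le> C * (W2 \<mu> \<nu> + dist z w))"

definition bounded_on_bounded :: "('x::euclidean_space measure \<Rightarrow> real) \<Rightarrow> bool" where
  "bounded_on_bounded c \<longleftrightarrow> (\<forall>R. \<exists>B. \<forall>\<mu>\<in>P2. W2 \<mu> dirac0 \<le> R \<longrightarrow> \<bar>c \<mu>\<bar> \<le> B)"

text \<open>\<open>mix \<theta> \<mu> \<nu>\<close> is \<open>\<theta>\<mu> + (1 - \<theta>)\<nu>\<close> (for \<open>\<theta>\<close> in \<open>[0,1]\<close>); \<open>dint \<mu> \<nu> \<phi>\<close> is the
  integral of \<open>\<phi>\<close> against the signed measure \<open>\<mu> - \<nu>\<close>.\<close>

definition mix :: "real \<Rightarrow> 'x::euclidean_space measure \<Rightarrow> 'x measure \<Rightarrow> 'x measure" where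
  "mix \<theta> \<mu> \<nu> = measure_of UNIV (sets borel)
     (\<lambda>A. ennreal \<theta> * emeasure \<mu> A + ennreal (1 - \<theta>) * emeasure \<nu> A)"

definition dint ::
  "'x::euclidean_space measure \<Rightarrow> 'x measure \<Rightarrow> ('x \<Rightarrow> 'y::euclidean_space) \<Rightarrow> 'y" where
  "dint \<mu> \<nu> \<phi> = (\<integral>x. \<phi> x \<partial>\<mu>) - (\<integral>x. \<phi> x \<partial>\<nu>)"

section \<open>Derivatives in Euclidean variables\<close>

text \<open>The Frechet derivative as a bounded linear map. Iterating it yields curried multilinear
  maps, on which \<open>norm\<close> is the operator norm of multilinear maps.\<close>

definition Dif ::
  "('b::real_normed_vector \<Rightarrow> 'y::real_normed_vector) \<Rightarrow> 'b \<Rightarrow> 'b \<Rightarrow>\<^sub>L 'y" where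
  "Dif \<phi> x = Blinfun (frechet_derivative \<phi> (at x))"

definition twice_differentiable ::
  "('b::real_normed_vector \<Rightarrow> 'y::real_normed_vector) \<Rightarrow> bool" where
  "twice_differentiable \<phi> \<longleftrightarrow>
     (\<forall>x. \<phi> differentiable (at x)) \<and> (\<forall>x. Dif \<phi> differentiable (at x))"

definition riesz :: "('b::euclidean_space \<Rightarrow> real) \<Rightarrow> 'b" where
  "riesz A = (\<Sum>b\<in>Basis. A b *\<^sub>R b)"

definition grad :: "('b::euclidean_space \<Rightarrow> real) \<Rightarrow> 'b \<Rightarrow> 'b" where
  "grad \<phi> x = riesz (blinfun_apply (Dif \<phi> x))"

section \<open>Linear functional derivatives\<close>

text \<open>For vector-valued maps these definitions (with Bochner integrals) are the componentwise ones.\<close>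

definition has_lfd ::
  "('x::euclidean_space measure \<Rightarrow> 'y::euclidean_space) \<Rightarrow> ('x measure \<Rightarrow> 'x \<Rightarrow> 'y) \<Rightarrow> bool" where
  "has_lfd h D \<longleftrightarrow>
     jcont UNIV D \<and>
     (\<exists>c. bounded_on_bounded c \<and> (\<forall>\<mu>\<in>P2. \<forall>x. norm (D \<mu> x) \<le> c \<mu> * (1 + (norm x)\<^sup>2))) \<and>
     (\<forall>\<nu>1\<in>P2. \<forall>\<nu>2\<in>P2. h \<nu>1 - h \<nu>2 = (LINT \<theta>:{0..1}|lborel. dint \<nu>1 \<nu>2 (D (mix \<theta> \<nu>1 \<nu>2)))) \<and>
     (\<forall>\<mu>\<in>P2. (\<integral>x. D \<mu> x \<partial>\<mu>) = 0)"

text \<open>The derivative is unique on \<open>P2\<close>, thanks to the normalization.\<close>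

definition lfd ::
  "('x::euclidean_space measure \<Rightarrow> 'y::euclidean_space) \<Rightarrow> 'x measure \<Rightarrow> 'x \<Rightarrow> 'y" where
  "lfd h = (SOME D. has_lfd h D)"

text \<open>Here \<open>D1\<close> is the first-order derivative. The defining identity determines \<open>D2\<close> only up
  to a part antisymmetric in \<open>(x, x')\<close>. Hence there is no operator for the second-order
  derivative: the assumptions below ask for some version of it with the required properties.\<close>

definition has_lfd2 ::
  "('x::euclidean_space measure \<Rightarrow> 'y::euclidean_space) \<Rightarrow> ('x measure \<Rightarrow> 'x \<Rightarrow> 'y) \<Rightarrow>
   ('x measure \<Rightarrow> 'x \<Rightarrow> 'x \<Rightarrow> 'y) \<Rightarrow> bool" where
  "has_lfd2 h D1 D2 \<longleftrightarrow>
     jcont UNIV (\<lambda>\<mu> (x, x'). D2 \<mu> x x') \<and>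
     (\<exists>c. bounded_on_bounded c \<and>
        (\<forall>\<mu>\<in>P2. \<forall>x x'. norm (D2 \<mu> x x') \<le> c \<mu> * (1 + (norm x)\<^sup>2 + (norm x')\<^sup>2))) \<and>
     (\<forall>\<mu>\<in>P2. (\<forall>x'. (\<integral>x. D2 \<mu> x x' \<partial>\<mu>) = 0) \<and> (\<forall>x. (\<integral>x'. D2 \<mu> x x' \<partial>\<mu>) = 0)) \<and>
     (\<forall>\<nu>1\<in>P2. \<forall>\<nu>2\<in>P2. h \<nu>1 - h \<nu>2 = dint \<nu>1 \<nu>2 (D1 \<nu>2) +
        (LINT \<theta>:{0..1}|lborel. LINT l:{0..1}|lborel.
           \<theta> *\<^sub>R dint \<nu>1 \<nu>2 (\<lambda>x'. dint \<nu>1 \<nu>2 (\<lambda>x. D2 (mix (l * \<theta>) \<nu>1 \<nu>2) x x'))))"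

text \<open>The mixed derivative of \<open>D2\<close> in both space variables. In terms of the measure
  derivative, this is the second-order L-derivative.\<close>

definition dd :: "('x::euclidean_space \<Rightarrow> 'x \<Rightarrow> 'y::euclidean_space) \<Rightarrow> 'x \<Rightarrow> 'x \<Rightarrow> 'x \<Rightarrow>\<^sub>L 'x \<Rightarrow>\<^sub>L 'y" where
  "dd A x x' = Dif (\<lambda>u. Dif (\<lambda>w. A u w) x') x"

definition regular2 ::
  "('x::euclidean_space measure \<Rightarrow> 'y::euclidean_space) \<Rightarrow> ('x measure \<Rightarrow> 'x \<Rightarrow> 'x \<Rightarrow> 'y) \<Rightarrow> bool" where
  "regular2 h D2 \<longleftrightarrow>
     (\<exists>D1. has_lfd h D1 \<and> has_lfd2 h D1 D2 \<and>
        (\<forall>\<mu>\<in>P2. twice_differentiable (D1 \<mu>)) \<and>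
        (\<forall>\<mu>\<in>P2. \<forall>x x'. (\<lambda>w. D2 \<mu> x w) differentiable (at x') \<and>
           (\<lambda>u. Dif (\<lambda>w. D2 \<mu> u w) x') differentiable (at x)) \<and>
        jcont UNIV (\<lambda>\<mu> x. Dif (Dif (D1 \<mu>)) x) \<and>
        jcont UNIV (\<lambda>\<mu> (x, x'). dd (D2 \<mu>) x x') \<and>
        (\<exists>c. bounded_on_bounded c \<and>
           (\<forall>\<mu>\<in>P2. \<forall>x. norm (Dif (Dif (D1 \<mu>)) x) \<le> c \<mu>) \<and>
           (\<forall>\<mu>\<in>P2. \<forall>x x'. norm (dd (D2 \<mu>) x x') \<le> c \<mu>)))"

section \<open>L-derivatives\<close>

text \<open>Random vectors live on \<open>[0,1]\<close> with the uniform distribution, an atomless space that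
  carries random vectors of every law on a Euclidean space.\<close>

definition \<Omega> :: "real measure" where
  "\<Omega> = uniform_measure lborel {0..1}"

definition L2 :: "(real \<Rightarrow> 'x::euclidean_space) set" where
  "L2 = {X \<in> borel_measurable \<Omega>. integrable \<Omega> (\<lambda>\<omega>. (norm (X \<omega>))\<^sup>2)}"

definition L2norm :: "(real \<Rightarrow> 'x::euclidean_space) \<Rightarrow> real" where
  "L2norm X = sqrt (\<integral>\<omega>. (norm (X \<omega>))\<^sup>2 \<partial>\<Omega>)"

definition Law :: "(real \<Rightarrow> 'x::euclidean_space) \<Rightarrow> 'x measure" where
  "Law X = distr \<Omega> borel X"

text \<open>Frechet differentiability of \<open>X \<mapsto> h (Law X)\<close> at \<open>X\<close>. The norm bound makes \<open>A\<close> respect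
  almost sure equality, so \<open>A\<close> is a continuous linear functional on the usual quotient space.\<close>

definition lift_has_derivative ::
  "('x::euclidean_space measure \<Rightarrow> real) \<Rightarrow> (real \<Rightarrow> 'x) \<Rightarrow> ((real \<Rightarrow> 'x) \<Rightarrow> real) \<Rightarrow> bool" where
  "lift_has_derivative h X A \<longleftrightarrow>
     (\<forall>Y\<in>L2. \<forall>Z\<in>L2. \<forall>r s. A (\<lambda>\<omega>. r *\<^sub>R Y \<omega> + s *\<^sub>R Z \<omega>) = r * A Y + s * A Z) \<and>
     (\<exists>C. \<forall>Y\<in>L2. \<bar>A Y\<bar> \<le> C * L2norm Y) \<and>
     (\<forall>e>0. \<exists>d>0. \<forall>Y\<in>L2. L2norm Y < d \<longrightarrow>
        \<bar>h (Law (\<lambda>\<omega>. X \<omega> + Y \<omega>)) - h (Law X) - A Y\<bar> \<le> e * L2norm Y)"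

definition L_differentiable ::
  "('x::euclidean_space measure \<Rightarrow> real) \<Rightarrow> 'x measure \<Rightarrow> bool" where
  "L_differentiable h \<mu> \<longleftrightarrow> (\<exists>X\<in>L2. Law X = \<mu> \<and> (\<exists>A. lift_has_derivative h X A))"

definition has_L_derivative ::
  "('x::euclidean_space measure \<Rightarrow> real) \<Rightarrow> 'x measure \<Rightarrow> ('x \<Rightarrow> 'x) \<Rightarrow> bool" where
  "has_L_derivative h \<mu> \<phi> \<longleftrightarrow>
     \<phi> \<in> borel_measurable borel \<and> integrable \<mu> (\<lambda>x. (norm (\<phi> x))\<^sup>2) \<and>
     (\<exists>X\<in>L2. Law X = \<mu> \<and> lift_has_derivative h X (\<lambda>Y. \<integral>\<omega>. \<phi> (X \<omega>) \<bullet> Y \<omega> \<partial>\<Omega>))"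

text \<open>The L-derivative of a map with values in a finite-dimensional space, by components (i.e.
  after applying any linear form \<open>l\<close>), as a linear map. At a given measure \<open>\<mu>\<close> it is determined
  \<open>\<mu>\<close>-almost everywhere only; \<open>LD\<close> denotes its unique jointly continuous version.\<close>

definition is_LD ::
  "('x::euclidean_space measure \<Rightarrow> 'y::real_normed_vector) \<Rightarrow> ('x measure \<Rightarrow> 'x \<Rightarrow> 'x \<Rightarrow>\<^sub>L 'y) \<Rightarrow> bool" where
  "is_LD F \<Phi> \<longleftrightarrow>
     (\<forall>\<mu>\<in>P2. \<forall>l :: 'y \<Rightarrow>\<^sub>L real. has_L_derivative (\<lambda>\<nu>. blinfun_apply l (F \<nu>)) \<mu>
        (\<lambda>x. riesz (\<lambda>u. blinfun_apply l (blinfun_apply (\<Phi> \<mu> x) u)))) \<and>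
     jcont UNIV \<Phi>"

definition LD ::
  "('x::euclidean_space measure \<Rightarrow> 'y::real_normed_vector) \<Rightarrow> 'x measure \<Rightarrow> 'x \<Rightarrow> 'x \<Rightarrow>\<^sub>L 'y" where
  "LD F = (SOME \<Phi>. is_LD F \<Phi>)"

section \<open>Partial derivatives of functions of state, measure and action\<close>

definition Dx ::
  "('x::euclidean_space \<Rightarrow> 'x measure \<Rightarrow> 'a::euclidean_space \<Rightarrow> 'y::real_normed_vector) \<Rightarrow>
   'x \<Rightarrow> 'x measure \<Rightarrow> 'a \<Rightarrow> 'x \<Rightarrow>\<^sub>L 'y" where
  "Dx F x \<mu> a = Dif (\<lambda>u. F u \<mu> a) x"

definition Da ::
  "('x::euclidean_space \<Rightarrow> 'x measure \<Rightarrow> 'a::euclidean_space \<Rightarrow> 'y::real_normed_vector) \<Rightarrow>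
   'x \<Rightarrow> 'x measure \<Rightarrow> 'a \<Rightarrow> 'a \<Rightarrow>\<^sub>L 'y" where
  "Da F x \<mu> a = Dif (\<lambda>b. F x \<mu> b) a"

definition Dm ::
  "('x::euclidean_space \<Rightarrow> 'x measure \<Rightarrow> 'a::euclidean_space \<Rightarrow> 'y::real_normed_vector) \<Rightarrow>
   'x \<Rightarrow> 'x measure \<Rightarrow> 'a \<Rightarrow> 'x \<Rightarrow> 'x \<Rightarrow>\<^sub>L 'y" where
  "Dm F x \<mu> a y = LD (\<lambda>\<nu>. F x \<nu> a) \<mu> y"

section \<open>Assumptions on the data\<close>

text \<open>The requirements on one second-order derivative \<open>Q\<close> of \<open>f\<close>. A derivative in which one or
  both of the extra space variables \<open>y\<close>, \<open>z\<close> do not occur is regarded as a function that ignores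
  them; taking \<open>y = y'\<close>, \<open>z = z'\<close> then removes the corresponding terms of the Lipschitz bound.\<close>

definition f_second_order ::
  "real \<Rightarrow> real \<Rightarrow>
   ('x::euclidean_space \<Rightarrow> 'x measure \<Rightarrow> 'a::euclidean_space \<Rightarrow> 'x \<Rightarrow> 'x \<Rightarrow> 'y::real_normed_vector) \<Rightarrow> bool" where
  "f_second_order lbf Lipf Q \<longleftrightarrow>
     jcont UNIV (\<lambda>\<mu> (x, a, y, z). Q x \<mu> a y z) \<and>
     (\<forall>x. \<forall>\<mu>\<in>P2. \<forall>a y z. norm (Q x \<mu> a y z) \<le> lbf / (1 + norm x + mnorm 1 \<mu>)) \<and>
     (\<forall>x x'. \<forall>\<mu>\<in>P2. \<forall>\<mu>'\<in>P2. \<forall>a a' y y' z z'.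
        norm (Q x \<mu> a y z - Q x' \<mu>' a' y' z') \<le>
          Lipf / (1 + max (norm x) (norm x') + max (mnorm 1 \<mu>) (mnorm 1 \<mu>')) *
          (norm (x - x') + W2 \<mu> \<mu>' + norm (a - a') + norm (y - y') + norm (z - z')))"

text \<open>In the names of constants, \<open>lam\<close> and \<open>Lam\<close> stand for a small and a capital lambda and \<open>lb\<close> for
  \<open>l\<close> with a bar. Mixed derivatives compose from right to left: \<open>Dm (Da f)\<close> is the L-derivative of
  the derivative in the action.\<close>

definition a1 ::
  "(real^'n \<Rightarrow> (real^'n) measure \<Rightarrow> real^'a \<Rightarrow> real^'n) \<Rightarrow> real \<Rightarrow> real \<Rightarrow> real \<Rightarrow> real \<Rightarrow> bool" where
  "a1 f lamf Lamf lbf Lipf \<longleftrightarrow>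
     lamf > 0 \<and> Lamf > 0 \<and> lbf > 0 \<and> Lipf > 0 \<and>
     (\<forall>\<mu>\<in>P2. twice_differentiable (\<lambda>(x, a). f x \<mu> a)) \<and>
     (\<forall>x a. \<exists>\<Phi>. is_LD (\<lambda>\<mu>. Da f x \<mu> a) \<Phi>) \<and>
     (\<forall>x. \<forall>\<mu>\<in>P2. \<forall>a y. (\<lambda>u. Dm f u \<mu> a y) differentiable (at x)) \<and>
     (\<forall>x. \<forall>\<mu>\<in>P2. \<forall>a y. Dm f x \<mu> a differentiable (at y)) \<and>
     jcont UNIV (\<lambda>\<mu> (x, a). Dx f x \<mu> a) \<and>
     jcont UNIV (\<lambda>\<mu> (x, a). Da f x \<mu> a) \<and>
     jcont UNIV (\<lambda>\<mu> (x, a, y). Dm f x \<mu> a y) \<and>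
     (\<forall>x. \<forall>\<mu>\<in>P2. \<forall>a \<xi>.
        (\<Sum>i\<in>UNIV. \<Sum>j\<in>UNIV. (\<xi> $ i *\<^sub>R grad (\<lambda>b. f x \<mu> b $ i) a) \<bullet> (\<xi> $ j *\<^sub>R grad (\<lambda>b. f x \<mu> b $ j) a))
          \<ge> lamf * (norm \<xi>)\<^sup>2) \<and>
     (\<forall>x. \<forall>\<mu>\<in>P2. \<forall>a y.
        max (max (norm (Da f x \<mu> a)) (norm (Dm f x \<mu> a y))) (norm (Dx f x \<mu> a)) \<le> Lamf) \<and>
     (\<exists>D2. (\<forall>x a. regular2 (\<lambda>\<mu>. f x \<mu> a) (D2 x a)) \<and>
        f_second_order lbf Lipf (\<lambda>x \<mu> a y z. dd (D2 x a \<mu>) y z)) \<and>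
     f_second_order lbf Lipf (\<lambda>x \<mu> a y z. Da (Da f) x \<mu> a) \<and>
     f_second_order lbf Lipf (\<lambda>x \<mu> a y z. Dm (Da f) x \<mu> a y) \<and>
     f_second_order lbf Lipf (\<lambda>x \<mu> a y z. Da (Dx f) x \<mu> a) \<and>
     f_second_order lbf Lipf (\<lambda>x \<mu> a y z. Dx (Dx f) x \<mu> a) \<and>
     f_second_order lbf Lipf (\<lambda>x \<mu> a y z. Dif (Dm f x \<mu> a) y) \<and>
     f_second_order lbf Lipf (\<lambda>x \<mu> a y z. Dx (\<lambda>x \<mu> a. Dm f x \<mu> a y) x \<mu> a)"

text \<open>Twice differentiability of \<open>G_of g\<close> (and of \<open>K_of k\<close>) in \<open>x\<close>, implicit in the convexity condition,
  is stated explicitly below.\<close>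

definition G_of ::
  "(real^'n \<Rightarrow> (real^'n) measure \<Rightarrow> real^'a \<Rightarrow> real) \<Rightarrow> real^'n \<Rightarrow> (real^'n) measure \<Rightarrow> real^'a \<Rightarrow> real" where
  "G_of g x \<mu> a = g x \<mu> a + (\<integral>y. lfd (\<lambda>\<nu>. g y \<nu> a) \<mu> x \<partial>\<mu>)"

definition a2 ::
  "(real^'n \<Rightarrow> (real^'n) measure \<Rightarrow> real^'a \<Rightarrow> real) \<Rightarrow> real \<Rightarrow> real \<Rightarrow> real \<Rightarrow> real \<Rightarrow> bool" where
  "a2 g lamg Lamg lbg lg \<longleftrightarrow>
     lamg > 0 \<and> Lamg > 0 \<and> lbg > 0 \<and> lg \<ge> 0 \<and>
     (\<forall>\<mu>\<in>P2. twice_differentiable (\<lambda>(x, a). g x \<mu> a)) \<and>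
     (\<forall>x. \<forall>\<mu>\<in>P2. \<forall>a y. (\<lambda>u. Dm g u \<mu> a y) differentiable (at x)) \<and>
     (\<forall>x. \<forall>\<mu>\<in>P2. \<forall>a y. (\<lambda>b. Dm g x \<mu> b y) differentiable (at a)) \<and>
     (\<forall>x. \<forall>\<mu>\<in>P2. \<forall>a y. Dm g x \<mu> a differentiable (at y)) \<and>
     (\<exists>D2. (\<forall>x a. regular2 (\<lambda>\<mu>. g x \<mu> a) (D2 x a)) \<and>
        jlipschitz (\<lambda>\<mu> (x, a, y, z). dd (D2 x a \<mu>) y z) \<and>
        (\<forall>x. \<forall>\<mu>\<in>P2. \<forall>a y z. norm (dd (D2 x a \<mu>) y z) \<le> Lamg)) \<and>
     jlipschitz (\<lambda>\<mu> (x, a). Da (Da g) x \<mu> a) \<and>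
     jlipschitz (\<lambda>\<mu> (x, a, y). Dx (\<lambda>x \<mu> a. Dm g x \<mu> a y) x \<mu> a) \<and>
     jlipschitz (\<lambda>\<mu> (x, a). Dx (Dx g) x \<mu> a) \<and>
     jlipschitz (\<lambda>\<mu> (x, a, y). Dif (Dm g x \<mu> a) y) \<and>
     jlipschitz (\<lambda>\<mu> (x, a). Dx (Da g) x \<mu> a) \<and>
     jlipschitz (\<lambda>\<mu> (x, a, y). Da (\<lambda>x \<mu> a. Dm g x \<mu> a y) x \<mu> a) \<and>
     (\<forall>x. \<forall>\<mu>\<in>P2. \<forall>a y.
        norm (Da (Da g) x \<mu> a) \<le> Lamg \<and>
        norm (Dx (\<lambda>x \<mu> a. Dm g x \<mu> a y) x \<mu> a) \<le> Lamg \<and>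
        norm (Dx (Dx g) x \<mu> a) \<le> Lamg \<and>
        norm (Dif (Dm g x \<mu> a) y) \<le> Lamg \<and>
        norm (Dx (Da g) x \<mu> a) \<le> lbg \<and>
        norm (Da (\<lambda>x \<mu> a. Dm g x \<mu> a y) x \<mu> a) \<le> lbg) \<and>
     (\<forall>x. \<forall>\<mu>\<in>P2. \<forall>a \<xi>.
        blinfun_apply (blinfun_apply (Da (Da g) x \<mu> a) \<xi>) \<xi> \<ge> lamg * (norm \<xi>)\<^sup>2) \<and>
     (\<forall>\<mu>\<in>P2. \<forall>a. twice_differentiable (\<lambda>x. G_of g x \<mu> a)) \<and>
     (\<forall>x. \<forall>\<mu>\<in>P2. \<forall>a \<xi>.
        blinfun_apply (blinfun_apply (Dx (Dx (G_of g)) x \<mu> a) \<xi>) \<xi> \<ge> lamg * (norm \<xi>)\<^sup>2) \<and>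
     (\<forall>\<mu>\<in>P2. \<forall>\<mu>'\<in>P2. \<forall>a.
        dint \<mu>' \<mu> (\<lambda>x. G_of g x \<mu>' a - G_of g x \<mu> a) \<ge> - lg * (norm (dint \<mu> \<mu>' (\<lambda>y. y)))\<^sup>2) \<and>
     lg \<le> lamg / 2"

definition K_of ::
  "(real^'n \<Rightarrow> (real^'n) measure \<Rightarrow> real) \<Rightarrow> real^'n \<Rightarrow> (real^'n) measure \<Rightarrow> real" where
  "K_of k x \<mu> = k x \<mu> + (\<integral>y. lfd (k y) \<mu> x \<partial>\<mu>)"

definition a3 ::
  "(real^'n \<Rightarrow> (real^'n) measure \<Rightarrow> real) \<Rightarrow> real \<Rightarrow> real \<Rightarrow> real \<Rightarrow> bool" where
  "a3 k lamk Lamk lk \<longleftrightarrow>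
     lamk > 0 \<and> Lamk > 0 \<and> lk \<ge> 0 \<and>
     (\<forall>\<mu>\<in>P2. twice_differentiable (\<lambda>x. k x \<mu>)) \<and>
     (\<forall>x. \<forall>\<mu>\<in>P2. \<forall>y. (\<lambda>u. LD (k u) \<mu> y) differentiable (at x)) \<and>
     (\<forall>x. \<forall>\<mu>\<in>P2. \<forall>y. LD (k x) \<mu> differentiable (at y)) \<and>
     (\<exists>D2. (\<forall>x. regular2 (k x) (D2 x)) \<and>
        jlipschitz (\<lambda>\<mu> (x, y, z). dd (D2 x \<mu>) y z) \<and>
        (\<forall>x. \<forall>\<mu>\<in>P2. \<forall>y z. norm (dd (D2 x \<mu>) y z) \<le> Lamk)) \<and>
     jlipschitz (\<lambda>\<mu> (x, y). Dif (\<lambda>u. LD (k u) \<mu> y) x) \<and>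
     jlipschitz (\<lambda>\<mu> x. Dif (Dif (\<lambda>u. k u \<mu>)) x) \<and>
     jlipschitz (\<lambda>\<mu> (x, y). Dif (LD (k x) \<mu>) y) \<and>
     (\<forall>x. \<forall>\<mu>\<in>P2. \<forall>y.
        norm (Dif (\<lambda>u. LD (k u) \<mu> y) x) \<le> Lamk \<and>
        norm (Dif (Dif (\<lambda>u. k u \<mu>)) x) \<le> Lamk \<and>
        norm (Dif (LD (k x) \<mu>) y) \<le> Lamk) \<and>
     (\<forall>\<mu>\<in>P2. twice_differentiable (\<lambda>x. K_of k x \<mu>)) \<and>
     (\<forall>x. \<forall>\<mu>\<in>P2. \<forall>\<xi>.
        blinfun_apply (blinfun_apply (Dif (Dif (\<lambda>u. K_of k u \<mu>)) x) \<xi>) \<xi> \<ge> lamk * (norm \<xi>)\<^sup>2) \<and>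
     (\<forall>\<mu>\<in>P2. \<forall>\<mu>'\<in>P2.
        dint \<mu>' \<mu> (\<lambda>x. K_of k x \<mu>' - K_of k x \<mu>) \<ge> - lk * (norm (dint \<mu> \<mu>' (\<lambda>y. y)))\<^sup>2) \<and>
     lk \<le> lamk / 2"

definition h1 ::
  "(real^'n \<Rightarrow> (real^'n) measure \<Rightarrow> real^'a \<Rightarrow> real^'n) \<Rightarrow>
   (real^'n \<Rightarrow> (real^'n) measure \<Rightarrow> real^'a \<Rightarrow> real) \<Rightarrow>
   (real^'n \<Rightarrow> (real^'n) measure \<Rightarrow> real) \<Rightarrow> bool" where
  "h1 f g k \<longleftrightarrow>
     f 0 dirac0 0 = 0 \<and>
     Dx g 0 dirac0 0 = 0 \<and> Da g 0 dirac0 0 = 0 \<and> Dm g 0 dirac0 0 0 = 0 \<and>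
     Dif (\<lambda>x. k x dirac0) 0 = 0 \<and> LD (k 0) dirac0 0 = 0"

section \<open>Constants\<close>

definition Lbar_k :: "real \<Rightarrow> real" where "Lbar_k Lamk = 3 * Lamk"

definition lam_z :: "real \<Rightarrow> real \<Rightarrow> real \<Rightarrow> real" where
  "lam_z lamf lamg Lamg = lamf\<^sup>2 / (Lamg + lamg / 20)"

definition lam_x :: "real \<Rightarrow> real" where "lam_x lamg = 17 / 20 * lamg"

definition lambar_k :: "real \<Rightarrow> real" where "lambar_k lamk = lamk / 4"

definition lambar_z :: "real \<Rightarrow> real \<Rightarrow> real \<Rightarrow> real" where
  "lambar_z lamf lamg Lamg = lam_z lamf lamg Lamg / 2"

definition lambar_x :: "real \<Rightarrow> real" where "lambar_x lamg = lamg / 40"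

definition kappa1 :: "real \<Rightarrow> real \<Rightarrow> real \<Rightarrow> real \<Rightarrow> real" where
  "kappa1 lamf lamg Lamg lamk = Min {lamk / 4, lam_z lamf lamg Lamg / 2, lamg / 40}"

definition kappa2 :: "real \<Rightarrow> real \<Rightarrow> real \<Rightarrow> real \<Rightarrow> real" where
  "kappa2 lamf lamg Lamg lamk = Min {lamk / 4, lam_z lamf lamg Lamg / 4, lamg / 5}"

definition L1_star :: "real \<Rightarrow> real \<Rightarrow> real \<Rightarrow> real \<Rightarrow> real \<Rightarrow> real \<Rightarrow> real" where
  "L1_star lamf Lamf lamg Lamg lamk Lamk = Max
     {4 * Lamk\<^sup>2 / lamk,
      1 / lam_z lamf lamg Lamg * (2 * Lamg + 3 / 20 * lamg),
      1 / lam_x lamg * (5 / 2 * Lamf + 2 * Lamg + 3 / 20 * lamg)}"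

definition L4_star :: "real \<Rightarrow> real \<Rightarrow> real \<Rightarrow> real \<Rightarrow> real \<Rightarrow> real \<Rightarrow> real" where
  "L4_star lamf Lamf lamg Lamg lamk Lamk = (let \<kappa> = kappa1 lamf lamg Lamg lamk in Max
     {Lamk\<^sup>2 / (\<kappa> * lamk),
      1 / (4 * \<kappa> * lam_x lamg) * (25 / 16 * Lamf\<^sup>2 + (2 * Lamg + 1 / 5 * lamg)\<^sup>2)})"

definition L5_star :: "real \<Rightarrow> real \<Rightarrow> real \<Rightarrow> real \<Rightarrow> real \<Rightarrow> real \<Rightarrow> real" where
  "L5_star lamf Lamf lamg Lamg lamk Lamk = (let \<kappa> = kappa2 lamf lamg Lamg lamk in Max
     {9 * Lamk\<^sup>2 / (4 * \<kappa> * lambar_k lamk),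
      25 * Lamf\<^sup>2 / (64 * \<kappa> * lambar_z lamf lamg Lamg),
      1 / (4 * \<kappa> * lambar_x lamg) * (25 / 16 * Lamf\<^sup>2 + 9 * (1 / 10 * lamg + Lamg)\<^sup>2)})"

definition L6_star :: "real \<Rightarrow> real \<Rightarrow> real \<Rightarrow> real \<Rightarrow> real \<Rightarrow> real \<Rightarrow> real" where
  "L6_star lamf Lamf lamg Lamg lamk Lamk = Max
     {27 * Lamk\<^sup>2 / lambar_k lamk,
      (Lamg + lamg / 10) / lambar_x lamg,
      (Lamg + lamg / 10) / lambar_z lamf lamg Lamg,
      12 * Lamk\<^sup>2 / lamk,
      (2 * Lamg + lamg / 5) / lam_x lamg,
      6 * Lamk\<^sup>2 / lambar_k lamk,
      (2 * Lamg + 3 * lamg / 20) / lambar_x lamg,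
      (15 / 4 * Lamf + 7 * Lamg + 13 / 20 * lamg) / lambar_z lamf lamg Lamg}"

definition L0_star :: "nat \<Rightarrow> real \<Rightarrow> real \<Rightarrow> real \<Rightarrow> real \<Rightarrow> real \<Rightarrow> real \<Rightarrow> real" where
  "L0_star dx lamf Lamf lamg Lamg lamk Lamk =
     (let L1 = L1_star lamf Lamf lamg Lamg lamk Lamk;
          L4 = L4_star lamf Lamf lamg Lamg lamk Lamk;
          L5 = L5_star lamf Lamf lamg Lamg lamk Lamk;
          L6 = L6_star lamf Lamf lamg Lamg lamk Lamk
      in real dx * max L1 (sqrt ((L4 * (2 + L5) + 1) * L1 * L6)))"

definition h2 ::
  "nat \<Rightarrow> real \<Rightarrow> real \<Rightarrow> real \<Rightarrow> real \<Rightarrow> real \<Rightarrow> real \<Rightarrow> real \<Rightarrow> real \<Rightarrow> bool" where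
  "h2 dx lamf Lamf lbf lamg Lamg lbg lamk Lamk \<longleftrightarrow>
     8 * lbg \<le> lamg \<and>
     lbf \<le> lamg / (40 * max (Lbar_k Lamk) (L0_star dx lamf Lamf lamg Lamg lamk Lamk))"

section \<open>The Bellman equation\<close>

text \<open>\<open>LEAST\<close> is the minimum over all actions.\<close>

definition hamiltonian ::
  "(real^'n \<Rightarrow> (real^'n) measure \<Rightarrow> real^'a \<Rightarrow> real^'n) \<Rightarrow>
   (real^'n \<Rightarrow> (real^'n) measure \<Rightarrow> real^'a \<Rightarrow> real) \<Rightarrow>
   real^'n \<Rightarrow> (real^'n) measure \<Rightarrow> real^'n \<Rightarrow> real" where
  "hamiltonian f g x \<mu> z = (LEAST r. r \<in> range (\<lambda>a. f x \<mu> a \<bullet> z + g x \<mu> a))"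

text \<open>\<open>vt\<close> and \<open>vm\<close> are the time derivative and the L-derivative of \<open>v\<close>; differentiability in
  \<open>t\<close> is one-sided at the end points of \<open>[0,T]\<close>.\<close>

definition regular_solution ::
  "real \<Rightarrow>
   (real^'n \<Rightarrow> (real^'n) measure \<Rightarrow> real^'a \<Rightarrow> real^'n) \<Rightarrow>
   (real^'n \<Rightarrow> (real^'n) measure \<Rightarrow> real^'a \<Rightarrow> real) \<Rightarrow>
   (real^'n \<Rightarrow> (real^'n) measure \<Rightarrow> real) \<Rightarrow>
   (real \<Rightarrow> (real^'n) measure \<Rightarrow> real) \<Rightarrow> bool" where
  "regular_solution T f g k v \<longleftrightarrow> (\<exists>vt vm.
     (\<forall>t\<in>{0..T}. \<forall>m\<in>P2.
        ((\<lambda>s. v s m) has_real_derivative vt t m) (at t within {0..T}) \<and>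
        has_L_derivative (v t) m (vm t m)) \<and>
     jcont {0..T} (\<lambda>m t. vt t m) \<and>
     jcont ({0..T} \<times> UNIV) (\<lambda>m (t, x). vm t m x) \<and>
     (\<forall>t\<in>{0..T}. \<forall>m\<in>P2.
        (\<lambda>s. vt s m) differentiable (at t within {0..T}) \<and> L_differentiable (vt t) m) \<and>
     (\<forall>t\<in>{0..T}. \<forall>m\<in>P2. \<forall>x.
        (\<lambda>s. vm s m x) differentiable (at t within {0..T}) \<and>
        vm t m differentiable (at x) \<and>
        (\<forall>i. L_differentiable (\<lambda>\<nu>. vm t \<nu> x $ i) m)) \<and>
     (\<forall>t\<in>{0..T}. \<forall>m\<in>P2. vt t m + (\<integral>x. hamiltonian f g x m (vm t m x) \<partial>m) = 0) \<and>
     (\<forall>m\<in>P2. v T m = (\<integral>x. k x m \<partial>m)))"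

end

theory Submission
  imports Defs
begin

text \<open>A classical solution is compared with another one by a verification argument on finitely supported
  laws \<open>m = \<Sum>\<^sub>i q\<^sub>i \<delta>\<^bsub>x\<^sub>i\<^esub>\<close>, on which the Bellman equation is a Hamilton--Jacobi equation in finitely many
  variables. Following for one solution \<open>v\<^sub>2\<close> the Euler polygons with optimal actions, \<open>v\<^sub>2\<close> decreases at the
  rate of the running cost, while any other solution \<open>v\<^sub>1\<close> decreases at most at that rate, up to errors
  that vanish with the step size; as both agree at time \<open>T\<close>, this gives \<open>v\<^sub>1 \<le> v\<^sub>2\<close>. The point is that no growth
  of the solutions is assumed, so that one has to keep the polygons in a compact set independent of
  the step size. A polygon shifted by a constant is suboptimal for \<open>v\<^sub>2\<close>; comparing the costs shows that
  the gradient of \<open>v\<^sub>2\<close> along the polygon obeys an approximate adjoint equation with coefficients of linear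
  growth, and a discrete Gronwall inequality bounds positions and gradients together. Finally, finitely
  supported laws are dense and the solutions are continuous.

  Optimal actions exist for every value of the gradient, because \<open>g\<close> is strongly convex in the action
  and \<open>f\<close> grows at most linearly; they need not be unique or depend continuously on the state. The growth of
  \<open>g\<close> in the measure comes from its second-order linear functional derivative.\<close>

section \<open>Comparison of classical solutions in finite dimension\<close>

text \<open>A polygon needs one minimiser per node and per label, so no feedback map has to be
  selected. Particles carry labels because they may meet and must still be displaced separately.

  The a priori bound looks circular: expansions of \<open>u2\<close> are uniform on bounded sets
  only, while staying in such a set is the claim. The circle is broken by fixing the radius
  \<open>R\<close> from the data and the initial values alone. The test shift has a fixed size
  \<open>\<delta>\<close> instead of an infinitesimal one, so \<open>u2\<close> need only be C^1:
  linearising at both ends of the polygon and summing the Euler errors costs at most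
  \<open>3 * \<delta>\<close>, and division by \<open>\<delta>\<close> leaves the absolute constant
  3, for which \<open>K0\<close> has made room. The induction uses the bound at earlier nodes only.

  An L-derivative is known at some random vector with the given law, which need not be the chosen
  one. All perturbations are therefore arranged so that the perturbed law does not depend on the
  representative: by relabelling for configurations, by moving a single atom for uniqueness of
  L-derivatives.\<close>

definition csize :: "'i set \<Rightarrow> ('i \<Rightarrow> 'e::real_normed_vector) \<Rightarrow> real" where
  "csize I x = (\<Sum>i\<in>I. norm (x i))"

text \<open>The differential of a function of the law sum_i q_i delta_{x_i}: moving the atom at x_i
  with velocity y_i changes it at the rate q_i (p_i . y_i), where p_i is the value of the
  L-derivative at x_i. The field \<open>Z\<close> below is thus the L-derivative; the Euclidean
  gradient in the position of label i is q_i Z_i.\<close>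

definition cpair :: "'i set \<Rightarrow> ('i \<Rightarrow> real) \<Rightarrow> ('i \<Rightarrow> 'e::real_inner) \<Rightarrow> ('i \<Rightarrow> 'e) \<Rightarrow> real" where
  "cpair I q p y = (\<Sum>i\<in>I. q i * (p i \<bullet> y i))"

lemma csize_nonneg: "0 \<le> csize I x"
  unfolding csize_def by (simp add: sum_nonneg)

lemma norm_le_csize: "finite I \<Longrightarrow> i \<in> I \<Longrightarrow> norm (x i) \<le> csize I x"
  unfolding csize_def by (rule member_le_sum) auto

lemma csize_add: "csize I (\<lambda>i. x i + y i) \<le> csize I x + csize I y"
  unfolding csize_def sum.distrib[symmetric] by (intro sum_mono norm_triangle_ineq)

lemma csize_triangle: "csize I x \<le> csize I (\<lambda>i. x i - y i) + csize I y"
  using csize_add[of I "\<lambda>i. x i - y i" y] by simp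

lemma csize_scaleR: "csize I (\<lambda>i. r *\<^sub>R x i) = \<bar>r\<bar> * csize I x"
  unfolding csize_def by (simp add: sum_distrib_left)

lemma cpair_diff_left: "cpair I q (\<lambda>i. p i - p' i) y = cpair I q p y - cpair I q p' y"
  unfolding cpair_def by (simp add: inner_diff_left algebra_simps sum_subtractf)

lemma cpair_diff_right: "cpair I q p (\<lambda>i. y i - y' i) = cpair I q p y - cpair I q p y'"
  unfolding cpair_def by (simp add: inner_diff_right algebra_simps sum_subtractf)

lemma cpair_scaleR_right: "cpair I q p (\<lambda>i. r *\<^sub>R y i) = r * cpair I q p y"
  unfolding cpair_def by (simp add: sum_distrib_left algebra_simps)

lemma cpair_bound:
  assumes "finite I" "\<And>i. i \<in> I \<Longrightarrow> 0 \<le> q i \<and> q i \<le> 1" "\<And>i. i \<in> I \<Longrightarrow> norm (y i) \<le> c"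
  shows "\<bar>cpair I q p y\<bar> \<le> csize I p * c"
proof -
  have "\<bar>cpair I q p y\<bar> \<le> (\<Sum>i\<in>I. \<bar>q i * (p i \<bullet> y i)\<bar>)"
    unfolding cpair_def by (rule sum_abs)
  also have "\<dots> \<le> (\<Sum>i\<in>I. norm (p i) * c)"
  proof (rule sum_mono)
    fix i assume i: "i \<in> I"
    have "\<bar>q i * (p i \<bullet> y i)\<bar> \<le> 1 * \<bar>p i \<bullet> y i\<bar>"
      unfolding abs_mult using assms(2)[OF i] by (intro mult_right_mono) auto
    also have "\<dots> \<le> norm (p i) * norm (y i)" using Cauchy_Schwarz_ineq2 by simp
    also have "\<dots> \<le> norm (p i) * c" using assms(3)[OF i] by (intro mult_left_mono) auto
    finally show "\<bar>q i * (p i \<bullet> y i)\<bar> \<le> norm (p i) * c" .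
  qed
  finally show ?thesis by (simp add: csize_def sum_distrib_right)
qed

section \<open>Uniform continuity and first-order expansions on configurations\<close>

lemma bounded_config_convergent_subseq:
  fixes x :: "nat \<Rightarrow> 'i \<Rightarrow> 'e::euclidean_space"
  assumes "finite J" "\<And>k i. i \<in> J \<Longrightarrow> norm (x k i) \<le> R"
  shows "\<exists>r::nat\<Rightarrow>nat. strict_mono r \<and> (\<exists>l. \<forall>i\<in>J. (\<lambda>k. x (r k) i) \<longlonglongrightarrow> l i)"
  using assms
proof (induction J rule: finite_induct)
  case empty
  then show ?case by (intro exI[of _ id]) (auto simp: strict_mono_def)
next
  case (insert j J)
  then obtain r l where r: "strict_mono (r::nat\<Rightarrow>nat)" and l: "\<forall>i\<in>J. (\<lambda>k. x (r k) i) \<longlonglongrightarrow> l i"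
    by auto
  have "\<forall>k. x (r k) j \<in> cball 0 R" using insert.prems by auto
  then obtain l' r' where r': "strict_mono (r'::nat\<Rightarrow>nat)" and l': "((\<lambda>k. x (r k) j) \<circ> r') \<longlonglongrightarrow> l'"
    using compact_cball[of "0::'e" R] unfolding compact_def by meson
  show ?case
  proof (intro exI conjI ballI)
    show "strict_mono (r \<circ> r')" using r r' by (rule strict_mono_o)
    fix i assume i: "i \<in> insert j J"
    show "(\<lambda>k. x ((r \<circ> r') k) i) \<longlonglongrightarrow> (l(j := l')) i"
    proof (cases "i = j")
      case True then show ?thesis using l' by (simp add: o_def)
    next
      case False
      then have "i \<in> J" using i by auto
      from LIMSEQ_subseq_LIMSEQ[OF bspec[OF l this] r'] False show ?thesis by (simp add: o_def)
    qed
  qed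
qed

text \<open>Continuity is tested by sequences that converge at the labels in \<open>I\<close>.
  Constant sequences show that, for times in [0,T], such an \<open>F\<close> depends on a
  configuration only through its values on \<open>I\<close>.\<close>

definition config_cont ::
  "'i set \<Rightarrow> real \<Rightarrow> (real \<Rightarrow> ('i \<Rightarrow> 'e::euclidean_space) \<Rightarrow> 'y::metric_space) \<Rightarrow> bool" where
  "config_cont I T F \<longleftrightarrow> (\<forall>s t x y. (\<forall>k. s k \<in> {0..T}) \<longrightarrow> t \<in> {0..T} \<longrightarrow> s \<longlonglongrightarrow> t \<longrightarrow>
     (\<forall>i\<in>I. (\<lambda>k::nat. x k i) \<longlonglongrightarrow> y i) \<longrightarrow> (\<lambda>k. F (s k) (x k)) \<longlonglongrightarrow> F t y)"

text \<open>Heine-Cantor: violations at distance 1/(k+1) stay bounded, so along a subsequence both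
  arguments converge, and to the same limit, where continuity forces the values together.\<close>

lemma config_cont_uniform:
  fixes F :: "real \<Rightarrow> ('i \<Rightarrow> 'e::euclidean_space) \<Rightarrow> 'y::metric_space"
  assumes I: "finite I" and F: "config_cont I T F" and e: "e > 0"
  shows "\<exists>d>0. \<forall>t\<in>{0..T}. \<forall>s\<in>{0..T}. \<forall>x y. csize I x \<le> R \<longrightarrow> csize I y \<le> R \<longrightarrow>
     \<bar>s - t\<bar> \<le> d \<longrightarrow> csize I (\<lambda>i. y i - x i) \<le> d \<longrightarrow> dist (F t x) (F s y) < e"
proof (rule ccontr)
  assume neg: "\<not> ?thesis"
  define P where "P k w \<longleftrightarrow> (case w of (t, s, x, y) \<Rightarrow> t \<in> {0..T} \<and> s \<in> {0..T} \<and> csize I x \<le> R \<and> csize I y \<le> R \<and>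
     \<bar>s - t\<bar> \<le> 1 / real (Suc k) \<and> csize I (\<lambda>i. y i - x i) \<le> 1 / real (Suc k) \<and> \<not> dist (F t x) (F s y) < e)" for k w
  have "\<exists>w. P k w" for k
  proof -
    have "(1 / real (Suc k)) > 0" by simp
    then show ?thesis unfolding P_def split_paired_Ex prod.case using neg by blast
  qed
  then obtain w where w: "\<And>k. P k (w k)" by metis
  define t where "t k = fst (w k)" for k
  define s where "s k = fst (snd (w k))" for k
  define x where "x k = fst (snd (snd (w k)))" for k
  define y where "y k = snd (snd (snd (w k)))" for k
  have ts: "\<And>k. t k \<in> {0..T}" "\<And>k. s k \<in> {0..T}" and
    xy: "\<And>k. csize I (x k) \<le> R" "\<And>k. csize I (y k) \<le> R" and
    close: "\<And>k. \<bar>s k - t k\<bar> \<le> 1 / real (Suc k)" "\<And>k. csize I (\<lambda>i. y k i - x k i) \<le> 1 / real (Suc k)" and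
    far: "\<And>k. \<not> dist (F (t k) (x k)) (F (s k) (y k)) < e"
    using w unfolding P_def t_def s_def x_def y_def by (simp_all add: case_prod_beta)
  have "norm (x k i) \<le> R" if "i \<in> I" for k i
    using norm_le_csize[OF I that, of "x k"] xy(1)[of k] by linarith
  with bounded_config_convergent_subseq[OF I, of x R]
  obtain r :: "nat \<Rightarrow> nat" and l where r: "strict_mono r" and l: "\<forall>i\<in>I. (\<lambda>k. x (r k) i) \<longlonglongrightarrow> l i" by blast
  have "\<forall>k. t (r k) \<in> {0..T}" using ts by auto
  then obtain t0 r' where t0: "t0 \<in> {0..T}" and r': "strict_mono (r'::nat\<Rightarrow>nat)" and lt: "((\<lambda>k. t (r k)) \<circ> r') \<longlonglongrightarrow> t0"
    using compact_Icc[of 0 T] unfolding compact_def by meson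
  define p where "p = r \<circ> r'"
  have p: "strict_mono p" unfolding p_def using r r' by (rule strict_mono_o)
  have tp: "(\<lambda>k. t (p k)) \<longlonglongrightarrow> t0" using lt by (simp add: p_def o_def)
  have xp: "\<forall>i\<in>I. (\<lambda>k. x (p k) i) \<longlonglongrightarrow> l i"
    using LIMSEQ_subseq_LIMSEQ[OF bspec[OF l] r'] by (auto simp: p_def o_def)
  have z: "(\<lambda>k. 1 / real (Suc (p k))) \<longlonglongrightarrow> 0"
    using LIMSEQ_subseq_LIMSEQ[OF LIMSEQ_inverse_real_of_nat p] by (simp add: o_def inverse_eq_divide)
  have "(\<lambda>k. s (p k) - t (p k)) \<longlonglongrightarrow> 0"
    by (rule tendsto_rabs_zero_cancel, rule tendsto_sandwich[OF _ _ tendsto_const z]) (use close(1) in auto)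
  from tendsto_add[OF this tp] have sp: "(\<lambda>k. s (p k)) \<longlonglongrightarrow> t0" by simp
  have yp: "\<forall>i\<in>I. (\<lambda>k. y (p k) i) \<longlonglongrightarrow> l i"
  proof
    fix i assume i: "i \<in> I"
    have "norm (y (p k) i - x (p k) i) \<le> 1 / real (Suc (p k))" for k
      using norm_le_csize[OF I i, of "\<lambda>i. y (p k) i - x (p k) i"] close(2)[of "p k"] by linarith
    then have "(\<lambda>k. y (p k) i - x (p k) i) \<longlonglongrightarrow> 0"
      by (intro Lim_null_comparison[OF _ z] always_eventually) auto
    from tendsto_add[OF this bspec[OF xp i]] show "(\<lambda>k. y (p k) i) \<longlonglongrightarrow> l i" by simp
  qed
  have "(\<lambda>k. F (t (p k)) (x (p k))) \<longlonglongrightarrow> F t0 l" "(\<lambda>k. F (s (p k)) (y (p k))) \<longlonglongrightarrow> F t0 l"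
    using F[unfolded config_cont_def, rule_format, of "\<lambda>k. t (p k)" t0 "\<lambda>k. x (p k)" l]
      F[unfolded config_cont_def, rule_format, of "\<lambda>k. s (p k)" t0 "\<lambda>k. y (p k)" l]
      ts t0 tp sp xp yp by auto
  from tendsto_dist[OF this] have "(\<lambda>k. dist (F (t (p k)) (x (p k))) (F (s (p k)) (y (p k)))) \<longlonglongrightarrow> 0" by simp
  from order_tendstoD(2)[OF this e] have "\<forall>\<^sub>F k in sequentially. dist (F (t (p k)) (x (p k))) (F (s (p k)) (y (p k))) < e" .
  then show False using far by (auto simp: eventually_sequentially)
qed

text \<open>Spatial differentiability is asked along lines only, in the form in which an
  L-derivative provides it; continuity of \<open>Z\<close> turns this into the uniform expansion of
  \<open>config_C1_expansion\<close>.\<close>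

definition config_C1 ::
  "'i set \<Rightarrow> ('i \<Rightarrow> real) \<Rightarrow> real \<Rightarrow> (real \<Rightarrow> ('i \<Rightarrow> 'e::euclidean_space) \<Rightarrow> real) \<Rightarrow>
   (real \<Rightarrow> ('i \<Rightarrow> 'e) \<Rightarrow> real) \<Rightarrow> (real \<Rightarrow> ('i \<Rightarrow> 'e) \<Rightarrow> 'i \<Rightarrow> 'e) \<Rightarrow> bool" where
  "config_C1 I q T u ut Z \<longleftrightarrow>
     (\<forall>t\<in>{0..T}. \<forall>x. ((\<lambda>s. u s x) has_real_derivative ut t x) (at t within {0..T})) \<and>
     (\<forall>t\<in>{0..T}. \<forall>x y. ((\<lambda>r. u t (\<lambda>i. x i + r *\<^sub>R y i)) has_real_derivative cpair I q (Z t x) y) (at 0)) \<and>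
     config_cont I T ut \<and> (\<forall>i\<in>I. config_cont I T (\<lambda>t x. Z t x i))"

lemma config_C1_Z_uniform:
  fixes u :: "real \<Rightarrow> ('i \<Rightarrow> 'e::euclidean_space) \<Rightarrow> real"
  assumes I: "finite I" and u: "config_C1 I q T u ut Z" and e: "e > 0"
  shows "\<exists>d>0. \<forall>t\<in>{0..T}. \<forall>s\<in>{0..T}. \<forall>x y. csize I x \<le> R \<longrightarrow> csize I y \<le> R \<longrightarrow>
     \<bar>s - t\<bar> \<le> d \<longrightarrow> csize I (\<lambda>i. y i - x i) \<le> d \<longrightarrow> (\<forall>i\<in>I. norm (Z s y i - Z t x i) < e)"
proof -
  define P where "P i d \<longleftrightarrow> (\<forall>t\<in>{0..T}. \<forall>s\<in>{0..T}. \<forall>x y. csize I x \<le> R \<longrightarrow> csize I y \<le> R \<longrightarrow>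
     \<bar>s - t\<bar> \<le> d \<longrightarrow> csize I (\<lambda>i. y i - x i) \<le> d \<longrightarrow> norm (Z s y i - Z t x i) < e)" for i d
  have "\<exists>d>0. P i d" if "i \<in> I" for i
    using config_cont_uniform[OF I _ e, of T "\<lambda>t x. Z t x i" R] u that
    unfolding config_C1_def P_def by (auto simp: dist_norm norm_minus_commute)
  then obtain d where d: "\<And>i. i \<in> I \<Longrightarrow> d i > 0" "\<And>i. i \<in> I \<Longrightarrow> P i (d i)" by metis
  define D where "D = Min (insert 1 (d ` I))"
  have D: "D > 0" "\<And>i. i \<in> I \<Longrightarrow> D \<le> d i" using I d by (auto simp: D_def)
  have "P i D" if "i \<in> I" for i
    unfolding P_def
  proof (intro ballI allI impI)
    fix t s and x y :: "'i \<Rightarrow> 'e" assume "t \<in> {0..T}" "s \<in> {0..T}" "csize I x \<le> R" "csize I y \<le> R"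
      "\<bar>s - t\<bar> \<le> D" "csize I (\<lambda>i. y i - x i) \<le> D"
    then show "norm (Z s y i - Z t x i) < e"
      using d(2)[OF that, unfolded P_def, rule_format, of t s x y] D(2)[OF that] by linarith
  qed
  then show ?thesis using D(1) unfolding P_def by blast
qed

lemma mean_value_bound:
  fixes \<phi> :: "real \<Rightarrow> real"
  assumes "\<And>r. a \<le> r \<Longrightarrow> r \<le> b \<Longrightarrow> (\<phi> has_real_derivative \<phi>' r) (at r within {a..b})"
    and "\<And>r. a \<le> r \<Longrightarrow> r \<le> b \<Longrightarrow> \<bar>\<phi>' r - c\<bar> \<le> e" and "a \<le> b"
  shows "\<bar>\<phi> b - \<phi> a - (b - a) * c\<bar> \<le> e * (b - a)"
proof -
  have "norm ((\<phi> b - c * b) - (\<phi> a - c * a)) \<le> e * norm (b - a)"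
  proof (rule field_differentiable_bound[where S="{a..b}" and f="\<lambda>r. \<phi> r - c * r" and f'="\<lambda>r. \<phi>' r - c"])
    fix r assume "r \<in> {a..b}"
    then show "((\<lambda>r. \<phi> r - c * r) has_field_derivative \<phi>' r - c) (at r within {a..b})"
      using assms(1)[of r] by (auto intro!: derivative_eq_intros)
  qed (use assms in auto)
  then show ?thesis using assms(3) by (simp add: algebra_simps)
qed

lemma config_line_derivative:
  fixes u :: "('i \<Rightarrow> 'e::euclidean_space) \<Rightarrow> real"
  assumes "\<And>x. ((\<lambda>r. u (\<lambda>i. x i + r *\<^sub>R y i)) has_real_derivative D x) (at 0)"
  shows "((\<lambda>r. u (\<lambda>i. x i + r *\<^sub>R y i)) has_real_derivative D (\<lambda>i. x i + r *\<^sub>R y i)) (at r)"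
proof -
  have "(\<lambda>s. u (\<lambda>i. (x i + r *\<^sub>R y i) + s *\<^sub>R y i)) = (\<lambda>s. u (\<lambda>i. x i + (s + r) *\<^sub>R y i))"
    by (simp add: algebra_simps)
  then have "((\<lambda>s. u (\<lambda>i. x i + (s + r) *\<^sub>R y i)) has_real_derivative D (\<lambda>i. x i + r *\<^sub>R y i)) (at 0)"
    using assms[of "\<lambda>i. x i + r *\<^sub>R y i"] by simp
  then show ?thesis using DERIV_shift[of "\<lambda>r. u (\<lambda>i. x i + r *\<^sub>R y i)" _ 0 r] by simp
qed

text \<open>A Taylor expansion forward in time with one range \<open>d\<close> for all base points
  in the ball of radius \<open>R\<close>. This uniformity lets the step size be fixed before the
  polygon is known.\<close>

definition config_expansion where
  "config_expansion I q T R e d u ut Z \<longleftrightarrow> (\<forall>t\<in>{0..T}. \<forall>s\<in>{0..T}. \<forall>x y. csize I x \<le> R \<longrightarrow> csize I y \<le> R \<longrightarrow>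
     t \<le> s \<longrightarrow> s - t \<le> d \<longrightarrow> csize I (\<lambda>i. y i - x i) \<le> d \<longrightarrow>
     \<bar>u s y - u t x - (s - t) * ut t x - cpair I q (Z t x) (\<lambda>i. y i - x i)\<bar>
       \<le> e * ((s - t) + csize I (\<lambda>i. y i - x i)))"

lemma config_expansion_mono:
  assumes "config_expansion I q T R e d u ut Z" "d' \<le> d"
  shows "config_expansion I q T R e d' u ut Z"
  unfolding config_expansion_def
  by (intro ballI allI impI, rule assms(1)[unfolded config_expansion_def, rule_format]) (use assms(2) in auto)

text \<open>The increment is split at (t, y): the segment from x to y at time t is controlled by the
  continuity of \<open>Z\<close>, the passage from t to s at y by that of \<open>ut\<close>, each
  through a mean value estimate.\<close>

lemma config_C1_expansion:
  fixes u :: "real \<Rightarrow> ('i \<Rightarrow> 'e::euclidean_space) \<Rightarrow> real"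
  assumes I: "finite I" and q: "\<And>i. i \<in> I \<Longrightarrow> 0 \<le> q i \<and> q i \<le> 1"
    and u: "config_C1 I q T u ut Z" and e: "e > 0"
  shows "\<exists>d>0. config_expansion I q T R e d u ut Z"
proof -
  \<comment> \<open>Each of the \<open>card I\<close> components of \<open>Z\<close> may vary by
    \<open>e'\<close>, so that together they vary by at most \<open>e\<close>; the summand 1 covers
    an empty label set.\<close>
  define e' where "e' = e / (1 + real (card I))"
  have e': "e' > 0" "e' \<le> e" using e by (auto simp: e'_def field_simps)
  have e'c: "real (card I) * e' \<le> e" using e by (auto simp: e'_def field_simps)
  from u have ut: "config_cont I T ut" unfolding config_C1_def by auto
  from config_cont_uniform[OF I ut e] obtain d1 where d1: "d1 > 0"
    "\<And>t s x y. t\<in>{0..T} \<Longrightarrow> s\<in>{0..T} \<Longrightarrow> csize I x \<le> R \<Longrightarrow> csize I y \<le> R \<Longrightarrow>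
     \<bar>s - t\<bar> \<le> d1 \<Longrightarrow> csize I (\<lambda>i. y i - x i) \<le> d1 \<Longrightarrow> dist (ut t x) (ut s y) < e" by blast
  from config_C1_Z_uniform[OF I u e'(1)] obtain d2 where d2: "d2 > 0"
    "\<And>t s x y i. t\<in>{0..T} \<Longrightarrow> s\<in>{0..T} \<Longrightarrow> csize I x \<le> R \<Longrightarrow> csize I y \<le> R \<Longrightarrow>
     \<bar>s - t\<bar> \<le> d2 \<Longrightarrow> csize I (\<lambda>i. y i - x i) \<le> d2 \<Longrightarrow> i \<in> I \<Longrightarrow> norm (Z s y i - Z t x i) < e'" by blast
  show ?thesis
    unfolding config_expansion_def
  proof (intro exI[of _ "min d1 d2"] conjI ballI allI impI)
    show "min d1 d2 > 0" using d1 d2 by auto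
    fix t s and x y :: "'i \<Rightarrow> 'e" assume t: "t \<in> {0..T}" and s: "s \<in> {0..T}" and xR: "csize I x \<le> R" and yR: "csize I y \<le> R"
      and ts: "t \<le> s" "s - t \<le> min d1 d2" and xy: "csize I (\<lambda>i. y i - x i) \<le> min d1 d2"
    let ?w = "\<lambda>i. y i - x i"
    have A: "\<bar>u s y - u t y - (s - t) * ut t x\<bar> \<le> e * (s - t)"
    proof (rule mean_value_bound[where \<phi>="\<lambda>r. u r y" and \<phi>'="\<lambda>r. ut r y"])
      fix r assume r: "t \<le> r" "r \<le> s"
      then have rT: "r \<in> {0..T}" using t s by auto
      show "((\<lambda>r. u r y) has_real_derivative ut r y) (at r within {t..s})"
        by (rule DERIV_subset[of _ _ _ "{0..T}"]) (use u rT t s in \<open>auto simp: config_C1_def\<close>)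
      have "dist (ut t x) (ut r y) < e" by (rule d1(2)) (use t rT xR yR r ts xy in auto)
      then show "\<bar>ut r y - ut t x\<bar> \<le> e" by (auto simp: dist_real_def)
    qed (rule ts)
    have B: "\<bar>u t (\<lambda>i. x i + 1 *\<^sub>R ?w i) - u t (\<lambda>i. x i + 0 *\<^sub>R ?w i) - (1 - 0) * cpair I q (Z t x) ?w\<bar>
        \<le> (e * csize I ?w) * (1 - 0)"
    proof (rule mean_value_bound[where \<phi>="\<lambda>r. u t (\<lambda>i. x i + r *\<^sub>R ?w i)" and
          \<phi>'="\<lambda>r. cpair I q (Z t (\<lambda>i. x i + r *\<^sub>R ?w i)) ?w"])
      fix r :: real assume r: "0 \<le> r" "r \<le> 1"
      show "((\<lambda>r. u t (\<lambda>i. x i + r *\<^sub>R ?w i)) has_real_derivative cpair I q (Z t (\<lambda>i. x i + r *\<^sub>R ?w i)) ?w) (at r within {0..1})"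
        by (rule has_field_derivative_at_within, rule config_line_derivative)
           (use u t in \<open>auto simp: config_C1_def\<close>)
      let ?x' = "\<lambda>i. x i + r *\<^sub>R ?w i"
      have "csize I ?x' = csize I (\<lambda>i. (1 - r) *\<^sub>R x i + r *\<^sub>R y i)" by (simp add: algebra_simps)
      also have "\<dots> \<le> \<bar>1 - r\<bar> * csize I x + \<bar>r\<bar> * csize I y"
        using csize_add[of I "\<lambda>i. (1 - r) *\<^sub>R x i" "\<lambda>i. r *\<^sub>R y i"] by (simp add: csize_scaleR)
      also have "\<dots> \<le> (1 - r) * R + r * R" using r xR yR by (intro add_mono mult_mono) (auto simp: csize_nonneg)
      finally have x'R: "csize I ?x' \<le> R" by (simp add: algebra_simps)
      have "csize I (\<lambda>i. ?x' i - x i) = r * csize I ?w" using r by (simp add: csize_scaleR)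
      also have "\<dots> \<le> 1 * csize I ?w" using r by (intro mult_right_mono) (auto simp: csize_nonneg)
      finally have x'x: "csize I (\<lambda>i. ?x' i - x i) \<le> d2" using xy by linarith
      have "norm (Z t ?x' i - Z t x i) \<le> e'" if "i \<in> I" for i
        by (rule less_imp_le, rule d2(2)) (use t xR x'R x'x d2(1) that in auto)
      then have "csize I (\<lambda>i. Z t ?x' i - Z t x i) \<le> real (card I) * e'"
        unfolding csize_def by (rule sum_bounded_above)
      then have zz: "csize I (\<lambda>i. Z t ?x' i - Z t x i) \<le> e" using e'c by linarith
      have "\<bar>cpair I q (\<lambda>i. Z t ?x' i - Z t x i) ?w\<bar> \<le> csize I (\<lambda>i. Z t ?x' i - Z t x i) * csize I ?w"
        by (rule cpair_bound[OF I q norm_le_csize[OF I]])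
      also have "\<dots> \<le> e * csize I ?w" using zz by (intro mult_right_mono) (auto simp: csize_nonneg)
      finally show "\<bar>cpair I q (Z t ?x') ?w - cpair I q (Z t x) ?w\<bar> \<le> e * csize I ?w"
        by (simp add: cpair_diff_left)
    qed simp
    from A B show "\<bar>u s y - u t x - (s - t) * ut t x - cpair I q (Z t x) ?w\<bar> \<le> e * ((s - t) + csize I ?w)"
      by (simp add: algebra_simps)
  qed
qed


section \<open>Discrete Gronwall inequality\<close>

lemma gronwall_sum:
  fixes K0 h :: real
  shows "K0 + h * (\<Sum>k<l. K0 * (1 + h) ^ k) = K0 * (1 + h) ^ l"
  by (induction l) (auto simp: algebra_simps)

text \<open>The recursive inequality at \<open>l\<close> may be proved under the claimed bound for
  all earlier indices. In the application it holds only as long as the polygon stays in a ball whose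
  radius comes from this very bound.\<close>

lemma discrete_gronwall:
  fixes s :: "nat \<Rightarrow> real"
  assumes "\<And>l. l \<le> M \<Longrightarrow> (\<And>k. k < l \<Longrightarrow> s k \<le> K0 * (1 + h) ^ k) \<Longrightarrow> s l \<le> K0 + h * (\<Sum>k<l. s k)"
    and "0 \<le> h" "l \<le> M"
  shows "s l \<le> K0 * (1 + h) ^ l"
  using assms(3)
proof (induction l rule: less_induct)
  case (less l)
  have IH: "s k \<le> K0 * (1 + h) ^ k" if "k < l" for k
    using less.IH[OF that] that less.prems by simp
  have "s l \<le> K0 + h * (\<Sum>k<l. s k)" by (rule assms(1)[OF less.prems IH])
  also have "\<dots> \<le> K0 + h * (\<Sum>k<l. K0 * (1 + h) ^ k)"
    using IH assms(2) by (intro add_left_mono mult_left_mono sum_mono) auto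
  finally show ?case unfolding gronwall_sum .
qed

lemma power_one_plus_le_exp:
  assumes "0 \<le> K" "0 \<le> h" "real k * h \<le> T"
  shows "(1 + h * K) ^ k \<le> exp (K * T)"
proof -
  have "(1 + h * K) ^ k \<le> exp (h * K) ^ k"
    using assms exp_ge_add_one_self[of "h * K"] by (intro power_mono) auto
  also have "\<dots> = exp (K * (real k * h))" by (simp add: exp_of_nat_mult[symmetric] algebra_simps)
  also have "\<dots> \<le> exp (K * T)" using assms by (simp add: mult_left_mono)
  finally show ?thesis .
qed

section \<open>The finite-dimensional control problem and its verification argument\<close>

text \<open>Dynamics \<open>b\<close> and running cost \<open>L\<close> of a particle system. The
  local Lipschitz constant of \<open>L\<close> grows linearly in positions and actions, as for a
  cost of quadratic growth; with linearly bounded optimal actions this makes the adjoint inequality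
  linear in positions and gradients.\<close>

locale particle_control =
  fixes I :: "'i set" and q :: "'i \<Rightarrow> real"
    and b :: "('i \<Rightarrow> 'e::euclidean_space) \<Rightarrow> ('i \<Rightarrow> 'a::real_normed_vector) \<Rightarrow> 'i \<Rightarrow> 'e"
    and L :: "('i \<Rightarrow> 'e) \<Rightarrow> ('i \<Rightarrow> 'a) \<Rightarrow> real"
    and C T :: real
  assumes fin: "finite I"
    and q_pos: "\<And>i. i \<in> I \<Longrightarrow> 0 < q i"
    and q_le: "\<And>i. i \<in> I \<Longrightarrow> q i \<le> 1"
    and C_pos: "0 < C"
    and b_growth: "\<And>x a. csize I (b x a) \<le> C * (csize I x + csize I a)"
    and b_lip: "\<And>x y a i. i \<in> I \<Longrightarrow> norm (b y a i - b x a i) \<le> C * csize I (\<lambda>i. y i - x i)"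
    and L_lip: "\<And>x y a. \<bar>L y a - L x a\<bar> \<le>
      C * csize I (\<lambda>i. y i - x i) * (csize I x + csize I y + csize I a)"
begin

text \<open>The infimum over actions in the Hamilton-Jacobi inequality is spelled out as one
  inequality per action. A minimiser, with a linear bound on its size, is asked for in
  \<open>solution\<close> only.\<close>

definition subsolution where
  "subsolution u ut Z \<longleftrightarrow> config_C1 I q T u ut Z \<and>
     (\<forall>t\<in>{0..T}. \<forall>x a. ut t x + cpair I q (Z t x) (b x a) + L x a \<ge> 0)"

definition solution where
  "solution u ut Z \<longleftrightarrow> subsolution u ut Z \<and>
     (\<forall>t\<in>{0..T}. \<forall>x. \<exists>a. ut t x + cpair I q (Z t x) (b x a) + L x a = 0 \<and>
        csize I a \<le> C * (csize I x + csize I (Z t x)))"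

lemma qq: "i \<in> I \<Longrightarrow> 0 \<le> q i \<and> q i \<le> 1"
  using q_pos q_le by (auto simp: less_imp_le)

text \<open>The optimal actions at \<open>x\<close> are suboptimal at the shifted position \<open>x + \<eta>\<close>. Summed over the steps of an
  Euler polygon, this inequality plays the role of the adjoint equation for the gradient.\<close>

lemma euler_gradient_step:
  assumes sub: "subsolution u ut Z" and t: "t \<in> {0..T}" "t + \<tau> \<in> {0..T}" "0 \<le> \<tau>"
    and opt: "ut t x + cpair I q (Z t x) (b x a) + L x a = 0"
    and ac: "csize I a \<le> C * (csize I x + csize I (Z t x))"
    and ex1: "\<bar>u (t + \<tau>) (\<lambda>i. x i + \<tau> *\<^sub>R b x a i) - u t x - \<tau> * ut t x - \<tau> * cpair I q (Z t x) (b x a)\<bar> \<le> \<tau> * e"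
    and ex2: "\<bar>u (t + \<tau>) (\<lambda>i. x i + \<tau> *\<^sub>R b x a i + \<eta> i) - u t (\<lambda>i. x i + \<eta> i)
        - \<tau> * ut t (\<lambda>i. x i + \<eta> i) - \<tau> * cpair I q (Z t (\<lambda>i. x i + \<eta> i)) (b x a)\<bar> \<le> \<tau> * e"
    and Zd: "csize I (\<lambda>i. Z t (\<lambda>i. x i + \<eta> i) i - Z t x i) \<le> 1" and \<eta>: "csize I \<eta> \<le> 1"
  shows "(u (t + \<tau>) (\<lambda>i. x i + \<tau> *\<^sub>R b x a i + \<eta> i) - u (t + \<tau>) (\<lambda>i. x i + \<tau> *\<^sub>R b x a i))
     - (u t (\<lambda>i. x i + \<eta> i) - u t x)
     \<ge> - (\<tau> * (csize I \<eta> * (C * (4 + C) * (1 + csize I x + csize I (Z t x))))) - 2 * (\<tau> * e)"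
proof -
  let ?y = "\<lambda>i. x i + \<eta> i"
  have ut: "ut t ?y + cpair I q (Z t ?y) (b ?y a) + L ?y a \<ge> 0"
    using sub t unfolding subsolution_def by auto
  \<comment> \<open>The inequality at the shifted point and the equality at \<open>x\<close> are
    compared for the same action \<open>a\<close>; what remains are the variations of
    \<open>b\<close> and \<open>L\<close>, both of first order in \<open>\<eta>\<close>.\<close>
  have "ut t ?y + cpair I q (Z t ?y) (b x a) - (ut t x + cpair I q (Z t x) (b x a))
     \<ge> - cpair I q (Z t ?y) (\<lambda>i. b ?y a i - b x a i) - (L ?y a - L x a)"
    using ut opt by (simp add: cpair_diff_right)
  moreover have "\<bar>cpair I q (Z t ?y) (\<lambda>i. b ?y a i - b x a i)\<bar> \<le> csize I (Z t ?y) * (C * csize I (\<lambda>i. ?y i - x i))"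
    by (rule cpair_bound[OF fin qq b_lip])
  moreover have "\<bar>L ?y a - L x a\<bar> \<le> C * csize I (\<lambda>i. ?y i - x i) * (csize I x + csize I ?y + csize I a)"
    by (rule L_lip)
  moreover have "csize I (Z t ?y) * (C * csize I \<eta>) + C * csize I \<eta> * (csize I x + csize I ?y + csize I a)
      \<le> csize I \<eta> * (C * (4 + C) * (1 + csize I x + csize I (Z t x)))"
  proof -
    have "csize I (Z t ?y) \<le> 1 + csize I (Z t x)"
      using csize_triangle[of I "Z t ?y" "Z t x"] Zd by simp
    moreover have "csize I ?y \<le> csize I x + 1" using csize_add[of I x \<eta>] \<eta> by simp
    ultimately have "csize I (Z t ?y) + csize I x + csize I ?y + csize I a
       \<le> 2 + csize I (Z t x) + 2 * csize I x + C * (csize I x + csize I (Z t x))"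
      using ac by simp
    also have "\<dots> \<le> (4 + C) * (1 + csize I x + csize I (Z t x))"
      using C_pos csize_nonneg[of I x] csize_nonneg[of I "Z t x"] by (simp add: algebra_simps)
    finally have "C * csize I \<eta> * (csize I (Z t ?y) + csize I x + csize I ?y + csize I a)
       \<le> C * csize I \<eta> * ((4 + C) * (1 + csize I x + csize I (Z t x)))"
      using C_pos by (intro mult_left_mono) (auto simp: csize_nonneg)
    then show ?thesis by (simp add: algebra_simps)
  qed
  ultimately have "ut t ?y + cpair I q (Z t ?y) (b x a) - (ut t x + cpair I q (Z t x) (b x a))
     \<ge> - (csize I \<eta> * (C * (4 + C) * (1 + csize I x + csize I (Z t x))))" (is "?A \<ge> - ?B")
    by simp
  then have "\<tau> * ?A \<ge> \<tau> * (- ?B)" using t(3) by (rule mult_left_mono)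
  then show ?thesis using ex1 ex2 by (simp add: algebra_simps)
qed

text \<open>The order of the choices matters: \<open>R\<close> depends on the data and the starting
  point, \<open>\<delta>\<close> on \<open>R\<close>, \<open>\<epsilon>\<close> on
  \<open>\<delta>\<close> and the tolerance \<open>e\<close>, the step \<open>\<tau>\<close> on
  \<open>\<epsilon>\<close>. All a priori bounds concern \<open>u2\<close>; the regularity of
  \<open>u1\<close> enters only once \<open>R\<close> is fixed.\<close>

lemma comparison:
  assumes sub: "subsolution u1 ut1 Z1" and sol: "solution u2 ut2 Z2"
    and term_eq: "\<And>x. u1 T x = u2 T x" and t0: "t0 \<in> {0..T}"
  shows "u1 t0 x0 \<le> u2 t0 x0"
proof (cases "t0 = T")
  case True
  then show ?thesis using term_eq by simp
next
  case False
  then have t0T: "t0 < T" "0 \<le> t0" using t0 by auto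
  have sub2: "subsolution u2 ut2 Z2" using sol unfolding solution_def by simp
  have C1: "config_C1 I q T u1 ut1 Z1" and C2: "config_C1 I q T u2 ut2 Z2"
    using sub sub2 unfolding subsolution_def by auto
  have "\<forall>t x. \<exists>a. t \<in> {0..T} \<longrightarrow> ut2 t x + cpair I q (Z2 t x) (b x a) + L x a = 0 \<and>
        csize I a \<le> C * (csize I x + csize I (Z2 t x))"
    using sol unfolding solution_def by blast
  then obtain act where act: "\<And>t x. t \<in> {0..T} \<Longrightarrow>
      ut2 t x + cpair I q (Z2 t x) (b x (act t x)) + L x (act t x) = 0"
    "\<And>t x. t \<in> {0..T} \<Longrightarrow> csize I (act t x) \<le> C * (csize I x + csize I (Z2 t x))"
    by metis
  \<comment> \<open>A shift of label \<open>i\<close> sees the gradient with the factor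
    \<open>q i\<close>; the reciprocals recover the norms.\<close>
  define Q where "Q = (\<Sum>i\<in>I. 1 / q i)"
  have Q: "0 \<le> Q" unfolding Q_def using q_pos by (intro sum_nonneg) (auto simp: less_imp_le)
  define c4 where "c4 = C * (4 + C)"
  \<comment> \<open>The first term is the growth rate of the positions under optimal actions, the
    second that of the gradients.\<close>
  define K where "K = C * (1 + C) + Q * c4"
  \<comment> \<open>The initial value of the quantity \<open>s\<close> below, plus an allowance for
    the three errors of size \<open>\<delta>\<close> in the gradient estimate, after division by
    \<open>\<delta>\<close> and by the weights.\<close>
  define K0 where "K0 = 1 + csize I x0 + csize I (Z2 t0 x0) + 3 * Q"
  have c4: "0 \<le> c4" and K: "0 \<le> K" and K0: "0 \<le> K0"
    using C_pos Q csize_nonneg[of I x0] csize_nonneg[of I "Z2 t0 x0"]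
    by (auto simp: c4_def K_def K0_def)
  define R where "R = K0 * exp (K * T)"
  define \<beta> where "\<beta> = C * (1 + C) * R"
  have R: "0 \<le> R" and \<beta>: "0 \<le> \<beta>" using K0 C_pos by (auto simp: R_def \<beta>_def)
  \<comment> \<open>Radius \<open>R + 1\<close> leaves room for shifts of size at most 1. Relative
    precision 1 is enough, since the gradient has to be bounded and not to be approximated.\<close>
  obtain d1 where d1: "d1 > 0" and ed1: "config_expansion I q T (R + 1) 1 d1 u2 ut2 Z2"
    using config_C1_expansion[OF fin qq C2 zero_less_one] by blast
  obtain d2 where d2: "d2 > 0" "\<And>t s x y i. t\<in>{0..T} \<Longrightarrow> s\<in>{0..T} \<Longrightarrow> csize I x \<le> R + 1 \<Longrightarrow> csize I y \<le> R + 1 \<Longrightarrow>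
     \<bar>s - t\<bar> \<le> d2 \<Longrightarrow> csize I (\<lambda>i. y i - x i) \<le> d2 \<Longrightarrow> i \<in> I \<Longrightarrow> norm (Z2 s y i - Z2 t x i) < 1 / (1 + real (card I))"
    using config_C1_Z_uniform[OF fin C2, of "1 / (1 + real (card I))" "R + 1"] by (auto simp del: atLeastAtMost_iff)
  define \<delta> where "\<delta> = min 1 (min d1 d2)"
  have \<delta>: "0 < \<delta>" "\<delta> \<le> 1" "\<delta> \<le> d1" "\<delta> \<le> d2" using d1 d2(1) by (auto simp: \<delta>_def)
  show ?thesis
  proof (rule field_le_epsilon)
    fix e :: real assume e: "0 < e"
    \<comment> \<open>Two Euler errors per step, accumulated over a time of at most
      \<open>T\<close>, then stay below \<open>\<delta>\<close> for the gradient bound and below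
      \<open>e\<close> for the comparison.\<close>
    define \<epsilon> where "\<epsilon> = min \<delta> e / (2 * (T + 1) * (1 + \<beta>))"
    have \<epsilon>: "0 < \<epsilon>" unfolding \<epsilon>_def using e \<delta> t0T \<beta> by (intro divide_pos_pos) auto
    have \<epsilon>le: "2 * (T + 1) * (1 + \<beta>) * \<epsilon> = min \<delta> e"
      unfolding \<epsilon>_def using t0T \<beta> by auto
    obtain d3 where d3: "d3 > 0" and ed3: "config_expansion I q T (R + 1) \<epsilon> d3 u1 ut1 Z1"
      using config_C1_expansion[OF fin qq C1 \<epsilon>] by blast
    obtain d4 where d4: "d4 > 0" and ed4: "config_expansion I q T (R + 1) \<epsilon> d4 u2 ut2 Z2"
      using config_C1_expansion[OF fin qq C2 \<epsilon>] by blast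
    define \<delta>1 where "\<delta>1 = min d3 d4"
    have \<delta>1: "0 < \<delta>1" "\<delta>1 \<le> d3" "\<delta>1 \<le> d4" using d3 d4 by (auto simp: \<delta>1_def)
    note ex1 = config_expansion_mono[OF ed3 \<delta>1(2)] and ex2 = config_expansion_mono[OF ed4 \<delta>1(3)]
    \<comment> \<open>With more than this many steps, one step changes the time by
      \<open>\<tau>\<close> and the configuration by at most \<open>\<tau> * \<beta>\<close>, both
      within the range \<open>\<delta>1\<close> of the expansions.\<close>
    obtain M0 :: nat where M0: "(T - t0) * (1 + \<beta>) / \<delta>1 < real M0" using reals_Archimedean2 by blast
    define M where "M = Suc M0"
    define \<tau> where "\<tau> = (T - t0) / real M"
    have \<tau>: "0 < \<tau>" "real M * \<tau> = T - t0" using t0T by (auto simp: \<tau>_def M_def)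
    have "(T - t0) * (1 + \<beta>) \<le> \<delta>1 * real M" using M0 \<delta>1(1) by (simp add: M_def field_simps)
    then have \<tau>\<beta>: "\<tau> * (1 + \<beta>) \<le> \<delta>1"
      using \<tau>(1) by (simp add: \<tau>_def M_def divide_le_eq)
    have "0 \<le> \<tau> * \<beta>" using \<tau>(1) \<beta> by simp
    then have \<tau>1: "\<tau> \<le> \<delta>1" "\<tau> * \<beta> \<le> \<delta>1" using \<tau>\<beta> \<tau>(1) unfolding ring_distribs by linarith+
    define tt where "tt k = t0 + real k * \<tau>" for k
    have tts: "tt (Suc k) = tt k + \<tau>" for k by (simp add: tt_def algebra_simps)
    have tt: "tt k \<in> {0..T}" if "k \<le> M" for k
    proof -
      have "real k * \<tau> \<le> real M * \<tau>" using that \<tau> by (intro mult_right_mono) auto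
      then show ?thesis using \<tau> t0T by (auto simp: tt_def)
    qed
    have kT: "real k * \<tau> \<le> T" if "k \<le> M" for k using tt[OF that] t0T by (auto simp: tt_def)
    define X where "X = rec_nat x0 (\<lambda>k x i. x i + \<tau> *\<^sub>R b x (act (tt k) x) i)"
    have X0: "X 0 = x0" and XS: "X (Suc k) = (\<lambda>i. X k i + \<tau> *\<^sub>R b (X k) (act (tt k) (X k)) i)" for k
      by (auto simp: X_def)
    define A where "A k = act (tt k) (X k)" for k
    define Z where "Z k = Z2 (tt k) (X k)" for k
    define B where "B k = b (X k) (A k)" for k
    have XSB: "X (Suc k) = (\<lambda>i. X k i + \<tau> *\<^sub>R B k i)" for k by (simp add: XS A_def B_def)
    define s where "s k = 1 + csize I (X k) + csize I (Z k)" for k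
    have s_ge: "1 \<le> s k" "csize I (X k) \<le> s k" for k by (auto simp: s_def csize_nonneg)
    have A_le: "csize I (A k) \<le> C * (csize I (X k) + csize I (Z k))" if "k \<le> M" for k
      using act(2)[OF tt[OF that], of "X k"] by (simp add: A_def Z_def)
    have B_le: "csize I (B k) \<le> C * (1 + C) * s k" if "k \<le> M" for k
    proof -
      have "csize I (A k) \<le> C * s k"
        using A_le[OF that] C_pos unfolding s_def by (simp add: algebra_simps)
      then have "csize I (X k) + csize I (A k) \<le> (1 + C) * s k"
        using s_ge(2)[of k] by (simp add: algebra_simps)
      then have "C * (csize I (X k) + csize I (A k)) \<le> C * ((1 + C) * s k)"
        using C_pos by (intro mult_left_mono) auto
      then show ?thesis using b_growth[of "X k" "A k"] by (simp add: B_def mult.assoc)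
    qed
    have B\<beta>: "csize I (B k) \<le> \<beta>" if "k \<le> M" "s k \<le> R" for k
    proof -
      have "C * (1 + C) * s k \<le> \<beta>" unfolding \<beta>_def using C_pos that by (intro mult_left_mono) auto
      then show ?thesis using B_le[OF that(1)] by linarith
    qed
    have X_le: "csize I (X l) \<le> csize I x0 + \<tau> * (C * (1 + C)) * (\<Sum>k<l. s k)" if "l \<le> M" for l
      using that
    proof (induction l)
      case (Suc l)
      have "csize I (X (Suc l)) \<le> csize I (X l) + \<tau> * csize I (B l)"
        using csize_add[of I "X l" "\<lambda>i. \<tau> *\<^sub>R B l i"] \<tau>(1) by (simp add: XSB csize_scaleR)
      also have "\<tau> * csize I (B l) \<le> \<tau> * (C * (1 + C) * s l)"
        using B_le[of l] Suc.prems \<tau>(1) by (intro mult_left_mono) auto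
      finally show ?case using Suc by (simp add: algebra_simps)
    qed (simp add: X0)
    have powR: "K0 * (1 + \<tau> * K) ^ k \<le> R" if "k \<le> M" for k
      unfolding R_def using power_one_plus_le_exp[OF K less_imp_le[OF \<tau>(1)] kT[OF that]] K0
      by (intro mult_left_mono)
    \<comment> \<open>Stated for a general function and a general shift: it serves \<open>u2\<close>
      with the shifts 0 and \<open>\<eta>\<close> in the gradient estimate, and both functions with
      shift 0 in the final comparison.\<close>
    have step: "\<bar>u (tt (Suc k)) (\<lambda>i. X (Suc k) i + \<eta> i) - u (tt k) (\<lambda>i. X k i + \<eta> i)
        - \<tau> * ut (tt k) (\<lambda>i. X k i + \<eta> i) - \<tau> * cpair I q (Zu (tt k) (\<lambda>i. X k i + \<eta> i)) (B k)\<bar>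
        \<le> \<tau> * (\<epsilon> * (1 + \<beta>))"
      if k: "k < M" "s k \<le> R" "csize I (X (Suc k)) \<le> R" "csize I \<eta> \<le> 1"
        and ex: "config_expansion I q T (R + 1) \<epsilon> \<delta>1 u ut Zu" for k \<eta> u ut Zu
    proof -
      have sz: "csize I (\<lambda>i. \<tau> *\<^sub>R B k i) = \<tau> * csize I (B k)" using \<tau>(1) by (simp add: csize_scaleR)
      have szle: "\<tau> * csize I (B k) \<le> \<tau> * \<beta>"
        using B\<beta>[of k] k \<tau>(1) by (intro mult_left_mono) auto
      have d: "(\<lambda>i. (X (Suc k) i + \<eta> i) - (X k i + \<eta> i)) = (\<lambda>i. \<tau> *\<^sub>R B k i)" by (simp add: XSB)
      have "\<bar>u (tt (Suc k)) (\<lambda>i. X (Suc k) i + \<eta> i) - u (tt k) (\<lambda>i. X k i + \<eta> i)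
        - (tt (Suc k) - tt k) * ut (tt k) (\<lambda>i. X k i + \<eta> i) - cpair I q (Zu (tt k) (\<lambda>i. X k i + \<eta> i)) (\<lambda>i. (X (Suc k) i + \<eta> i) - (X k i + \<eta> i))\<bar>
        \<le> \<epsilon> * ((tt (Suc k) - tt k) + csize I (\<lambda>i. (X (Suc k) i + \<eta> i) - (X k i + \<eta> i)))"
      proof (rule ex[unfolded config_expansion_def, rule_format])
        show "csize I (\<lambda>i. X k i + \<eta> i) \<le> R + 1" "csize I (\<lambda>i. X (Suc k) i + \<eta> i) \<le> R + 1"
          using csize_add[of I "X k" \<eta>] csize_add[of I "X (Suc k)" \<eta>] k s_ge(2)[of k] by linarith+
        show "csize I (\<lambda>i. (X (Suc k) i + \<eta> i) - (X k i + \<eta> i)) \<le> \<delta>1"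
          unfolding d sz using szle \<tau>1 by linarith
      qed (use tt[of k] tt[of "Suc k"] k tts[of k] \<tau> \<tau>1 in auto)
      also have "\<dots> \<le> \<epsilon> * (\<tau> + \<tau> * \<beta>)"
        unfolding d sz using szle \<epsilon> by (intro mult_left_mono) (auto simp: tts)
      finally show ?thesis unfolding d by (simp add: tts cpair_scaleR_right algebra_simps)
    qed
    have s_bound: "s l \<le> K0 * (1 + \<tau> * K) ^ l" if "l \<le> M" for l
    proof (rule discrete_gronwall[OF _ _ that])
      show "0 \<le> \<tau> * K" using \<tau> K by simp
      fix l assume l: "l \<le> M" and IH: "\<And>k. k < l \<Longrightarrow> s k \<le> K0 * (1 + \<tau> * K) ^ k"
      let ?S = "\<Sum>k<l. s k"
      have S: "0 \<le> ?S" using s_ge(1) by (intro sum_nonneg) (use order_trans[OF zero_le_one] in blast)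
      have sR: "s k \<le> R" if "k < l" for k
        using IH[OF that] powR[of k] that l by linarith
      have "C * (1 + C) \<le> K" using Q c4 by (simp add: K_def)
      then have "\<tau> * (C * (1 + C)) * ?S \<le> \<tau> * K * ?S"
        using \<tau> S by (intro mult_right_mono mult_left_mono) auto
      also have "\<dots> \<le> \<tau> * K * (\<Sum>k<l. K0 * (1 + \<tau> * K) ^ k)"
        using IH \<tau> K by (intro mult_left_mono sum_mono) auto
      finally have "csize I (X l) \<le> K0 + \<tau> * K * (\<Sum>k<l. K0 * (1 + \<tau> * K) ^ k)"
        using X_le[OF l] Q csize_nonneg[of I "Z2 t0 x0"] by (simp add: K0_def)
      \<comment> \<open>\<open>X l\<close> is determined by the earlier nodes, so it is known to lie
        in the ball before the gradient there is estimated; the expansions at node \<open>l\<close>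
        rely on this.\<close>
      then have XlR: "csize I (X l) \<le> R"
        unfolding gronwall_sum using powR[OF l] by linarith
      have XR: "csize I (X k) \<le> R" if "k \<le> l" for k
        using that XlR sR[of k] s_ge(2)[of k] by (cases "k = l") force+
      have key: "q i * norm (Z l i - Z 0 i) \<le> c4 * \<tau> * ?S + 3" if i: "i \<in> I" for i
      proof -
        \<comment> \<open>Label \<open>i\<close> alone moves, by \<open>\<delta>\<close> and against
          the change of its gradient. The inequality available for \<open>u2\<close> is one-sided,
          and this sign makes it an upper bound for the norm of that change.\<close>
        define \<eta> where "\<eta> j = (if j = i then - (\<delta> *\<^sub>R sgn (Z l i - Z 0 i)) else 0)" for j
        have "csize I \<eta> = norm (\<eta> i)"
          unfolding csize_def using fin i by (subst sum.remove[of _ i]) (auto simp: \<eta>_def)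
        then have \<eta>: "csize I \<eta> \<le> \<delta>" using \<delta>(1) by (simp add: \<eta>_def norm_sgn)
        then have \<eta>1: "csize I \<eta> \<le> 1" using \<delta> by linarith
        have "cpair I q (\<lambda>i. Z l i - Z 0 i) \<eta> = q i * ((Z l i - Z 0 i) \<bullet> \<eta> i)"
          unfolding cpair_def using fin i by (subst sum.remove[of _ i]) (auto simp: \<eta>_def)
        also have "(Z l i - Z 0 i) \<bullet> \<eta> i = - (\<delta> * norm (Z l i - Z 0 i))"
          by (cases "Z l i = Z 0 i") (simp_all add: \<eta>_def sgn_div_norm power2_norm_eq_inner[symmetric] power2_eq_square)
        finally have pr: "cpair I q (Z l) \<eta> - cpair I q (Z 0) \<eta> = - (\<delta> * (q i * norm (Z l i - Z 0 i)))"
          by (simp add: cpair_diff_left)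
        \<comment> \<open>A finite difference stands in for the pairing of \<open>Z k\<close> with
          \<open>\<eta>\<close>, up to an error \<open>\<delta>\<close>. Being made of values of
          \<open>u2\<close>, it can be followed along Euler steps, which the merely continuous
          gradient cannot.\<close>
        define D where "D k = u2 (tt k) (\<lambda>i. X k i + \<eta> i) - u2 (tt k) (X k)" for k
        have Dpair: "\<bar>D k - cpair I q (Z k) \<eta>\<bar> \<le> \<delta>" if k: "k \<le> l" for k
        proof -
          have "\<bar>u2 (tt k) (\<lambda>i. X k i + \<eta> i) - u2 (tt k) (X k) - (tt k - tt k) * ut2 (tt k) (X k)
            - cpair I q (Z2 (tt k) (X k)) (\<lambda>i. (X k i + \<eta> i) - X k i)\<bar>
            \<le> 1 * ((tt k - tt k) + csize I (\<lambda>i. (X k i + \<eta> i) - X k i))"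
            by (rule ed1[unfolded config_expansion_def, rule_format]) (use tt[of k] l k XR[of k] \<eta> \<eta>1 \<delta> d1 csize_add[of I "X k" \<eta>] in auto)
          then show ?thesis using \<eta> by (simp add: D_def Z_def)
        qed
        have Dstep: "D (Suc k) - D k \<ge> - (\<tau> * (csize I \<eta> * (c4 * s k))) - 2 * (\<tau> * (\<epsilon> * (1 + \<beta>)))" if k: "k < l" for k
        proof -
          have kM: "k < M" using k l by simp
          note st = step[OF kM sR[OF k] XR _ ex2]
          have Zi: "norm (Z2 (tt k) (\<lambda>i. X k i + \<eta> i) i - Z2 (tt k) (X k) i) \<le> 1 / (1 + real (card I))" if "i \<in> I" for i
            by (rule less_imp_le, rule d2(2))
               (use tt[of k] kM XR[of k] k \<eta> \<eta>1 \<delta> d2(1) csize_add[of I "X k" \<eta>] that in auto)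
          have "csize I (\<lambda>i. Z2 (tt k) (\<lambda>i. X k i + \<eta> i) i - Z2 (tt k) (X k) i) \<le> real (card I) * (1 / (1 + real (card I)))"
            unfolding csize_def by (rule sum_bounded_above[OF Zi])
          also have "\<dots> \<le> 1" by simp
          finally have Zd: "csize I (\<lambda>i. Z2 (tt k) (\<lambda>i. X k i + \<eta> i) i - Z2 (tt k) (X k) i) \<le> 1" .
          have st0: "\<bar>u2 (tt k + \<tau>) (\<lambda>i. X k i + \<tau> *\<^sub>R b (X k) (A k) i) - u2 (tt k) (X k)
            - \<tau> * ut2 (tt k) (X k) - \<tau> * cpair I q (Z2 (tt k) (X k)) (b (X k) (A k))\<bar> \<le> \<tau> * (\<epsilon> * (1 + \<beta>))"
            using st[of "\<lambda>_. 0"] k by (simp add: XSB B_def tts csize_def)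
          have st\<eta>: "\<bar>u2 (tt k + \<tau>) (\<lambda>i. X k i + \<tau> *\<^sub>R b (X k) (A k) i + \<eta> i) - u2 (tt k) (\<lambda>i. X k i + \<eta> i)
            - \<tau> * ut2 (tt k) (\<lambda>i. X k i + \<eta> i) - \<tau> * cpair I q (Z2 (tt k) (\<lambda>i. X k i + \<eta> i)) (b (X k) (A k))\<bar> \<le> \<tau> * (\<epsilon> * (1 + \<beta>))"
            using st[of \<eta>] k \<eta>1 by (simp add: XSB B_def tts)
          have tk: "tt k \<in> {0..T}" "tt k + \<tau> \<in> {0..T}" using tt[of k] tt[of "Suc k"] kM tts[of k] by auto
          have op: "ut2 (tt k) (X k) + cpair I q (Z2 (tt k) (X k)) (b (X k) (A k)) + L (X k) (A k) = 0"
            using act(1)[OF tk(1)] by (simp add: A_def)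
          show ?thesis
            using euler_gradient_step[OF sub2 tk less_imp_le[OF \<tau>(1)] op A_le[unfolded Z_def] st0 st\<eta> Zd \<eta>1] kM
            by (simp add: D_def XSB B_def tts c4_def s_def Z_def)
        qed
        \<comment> \<open>Telescoping of \<open>Dstep\<close>; in the sum the upper limit is the
          outer \<open>k\<close>, the summation index the inner one.\<close>
        have "D k - D 0 \<ge> - (\<tau> * (csize I \<eta> * (c4 * (\<Sum>k<k. s k)))) - real k * (2 * (\<tau> * (\<epsilon> * (1 + \<beta>))))" if "k \<le> l" for k
          using that
        proof (induction k)
          case (Suc k)
          then show ?case using Dstep[of k] by (simp add: algebra_simps)
        qed simp
        from this[of l] have Dl: "D l - D 0 \<ge> - (\<tau> * (csize I \<eta> * (c4 * ?S))) - 2 * (real l * \<tau>) * (\<epsilon> * (1 + \<beta>))"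
          by (simp add: algebra_simps)
        have "2 * (real l * \<tau>) * (\<epsilon> * (1 + \<beta>)) \<le> 2 * (T + 1) * (\<epsilon> * (1 + \<beta>))"
          using kT[OF l] \<epsilon> \<beta> by (intro mult_right_mono) auto
        also have "\<dots> \<le> \<delta>" using \<epsilon>le by (simp add: algebra_simps)
        finally have e1: "2 * (real l * \<tau>) * (\<epsilon> * (1 + \<beta>)) \<le> \<delta>" .
        have e2: "\<tau> * (csize I \<eta> * (c4 * ?S)) \<le> \<delta> * (c4 * \<tau> * ?S)"
          using mult_right_mono[OF \<eta>, of "c4 * \<tau> * ?S"] \<tau> c4 S by (simp add: algebra_simps)
        \<comment> \<open>One \<open>\<delta>\<close> from the Euler errors and one from
          \<open>Dpair\<close> at each of the nodes \<open>l\<close> and 0 add up to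
          \<open>3 * \<delta>\<close>.\<close>
        have "\<delta> * (q i * norm (Z l i - Z 0 i)) \<le> \<delta> * (c4 * \<tau> * ?S + 3)"
          using Dl e1 e2 pr Dpair[of l] Dpair[of 0] by (simp add: algebra_simps)
        then show ?thesis using \<delta>(1) by simp
      qed
      have "norm (Z l i - Z 0 i) \<le> 1 / q i * (c4 * \<tau> * ?S + 3)" if i: "i \<in> I" for i
        using key[OF i] q_pos[OF i] by (simp add: field_simps)
      then have "csize I (\<lambda>i. Z l i - Z 0 i) \<le> Q * (c4 * \<tau> * ?S + 3)"
        unfolding csize_def Q_def sum_distrib_right by (rule sum_mono)
      then have "csize I (Z l) \<le> csize I (Z2 t0 x0) + Q * (c4 * \<tau> * ?S + 3)"
        using csize_triangle[of I "Z l" "Z 0"] by (simp add: Z_def tt_def X0)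
      then show "s l \<le> K0 + \<tau> * K * ?S"
        using X_le[OF l] by (simp add: s_def K0_def K_def algebra_simps)
    qed
    have sR: "s k \<le> R" if "k \<le> M" for k using s_bound[OF that] powR[OF that] by linarith
    have XR: "csize I (X k) \<le> R" if "k \<le> M" for k using sR[OF that] s_ge(2)[of k] by linarith
    \<comment> \<open>Along a polygon that is optimal for \<open>u2\<close>, the difference
      \<open>w\<close> can decrease by Euler errors only, and it vanishes at the last node.\<close>
    define w where "w k = u1 (tt k) (X k) - u2 (tt k) (X k)" for k
    have wstep: "w k \<le> w (Suc k) + 2 * (\<tau> * (\<epsilon> * (1 + \<beta>)))" if k: "k < M" for k
    proof -
      have tk: "tt k \<in> {0..T}" using tt[of k] k by auto
      have kR: "s k \<le> R" "csize I (X (Suc k)) \<le> R" using sR XR k by auto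
      have op: "ut2 (tt k) (X k) + cpair I q (Z2 (tt k) (X k)) (B k) + L (X k) (A k) = 0"
        using act(1)[OF tk] by (simp add: A_def B_def)
      have su: "ut1 (tt k) (X k) + cpair I q (Z1 (tt k) (X k)) (B k) + L (X k) (A k) \<ge> 0"
        using sub tk unfolding subsolution_def B_def by blast
      have "\<bar>u1 (tt (Suc k)) (X (Suc k)) - u1 (tt k) (X k) - \<tau> * ut1 (tt k) (X k)
            - \<tau> * cpair I q (Z1 (tt k) (X k)) (B k)\<bar> \<le> \<tau> * (\<epsilon> * (1 + \<beta>))"
        using step[OF k kR _ ex1, of "\<lambda>_. 0"] by (simp add: csize_def)
      moreover have "\<bar>u2 (tt (Suc k)) (X (Suc k)) - u2 (tt k) (X k) - \<tau> * ut2 (tt k) (X k)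
            - \<tau> * cpair I q (Z2 (tt k) (X k)) (B k)\<bar> \<le> \<tau> * (\<epsilon> * (1 + \<beta>))"
        using step[OF k kR _ ex2, of "\<lambda>_. 0"] by (simp add: csize_def)
      moreover have "\<tau> * (ut1 (tt k) (X k) + cpair I q (Z1 (tt k) (X k)) (B k))
          \<ge> \<tau> * (ut2 (tt k) (X k) + cpair I q (Z2 (tt k) (X k)) (B k))"
        using op su \<tau>(1) by (intro mult_left_mono) auto
      ultimately show ?thesis by (simp add: w_def algebra_simps)
    qed
    have "w 0 \<le> w k + real k * (2 * (\<tau> * (\<epsilon> * (1 + \<beta>))))" if "k \<le> M" for k
      using that
    proof (induction k)
      case (Suc k)
      then show ?case using wstep[of k] by (simp add: algebra_simps)
    qed simp
    from this[of M] have "w 0 \<le> w M + 2 * (real M * \<tau>) * (\<epsilon> * (1 + \<beta>))" by (simp add: algebra_simps)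
    moreover have "2 * (real M * \<tau>) * (\<epsilon> * (1 + \<beta>)) \<le> 2 * (T + 1) * (\<epsilon> * (1 + \<beta>))"
      using kT[of M] \<epsilon> \<beta> by (intro mult_right_mono) auto
    moreover have "2 * (T + 1) * (\<epsilon> * (1 + \<beta>)) \<le> e" using \<epsilon>le by (simp add: algebra_simps)
    moreover have "w M = 0" using \<tau>(2) term_eq by (simp add: w_def tt_def)
    ultimately show "u1 t0 x0 \<le> u2 t0 x0 + e" by (simp add: w_def tt_def X0)
  qed
qed

end

section \<open>Laws of square-integrable random vectors\<close>

lemma prob_space_Omega: "prob_space \<Omega>"
  unfolding \<Omega>_def by (rule prob_space_uniform_measure) auto

interpretation \<Omega>: prob_space \<Omega> by (rule prob_space_Omega)

lemma space_Omega [simp]: "space \<Omega> = UNIV"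
  by (simp add: \<Omega>_def)

lemma sets_Omega [simp, measurable_cong]: "sets \<Omega> = sets borel"
  by (simp add: \<Omega>_def)

lemma prob_Omega_UNIV [simp]: "measure \<Omega> UNIV = 1"
  using \<Omega>.prob_space by simp

lemma L2_measurable [measurable_dest]: "X \<in> L2 \<Longrightarrow> X \<in> borel_measurable \<Omega>"
  by (simp add: L2_def)

lemma L2_square: "X \<in> L2 \<Longrightarrow> integrable \<Omega> (\<lambda>\<omega>. (norm (X \<omega>))\<^sup>2)"
  by (simp add: L2_def)

lemma L2_I: "X \<in> borel_measurable \<Omega> \<Longrightarrow> integrable \<Omega> (\<lambda>\<omega>. (norm (X \<omega>))\<^sup>2) \<Longrightarrow> X \<in> L2"
  by (simp add: L2_def)

lemma L2_norm_integrable: "X \<in> L2 \<Longrightarrow> integrable \<Omega> (\<lambda>\<omega>. norm (X \<omega>))"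
  by (rule \<Omega>.square_integrable_imp_integrable) (auto dest: L2_square)

lemma L2_const: "(\<lambda>_. c) \<in> L2"
  by (rule L2_I) auto

lemma L2_scaleR: "X \<in> L2 \<Longrightarrow> (\<lambda>\<omega>. r *\<^sub>R X \<omega>) \<in> L2"
  by (rule L2_I) (auto simp: power_mult_distrib dest: L2_square)

lemma norm_add_square_le: "(norm (x + y))\<^sup>2 \<le> 2 * (norm x)\<^sup>2 + 2 * (norm (y::'b::real_normed_vector))\<^sup>2"
proof -
  have "(norm (x + y))\<^sup>2 \<le> (norm x + norm y)\<^sup>2" by (intro power_mono norm_triangle_ineq) auto
  also have "\<dots> \<le> 2 * (norm x)\<^sup>2 + 2 * (norm y)\<^sup>2"
    using sum_squares_bound[of "norm x" "norm y"] by (simp add: power2_sum)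
  finally show ?thesis .
qed

lemma L2_add: assumes "X \<in> L2" "Y \<in> L2" shows "(\<lambda>\<omega>. X \<omega> + Y \<omega>) \<in> L2"
proof (rule L2_I)
  note [measurable] = assms
  show "(\<lambda>\<omega>. X \<omega> + Y \<omega>) \<in> borel_measurable \<Omega>" by measurable
  show "integrable \<Omega> (\<lambda>\<omega>. (norm (X \<omega> + Y \<omega>))\<^sup>2)"
  proof (rule Bochner_Integration.integrable_bound)
    show "integrable \<Omega> (\<lambda>\<omega>. 2 * (norm (X \<omega>))\<^sup>2 + 2 * (norm (Y \<omega>))\<^sup>2)"
      using assms by (intro Bochner_Integration.integrable_add integrable_mult_right L2_square)
    show "AE \<omega> in \<Omega>. norm ((norm (X \<omega> + Y \<omega>))\<^sup>2) \<le> norm (2 * (norm (X \<omega>))\<^sup>2 + 2 * (norm (Y \<omega>))\<^sup>2)"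
      using norm_add_square_le[of "X _" "Y _"] by (auto intro!: AE_I2)
  qed measurable
qed

lemma L2_diff: "X \<in> L2 \<Longrightarrow> Y \<in> L2 \<Longrightarrow> (\<lambda>\<omega>. X \<omega> - Y \<omega>) \<in> L2"
  using L2_add[of X "\<lambda>\<omega>. (-1) *\<^sub>R Y \<omega>"] L2_scaleR[of Y "-1"] by simp

lemma L2norm_nonneg: "0 \<le> L2norm X"
  unfolding L2norm_def by simp

lemma L2norm_sq: "(L2norm X)\<^sup>2 = (\<integral>\<omega>. (norm (X \<omega>))\<^sup>2 \<partial>\<Omega>)"
  unfolding L2norm_def by simp

lemma L2norm_scaleR: "L2norm (\<lambda>\<omega>. r *\<^sub>R X \<omega>) = \<bar>r\<bar> * L2norm X"
  unfolding L2norm_def by (simp add: power_mult_distrib real_sqrt_mult)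

lemma L2_mult_integrable:
  assumes "X \<in> L2" "Y \<in> L2" shows "integrable \<Omega> (\<lambda>\<omega>. norm (X \<omega>) * norm (Y \<omega>))"
proof (rule Bochner_Integration.integrable_bound)
  have [measurable]: "X \<in> borel_measurable \<Omega>" "Y \<in> borel_measurable \<Omega>" using assms by (auto dest: L2_measurable)
  show "(\<lambda>\<omega>. norm (X \<omega>) * norm (Y \<omega>)) \<in> borel_measurable \<Omega>" by measurable
  show "integrable \<Omega> (\<lambda>\<omega>. (norm (X \<omega>))\<^sup>2 + (norm (Y \<omega>))\<^sup>2)"
    using assms by (auto dest: L2_square)
  show "AE \<omega> in \<Omega>. norm (norm (X \<omega>) * norm (Y \<omega>)) \<le> norm ((norm (X \<omega>))\<^sup>2 + (norm (Y \<omega>))\<^sup>2)"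
  proof (intro AE_I2)
    fix \<omega>
    have "0 \<le> norm (X \<omega>) * norm (Y \<omega>)" by simp
    then have "norm (X \<omega>) * norm (Y \<omega>) \<le> (norm (X \<omega>))\<^sup>2 + (norm (Y \<omega>))\<^sup>2"
      using sum_squares_bound[of "norm (X \<omega>)" "norm (Y \<omega>)"] by linarith
    then show "norm (norm (X \<omega>) * norm (Y \<omega>)) \<le> norm ((norm (X \<omega>))\<^sup>2 + (norm (Y \<omega>))\<^sup>2)" by simp
  qed
qed

text \<open>The integral of (|X| - r |Y|)^2 is a nonnegative quadratic polynomial in r; its value at
  the minimiser gives the claim. If \<open>L2norm Y = 0\<close> it is affine, so its slope must
  vanish.\<close>

lemma L2_Cauchy_Schwarz:
  assumes X: "X \<in> L2" and Y: "Y \<in> L2"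
  shows "(\<integral>\<omega>. norm (X \<omega>) * norm (Y \<omega>) \<partial>\<Omega>) \<le> L2norm X * L2norm Y"
proof -
  let ?c = "\<integral>\<omega>. norm (X \<omega>) * norm (Y \<omega>) \<partial>\<Omega>"
  have q: "0 \<le> (L2norm X)\<^sup>2 - 2 * r * ?c + r\<^sup>2 * (L2norm Y)\<^sup>2" for r
  proof -
    have "0 \<le> (\<integral>\<omega>. (norm (X \<omega>) - r * norm (Y \<omega>))\<^sup>2 \<partial>\<Omega>)" by simp
    also have "\<dots> = (\<integral>\<omega>. (norm (X \<omega>))\<^sup>2 - 2 * r * (norm (X \<omega>) * norm (Y \<omega>)) + r\<^sup>2 * (norm (Y \<omega>))\<^sup>2 \<partial>\<Omega>)"
      by (rule Bochner_Integration.integral_cong) (auto simp: power2_eq_square algebra_simps)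
    also have "\<dots> = (L2norm X)\<^sup>2 - 2 * r * ?c + r\<^sup>2 * (L2norm Y)\<^sup>2"
      using L2_square[OF X] L2_square[OF Y] L2_mult_integrable[OF X Y] by (simp add: L2norm_sq)
    finally show ?thesis .
  qed
  have c0: "0 \<le> ?c" by simp
  have "?c\<^sup>2 \<le> (L2norm X * L2norm Y)\<^sup>2"
  proof (cases "L2norm Y = 0")
    case True
    have "?c = 0"
    proof (rule ccontr)
      assume "?c \<noteq> 0"
      then have "0 < ?c" using c0 by linarith
      \<comment> \<open>At this r the affine function takes the value -1.\<close>
      with q[of "((L2norm X)\<^sup>2 + 1) / (2 * ?c)"] True show False by (simp add: field_simps)
    qed
    then show ?thesis by simp
  next
    case False
    define b where "b = (L2norm Y)\<^sup>2"
    have b: "0 < b" using False by (simp add: b_def)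
    have "2 * (?c / b) * ?c = 2 * (?c\<^sup>2 / b)" "(?c / b)\<^sup>2 * b = ?c\<^sup>2 / b"
      using b by (auto simp: power2_eq_square)
    then have "?c\<^sup>2 / b \<le> (L2norm X)\<^sup>2" using q[of "?c / b"] unfolding b_def[symmetric] by linarith
    then show ?thesis using b by (simp add: power_mult_distrib b_def[symmetric] field_simps)
  qed
  then show ?thesis by (rule power2_le_imp_le) (simp add: L2norm_nonneg)
qed

lemma L1_le_L2norm: assumes "X \<in> L2" shows "(\<integral>\<omega>. norm (X \<omega>) \<partial>\<Omega>) \<le> L2norm X"
  using L2_Cauchy_Schwarz[OF assms L2_const[of "1::real"]] by (simp add: L2norm_def \<Omega>.prob_space)

lemma Law_cong_AE:
  assumes "X \<in> borel_measurable \<Omega>" "Y \<in> borel_measurable \<Omega>" "AE \<omega> in \<Omega>. X \<omega> = Y \<omega>"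
  shows "Law X = Law Y"
  unfolding Law_def by (rule distr_cong_AE) (use assms in auto)

lemma sets_Law [simp, measurable_cong]: "sets (Law X) = sets borel"
  by (simp add: Law_def)

lemma integral_Law:
  fixes h :: "'b::euclidean_space \<Rightarrow> 'c::{banach,second_countable_topology}"
  assumes "X \<in> borel_measurable \<Omega>" "h \<in> borel_measurable borel"
  shows "(\<integral>x. h x \<partial>Law X) = (\<integral>\<omega>. h (X \<omega>) \<partial>\<Omega>)"
  unfolding Law_def using assms by (intro integral_distr) auto

lemma integrable_Law:
  fixes h :: "'b::euclidean_space \<Rightarrow> 'c::{banach,second_countable_topology}"
  assumes "X \<in> borel_measurable \<Omega>" "h \<in> borel_measurable borel"
  shows "integrable (Law X) h \<longleftrightarrow> integrable \<Omega> (\<lambda>\<omega>. h (X \<omega>))"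
  unfolding Law_def using assms by (intro integrable_distr_eq) auto

lemma Law_P2: assumes "X \<in> L2" shows "Law X \<in> P2"
proof -
  have [measurable]: "X \<in> borel_measurable \<Omega>" using assms by (rule L2_measurable)
  show ?thesis unfolding P2_def
    using L2_square[OF assms] \<Omega>.prob_space_distr[of X borel]
    by (auto simp: integrable_Law) (simp add: Law_def)
qed

lemma W2_le:
  assumes "\<pi> \<in> couplings \<mu> \<nu>"
  shows "W2 \<mu> \<nu> \<le> sqrt (\<integral>z. (norm (fst z - snd z))\<^sup>2 \<partial>\<pi>)"
proof -
  have eq: "norm z powr 2 = (norm z)\<^sup>2" for z :: 'a by (simp add: powr_numeral)
  have "(INF \<pi>\<in>couplings \<mu> \<nu>. \<integral>z. (norm (fst z - snd z))\<^sup>2 \<partial>\<pi>) \<le> (\<integral>z. (norm (fst z - snd z))\<^sup>2 \<partial>\<pi>)"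
    by (rule cINF_lower[OF _ assms]) (auto intro!: bdd_belowI[of _ 0])
  moreover have "0 \<le> (INF \<pi>\<in>couplings \<mu> \<nu>. \<integral>z. (norm (fst z - snd z))\<^sup>2 \<partial>\<pi>)"
    using assms by (intro cINF_greatest) auto
  ultimately show ?thesis
    unfolding wasserstein_def eq by (simp add: powr_half_sqrt)
qed

lemma borel_measurable_fst_snd [measurable]:
  "(fst :: 'b::euclidean_space \<times> 'c::euclidean_space \<Rightarrow> 'b) \<in> borel_measurable borel"
  "(snd :: 'b \<times> 'c \<Rightarrow> 'c) \<in> borel_measurable borel"
  by (auto intro!: borel_measurable_continuous_onI continuous_on_fst continuous_on_snd continuous_on_id)

lemma W2_Law_le:
  assumes X: "X \<in> borel_measurable \<Omega>" and Y: "Y \<in> borel_measurable \<Omega>"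
  shows "W2 (Law X) (Law Y) \<le> L2norm (\<lambda>\<omega>. X \<omega> - Y \<omega>)"
proof -
  have [measurable]: "X \<in> borel_measurable \<Omega>" "Y \<in> borel_measurable \<Omega>" using assms by auto
  have [measurable]: "(\<lambda>\<omega>. (X \<omega>, Y \<omega>)) \<in> borel_measurable \<Omega>" by (rule borel_measurable_Pair) measurable
  let ?\<pi> = "distr \<Omega> borel (\<lambda>\<omega>. (X \<omega>, Y \<omega>))"
  have "?\<pi> \<in> couplings (Law X) (Law Y)"
    unfolding couplings_def Law_def by (auto simp: distr_distr o_def)
  from W2_le[OF this] show ?thesis
    unfolding L2norm_def by (simp add: integral_distr)
qed

lemma dirac0_Law: "dirac0 = Law (\<lambda>_. 0)"
  unfolding Law_def by (rule \<Omega>.distr_const[symmetric]) simp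

lemma jcontD:
  assumes "jcont S F" "\<mu> \<in> P2" "z \<in> S" "\<And>k. \<mu>s k \<in> P2" "\<And>k. zs k \<in> S"
    "(\<lambda>k::nat. W2 \<mu> (\<mu>s k)) \<longlonglongrightarrow> 0" "zs \<longlonglongrightarrow> z"
  shows "(\<lambda>k. F (\<mu>s k) (zs k)) \<longlonglongrightarrow> F \<mu> z"
proof (rule tendstoI)
  fix e :: real assume "e > 0"
  then obtain d where d: "d > 0"
    "\<And>\<nu> w. \<nu> \<in> P2 \<Longrightarrow> w \<in> S \<Longrightarrow> W2 \<mu> \<nu> < d \<Longrightarrow> dist z w < d \<Longrightarrow> dist (F \<mu> z) (F \<nu> w) < e"
    using assms(1-3) unfolding jcont_def by blast
  have "\<forall>\<^sub>F k in sequentially. W2 \<mu> (\<mu>s k) < d" "\<forall>\<^sub>F k in sequentially. dist (zs k) z < d"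
    using order_tendstoD(2)[OF assms(6) d(1)] tendstoD[OF assms(7) d(1)] by auto
  then show "\<forall>\<^sub>F k in sequentially. dist (F (\<mu>s k) (zs k)) (F \<mu> z) < e"
    by eventually_elim (use d(2)[OF assms(4,5)] in \<open>auto simp: dist_commute\<close>)
qed

section \<open>Finitely supported laws\<close>

lemma measure_Omega: "A \<in> sets borel \<Longrightarrow> measure \<Omega> A = measure lborel ({0..1} \<inter> A)"
  unfolding \<Omega>_def by (subst measure_uniform_measure) auto

text \<open>The mass of \<open>A\<close> to the left of s is 1-Lipschitz in s, as
  \<open>\<Omega>\<close> has density at most 1, so the intermediate value theorem applies. The
  interval starts at -1, where this mass is certainly 0.\<close>

lemma ex_subset_Omega_measure:
  assumes A: "A \<in> sets borel" and c: "0 \<le> c" "c \<le> measure \<Omega> A"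
  shows "\<exists>B\<subseteq>A. B \<in> sets borel \<and> measure \<Omega> B = c"
proof -
  define F where "F s = measure \<Omega> (A \<inter> {..s})" for s :: real
  have lip': "\<bar>F s - F r\<bar> \<le> \<bar>s - r\<bar>" if "r \<le> s" for r s
  proof -
    have "F s \<le> measure \<Omega> ((A \<inter> {..r}) \<union> {r<..s})"
      unfolding F_def using A by (intro \<Omega>.finite_measure_mono) auto
    also have "\<dots> \<le> F r + measure \<Omega> {r<..s}"
      unfolding F_def using A by (intro measure_Un_le) auto
    also have "measure \<Omega> {r<..s} \<le> measure lborel {r<..s}"
      unfolding measure_Omega[OF greaterThanAtMost_borel]
      by (intro measure_mono_fmeasurable) (auto simp: fmeasurable_def emeasure_lborel_Ioc that)
    also have "\<dots> = s - r" using that by simp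
    finally have "F s - F r \<le> s - r" by simp
    moreover have "F r \<le> F s"
      unfolding F_def using A that by (intro \<Omega>.finite_measure_mono) auto
    ultimately show ?thesis using that by simp
  qed
  have lip: "\<bar>F s - F r\<bar> \<le> \<bar>s - r\<bar>" for r s
    using lip'[of r s] lip'[of s r] by (cases "r \<le> s") (simp_all add: abs_minus_commute)
  have "continuous_on {-1..1} F"
    unfolding continuous_on_iff dist_real_def
  proof (intro ballI allI impI)
    fix x e :: real assume "0 < e"
    then show "\<exists>d>0. \<forall>x'\<in>{- 1..1}. \<bar>x' - x\<bar> < d \<longrightarrow> \<bar>F x' - F x\<bar> < e"
      using lip by (intro exI[of _ e]) (auto intro: le_less_trans)
  qed
  moreover have "F (-1) = 0"
  proof -
    have "{0..1} \<inter> (A \<inter> {..-1::real}) = {}" by auto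
    then show ?thesis unfolding F_def using A by (subst measure_Omega) auto
  qed
  moreover have "F 1 = measure \<Omega> A"
  proof -
    have "{0..1} \<inter> (A \<inter> {..1::real}) = {0..1} \<inter> A" by auto
    then show ?thesis unfolding F_def using A by (simp add: measure_Omega)
  qed
  ultimately have "\<exists>s\<ge>-1. s \<le> 1 \<and> F s = c"
    using c by (intro IVT') auto
  then obtain s where "F s = c" by auto
  then show ?thesis using A unfolding F_def by (intro exI[of _ "A \<inter> {..s}"]) auto
qed

text \<open>Pieces are cut off one label at a time, and the last label takes all that remains, so
  that every point of \<open>A\<close> receives a label.\<close>

lemma ex_partition_Omega_measure:
  assumes "finite J" "J \<noteq> {}" "\<And>i. i \<in> J \<Longrightarrow> 0 \<le> q i" "A \<in> sets borel" "measure \<Omega> A = sum q J"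
  shows "\<exists>l::real\<Rightarrow>'i. (\<forall>\<omega>\<in>A. l \<omega> \<in> J) \<and>
    (\<forall>i\<in>J. {\<omega>\<in>A. l \<omega> = i} \<in> sets borel \<and> measure \<Omega> {\<omega>\<in>A. l \<omega> = i} = q i)"
  using assms
proof (induction J arbitrary: A rule: finite_ne_induct)
  case (singleton j)
  then show ?case by (intro exI[of _ "\<lambda>_. j"]) auto
next
  case (insert j J)
  then have "q j \<le> measure \<Omega> A" by (simp add: sum_nonneg)
  then obtain B where B: "B \<subseteq> A" "B \<in> sets borel" "measure \<Omega> B = q j"
    using ex_subset_Omega_measure[of A "q j"] insert.prems by auto
  have "measure \<Omega> (A - B) = sum q J"
    using B insert by (subst \<Omega>.finite_measure_Diff) auto
  then obtain l where l: "\<forall>\<omega>\<in>A - B. l \<omega> \<in> J"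
    "\<forall>i\<in>J. {\<omega>\<in>A - B. l \<omega> = i} \<in> sets borel \<and> measure \<Omega> {\<omega>\<in>A - B. l \<omega> = i} = q i"
    using insert.IH[of "A - B"] insert.prems B(2) by auto
  let ?l = "\<lambda>\<omega>. if \<omega> \<in> B then j else l \<omega>"
  have "{\<omega>\<in>A. ?l \<omega> = j} = B" using B(1) l(1) insert.hyps by auto
  moreover have "{\<omega>\<in>A. ?l \<omega> = i} = {\<omega>\<in>A - B. l \<omega> = i}" if "i \<in> J" for i
    using B(1) that insert.hyps by auto
  ultimately show ?case
    using l B by (intro exI[of _ ?l]) auto
qed

section \<open>Labelled atoms and relabelling\<close>

text \<open>A finitely supported law with named atoms: a configuration \<open>x\<close> becomes the
  random vector \<open>x (\<iota> \<omega>)\<close>, where label \<open>i\<close> contributes the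
  mass \<open>weight i\<close> at \<open>x i\<close> and several labels may share a position.
  Positivity of the weights lets the gradient of every single label be recovered.\<close>

locale labelling =
  fixes \<iota> :: "real \<Rightarrow> 'i"
  assumes simple: "simple_function \<Omega> \<iota>"
    and weight_pos: "\<And>i. i \<in> range \<iota> \<Longrightarrow> 0 < measure \<Omega> (\<iota> -` {i})"
begin

definition weight :: "'i \<Rightarrow> real" where
  "weight i = measure \<Omega> (\<iota> -` {i})"

lemma finite_labels: "finite (range \<iota>)"
  using simple by (simp add: simple_function_def)

lemma weight_le_1: "weight i \<le> 1"
  unfolding weight_def by (rule \<Omega>.prob_le_1)

lemma weight_gt_0: "i \<in> range \<iota> \<Longrightarrow> 0 < weight i"
  unfolding weight_def by (rule weight_pos)

end

lemma simple_Omega_measurable: "simple_function \<Omega> \<iota> \<Longrightarrow> (\<lambda>\<omega>. x (\<iota> \<omega>)) \<in> borel_measurable \<Omega>"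
  for x :: "'i \<Rightarrow> 'b::topological_space"
  using borel_measurable_simple_function[of \<Omega> "x \<circ> \<iota>"] simple_function_compose[of \<Omega> \<iota> x]
  by (simp add: o_def)

lemma simple_Omega_L2:
  fixes x :: "'i \<Rightarrow> 'b::euclidean_space"
  assumes "simple_function \<Omega> \<iota>" shows "(\<lambda>\<omega>. x (\<iota> \<omega>)) \<in> L2"
proof (rule L2_I)
  show "(\<lambda>\<omega>. x (\<iota> \<omega>)) \<in> borel_measurable \<Omega>" using assms by (rule simple_Omega_measurable)
  have "finite (range \<iota>)" using assms by (simp add: simple_function_def)
  then have "finite (range (\<lambda>\<omega>. (norm (x (\<iota> \<omega>)))\<^sup>2))"
    by (rule finite_surj[of _ _ "\<lambda>i. (norm (x i))\<^sup>2"]) auto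
  then have B: "(norm (x (\<iota> \<omega>)))\<^sup>2 \<le> Max (range (\<lambda>\<omega>. (norm (x (\<iota> \<omega>)))\<^sup>2))" for \<omega>
    by (rule Max_ge) auto
  show "integrable \<Omega> (\<lambda>\<omega>. (norm (x (\<iota> \<omega>)))\<^sup>2)"
    by (rule \<Omega>.integrable_const_bound[of _ "Max (range (\<lambda>\<omega>. (norm (x (\<iota> \<omega>)))\<^sup>2))"]) (use B simple_Omega_measurable[OF assms] in auto)
qed

text \<open>\<open>J\<close> may exceed the range of \<open>\<iota>\<close>, as additional labels
  have empty preimages. Two labellings can thus be compared by sums over the same index set.\<close>

lemma integral_simple_Omega:
  fixes h :: "'i \<Rightarrow> 'b::euclidean_space"
  assumes s: "simple_function \<Omega> \<iota>" and J: "finite J" "range \<iota> \<subseteq> J"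
  shows "(\<integral>\<omega>. h (\<iota> \<omega>) \<partial>\<Omega>) = (\<Sum>i\<in>J. measure \<Omega> (\<iota> -` {i}) *\<^sub>R h i)"
proof -
  have m: "\<iota> -` {i} \<in> sets borel" for i
    using simple_functionD(2)[OF s, of "{i}"] by simp
  have "(\<integral>\<omega>. h (\<iota> \<omega>) \<partial>\<Omega>) = (\<integral>\<omega>. (\<Sum>i\<in>J. indicat_real (\<iota> -` {i}) \<omega> *\<^sub>R h i) \<partial>\<Omega>)"
  proof (rule Bochner_Integration.integral_cong)
    fix \<omega>
    have "(\<Sum>i\<in>J. indicat_real (\<iota> -` {i}) \<omega> *\<^sub>R h i) = (\<Sum>i\<in>{\<iota> \<omega>}. indicat_real (\<iota> -` {i}) \<omega> *\<^sub>R h i)"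
      using J by (intro sum.mono_neutral_right) auto
    then show "h (\<iota> \<omega>) = (\<Sum>i\<in>J. indicat_real (\<iota> -` {i}) \<omega> *\<^sub>R h i)" by simp
  qed simp
  also have "\<dots> = (\<Sum>i\<in>J. measure \<Omega> (\<iota> -` {i}) *\<^sub>R h i)"
    by (subst Bochner_Integration.integral_sum) (use m in \<open>auto intro!: integrable_scaleR_left simp: \<Omega>.emeasure_eq_measure less_top[symmetric]\<close>)
  finally show ?thesis .
qed

lemma measure_simple_Omega:
  assumes s: "simple_function \<Omega> \<iota>" and J: "finite J" "range \<iota> \<subseteq> J"
  shows "measure \<Omega> {\<omega>. P (\<iota> \<omega>)} = (\<Sum>i\<in>J. if P i then measure \<Omega> (\<iota> -` {i}) else 0)"
proof -
  have "{\<omega>. P (\<iota> \<omega>)} \<in> sets \<Omega>"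
    using simple_functionD(2)[OF s, of "Collect P"] by (simp add: vimage_def)
  then have "measure \<Omega> {\<omega>. P (\<iota> \<omega>)} = (\<integral>\<omega>. indicat_real {\<omega>. P (\<iota> \<omega>)} \<omega> \<partial>\<Omega>)"
    by simp
  also have "\<dots> = (\<integral>\<omega>. indicat_real (Collect P) (\<iota> \<omega>) \<partial>\<Omega>)"
    by (rule Bochner_Integration.integral_cong) (auto simp: indicator_def)
  also have "\<dots> = (\<Sum>i\<in>J. measure \<Omega> (\<iota> -` {i}) *\<^sub>R indicator (Collect P) i)"
    by (rule integral_simple_Omega[OF s J])
  finally show ?thesis by (simp add: indicator_def of_bool_def if_distrib cong: if_cong)
qed

lemma Law_simple_cong:
  fixes y :: "'i \<Rightarrow> 'b::euclidean_space"
  assumes s: "simple_function \<Omega> \<iota>" "simple_function \<Omega> \<iota>'" and J: "finite J" "range \<iota> \<subseteq> J" "range \<iota>' \<subseteq> J"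
    and eq: "\<And>i. i \<in> J \<Longrightarrow> measure \<Omega> (\<iota> -` {i}) = measure \<Omega> (\<iota>' -` {i})"
  shows "Law (\<lambda>\<omega>. y (\<iota> \<omega>)) = Law (\<lambda>\<omega>. y (\<iota>' \<omega>))"
proof (rule measure_eqI)
  fix A assume "A \<in> sets (Law (\<lambda>\<omega>. y (\<iota> \<omega>)))"
  then have A: "A \<in> sets borel" by simp
  have "measure \<Omega> {\<omega>. y (\<iota> \<omega>) \<in> A} = measure \<Omega> {\<omega>. y (\<iota>' \<omega>) \<in> A}"
    unfolding measure_simple_Omega[OF s(1) J(1,2), of "\<lambda>i. y i \<in> A"]
      measure_simple_Omega[OF s(2) J(1,3), of "\<lambda>i. y i \<in> A"]
    using eq by (intro sum.cong) auto
  then show "emeasure (Law (\<lambda>\<omega>. y (\<iota> \<omega>))) A = emeasure (Law (\<lambda>\<omega>. y (\<iota>' \<omega>))) A"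
    unfolding Law_def using A s
    by (simp add: emeasure_distr simple_Omega_measurable \<Omega>.emeasure_eq_measure vimage_def)
qed simp

text \<open>Since \<open>\<Omega>\<close> is atomless, every random vector with a finitely supported law is, up to a null
  set, a relabelled version of any other one, even when labels with equal positions are to be
  distinguished.\<close>

lemma (in labelling) ex_relabelling:
  fixes x :: "'i \<Rightarrow> 'b::euclidean_space"
  assumes X: "X \<in> borel_measurable \<Omega>" and law: "Law X = Law (\<lambda>\<omega>. x (\<iota> \<omega>))"
  shows "\<exists>\<iota>'. simple_function \<Omega> \<iota>' \<and> range \<iota>' \<subseteq> range \<iota> \<and>
    (\<forall>i\<in>range \<iota>. measure \<Omega> (\<iota>' -` {i}) = weight i) \<and> (AE \<omega> in \<Omega>. X \<omega> = x (\<iota>' \<omega>))"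
proof -
  note [measurable] = X simple_Omega_measurable[OF simple]
  let ?I = "range \<iota>"
  have Xb: "X -` A \<in> sets borel" if "A \<in> sets borel" for A
    using measurable_sets[OF X that] by simp
  have meas: "measure \<Omega> (X -` A) = measure \<Omega> {\<omega>. x (\<iota> \<omega>) \<in> A}" if "A \<in> sets borel" for A
    using arg_cong[OF law, of "\<lambda>M. measure M A"] that
    by (simp add: Law_def measure_distr X simple_Omega_measurable[OF simple] vimage_def)
  \<comment> \<open>The level set where \<open>X\<close> equals \<open>c\<close> has the total
    weight of the labels placed at \<open>c\<close>; it is cut into pieces of the individual
    weights.\<close>
  define P where "P c l \<longleftrightarrow> (\<forall>\<omega>\<in>X -` {c}. l \<omega> \<in> {i\<in>?I. x i = c}) \<and>
    (\<forall>i\<in>{i\<in>?I. x i = c}. {\<omega>\<in>X -` {c}. l \<omega> = i} \<in> sets borel \<and> measure \<Omega> {\<omega>\<in>X -` {c}. l \<omega> = i} = weight i)"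
    for c and l :: "real \<Rightarrow> 'i"
  have "\<exists>l. P c l" if c: "c \<in> x ` ?I" for c
    unfolding P_def
  proof (rule ex_partition_Omega_measure)
    show "measure \<Omega> (X -` {c}) = sum weight {i\<in>?I. x i = c}"
      unfolding meas[OF borel_closed[OF closed_singleton]] weight_def
      by (subst measure_simple_Omega[OF simple finite_labels order_refl])
         (simp add: sum.inter_filter finite_labels)
  qed (use c finite_labels Xb weight_gt_0 in \<open>auto simp: less_imp_le\<close>)
  then obtain l where Pl: "\<And>c. c \<in> x ` ?I \<Longrightarrow> P c (l c)" by metis
  have l: "l c \<omega> \<in> ?I \<and> x (l c \<omega>) = c" if "c \<in> x ` ?I" "X \<omega> = c" for c \<omega>
    using Pl[OF that(1)] that(2) unfolding P_def by blast
  define F where "F i = {\<omega>\<in>X -` {x i}. l (x i) \<omega> = i}" for i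
  have F: "F i \<in> sets borel" "measure \<Omega> (F i) = weight i" if "i \<in> ?I" for i
    using Pl[OF imageI[OF that]] that unfolding P_def F_def by blast+
  \<comment> \<open>Default label for the null set \<open>N\<close> on which \<open>X\<close> misses
    all positions.\<close>
  define i0 where "i0 = \<iota> 0"
  define \<iota>' where "\<iota>' \<omega> = (if X \<omega> \<in> x ` ?I then l (X \<omega>) \<omega> else i0)" for \<omega>
  define N where "N = X -` (- (x ` ?I))"
  have N: "N \<in> sets borel" unfolding N_def
    by (intro Xb borel_open open_Compl finite_imp_closed finite_imageI finite_labels)
  have "measure \<Omega> N = measure \<Omega> {\<omega>. x (\<iota> \<omega>) \<in> - (x ` ?I)}" unfolding N_def
    by (intro meas borel_open open_Compl finite_imp_closed finite_imageI finite_labels)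
  also have "{\<omega>. x (\<iota> \<omega>) \<in> - (x ` ?I)} = {}" by auto
  finally have N0: "measure \<Omega> N = 0" by simp
  have fib: "\<iota>' -` {i} = F i \<union> (if i = i0 then N else {})" if i: "i \<in> ?I" for i
  proof (intro set_eqI)
    fix \<omega>
    show "\<omega> \<in> \<iota>' -` {i} \<longleftrightarrow> \<omega> \<in> F i \<union> (if i = i0 then N else {})"
    proof (cases "X \<omega> \<in> x ` ?I")
      case True
      have "l (X \<omega>) \<omega> = i \<longleftrightarrow> X \<omega> = x i \<and> l (x i) \<omega> = i" using l[OF True refl] by auto
      then show ?thesis using True by (simp add: \<iota>'_def N_def F_def)
    next
      case False
      then have "X \<omega> \<noteq> x i" using i by blast
      then show ?thesis using False by (simp add: \<iota>'_def N_def F_def)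
    qed
  qed
  have ran: "range \<iota>' \<subseteq> ?I" using l by (auto simp: \<iota>'_def i0_def)
  have sf: "simple_function \<Omega> \<iota>'"
    unfolding simple_function_def
  proof
    show "finite (\<iota>' ` space \<Omega>)" using ran finite_labels by (auto intro: finite_subset)
    have "\<iota>' -` {i} \<in> sets borel" if "i \<in> ?I" for i
      unfolding fib[OF that] by (rule sets.Un[OF F(1)[OF that]]) (simp add: N)
    then show "\<forall>i\<in>\<iota>' ` space \<Omega>. \<iota>' -` {i} \<inter> space \<Omega> \<in> sets \<Omega>" using ran by simp blast
  qed
  have wt: "measure \<Omega> (\<iota>' -` {i}) = weight i" if i: "i \<in> ?I" for i
  proof -
    have "measure \<Omega> (F i \<union> N) \<le> measure \<Omega> (F i) + measure \<Omega> N"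
      using F[OF i] N by (intro measure_Un_le) simp_all
    moreover have "measure \<Omega> (F i) \<le> measure \<Omega> (F i \<union> N)"
      using F[OF i] N by (intro \<Omega>.finite_measure_mono) auto
    ultimately show ?thesis unfolding fib[OF i] using F[OF i] N0 by simp
  qed
  have "AE \<omega> in \<Omega>. \<omega> \<notin> N"
    using N N0 by (intro AE_not_in) (auto simp: null_sets_def \<Omega>.emeasure_eq_measure)
  then have ae: "AE \<omega> in \<Omega>. X \<omega> = x (\<iota>' \<omega>)"
    by eventually_elim (use l in \<open>auto simp: N_def \<iota>'_def\<close>)
  show ?thesis using sf ran wt ae by blast
qed

lemma lift_derivative_line:
  assumes h: "lift_has_derivative h X A" and Y: "Y \<in> L2"
  shows "((\<lambda>r. h (Law (\<lambda>\<omega>. X \<omega> + r *\<^sub>R Y \<omega>))) has_real_derivative A Y) (at 0)"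
  unfolding has_field_derivative_def has_derivative_at_alt
proof (intro conjI allI impI)
  show "bounded_linear ((*) (A Y))" by (rule bounded_linear_mult_right)
  fix e :: real assume e: "0 < e"
  \<comment> \<open>The summand 1 keeps the quotients meaningful when \<open>Y\<close> has norm
    0.\<close>
  let ?N = "L2norm Y + 1"
  have N: "0 < ?N" using L2norm_nonneg[of Y] by linarith
  have lin: "A (\<lambda>\<omega>. r *\<^sub>R Y \<omega>) = r * A Y" for r
  proof -
    have "A (\<lambda>\<omega>. r *\<^sub>R Y \<omega> + 0 *\<^sub>R Y \<omega>) = r * A Y + 0 * A Y"
      using h Y unfolding lift_has_derivative_def by blast
    then show ?thesis by simp
  qed
  have "\<forall>e>0. \<exists>d>0. \<forall>Y\<in>L2. L2norm Y < d \<longrightarrow>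
        \<bar>h (Law (\<lambda>\<omega>. X \<omega> + Y \<omega>)) - h (Law X) - A Y\<bar> \<le> e * L2norm Y"
    using h unfolding lift_has_derivative_def by blast
  moreover have "0 < e / ?N" using e N by simp
  ultimately obtain d where d: "d > 0" and dd: "\<And>Y. Y \<in> L2 \<Longrightarrow> L2norm Y < d \<Longrightarrow>
        \<bar>h (Law (\<lambda>\<omega>. X \<omega> + Y \<omega>)) - h (Law X) - A Y\<bar> \<le> (e / ?N) * L2norm Y"
    by blast
  show "\<exists>d>0. \<forall>r. norm (r - 0) < d \<longrightarrow>
     norm (h (Law (\<lambda>\<omega>. X \<omega> + r *\<^sub>R Y \<omega>)) - h (Law (\<lambda>\<omega>. X \<omega> + 0 *\<^sub>R Y \<omega>)) - A Y * (r - 0)) \<le> e * norm (r - 0)"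
  proof (intro exI conjI allI impI)
    show "0 < d / ?N" using d N by simp
    fix r :: real assume "norm (r - 0) < d / ?N"
    then have "\<bar>r\<bar> * ?N < d" using N by (simp add: field_simps)
    then have "L2norm (\<lambda>\<omega>. r *\<^sub>R Y \<omega>) < d" unfolding L2norm_scaleR by (simp add: algebra_simps)
    from dd[OF L2_scaleR[OF Y] this]
    have "\<bar>h (Law (\<lambda>\<omega>. X \<omega> + r *\<^sub>R Y \<omega>)) - h (Law X) - r * A Y\<bar> \<le> (e / ?N) * (\<bar>r\<bar> * L2norm Y)"
      unfolding L2norm_scaleR lin .
    also have "\<dots> = (e * \<bar>r\<bar>) * (L2norm Y / ?N)" by simp
    also have "\<dots> \<le> (e * \<bar>r\<bar>) * 1" using e N by (intro mult_left_mono) auto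
    finally show "norm (h (Law (\<lambda>\<omega>. X \<omega> + r *\<^sub>R Y \<omega>)) - h (Law (\<lambda>\<omega>. X \<omega> + 0 *\<^sub>R Y \<omega>)) - A Y * (r - 0)) \<le> e * norm (r - 0)"
      by (simp add: mult.commute)
  qed
qed

text \<open>The lift is differentiable at some \<open>X\<close> with the right law, not necessarily
  at \<open>x (\<iota> \<omega>)\<close>. Up to a null set \<open>X\<close> equals
  \<open>x (\<iota>' \<omega>)\<close> for a relabelling \<open>\<iota>'\<close>, and the direction
  \<open>y (\<iota>' \<omega>)\<close> produces the same perturbed laws as
  \<open>y (\<iota> \<omega>)\<close> does at \<open>x (\<iota> \<omega>)\<close>.\<close>

lemma (in labelling) L_derivative_line:
  fixes x y :: "'i \<Rightarrow> 'b::euclidean_space"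
  assumes "has_L_derivative h (Law (\<lambda>\<omega>. x (\<iota> \<omega>))) \<phi>"
  shows "((\<lambda>r. h (Law (\<lambda>\<omega>. x (\<iota> \<omega>) + r *\<^sub>R y (\<iota> \<omega>)))) has_real_derivative
      (\<Sum>i\<in>range \<iota>. weight i * (\<phi> (x i) \<bullet> y i))) (at 0)"
proof -
  from assms obtain X where X: "X \<in> L2" "Law X = Law (\<lambda>\<omega>. x (\<iota> \<omega>))"
    and lift: "lift_has_derivative h X (\<lambda>Y. \<integral>\<omega>. \<phi> (X \<omega>) \<bullet> Y \<omega> \<partial>\<Omega>)"
    and phi [measurable]: "\<phi> \<in> borel_measurable borel"
    unfolding has_L_derivative_def by blast
  note [measurable] = L2_measurable[OF X(1)]
  from ex_relabelling[OF L2_measurable[OF X(1)] X(2)] obtain \<iota>' where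
    \<iota>': "simple_function \<Omega> \<iota>'" "range \<iota>' \<subseteq> range \<iota>" "\<And>i. i\<in>range \<iota> \<Longrightarrow> measure \<Omega> (\<iota>' -` {i}) = weight i"
    and ae: "AE \<omega> in \<Omega>. X \<omega> = x (\<iota>' \<omega>)" by blast
  have [measurable]: "(\<lambda>\<omega>. u (\<iota>' \<omega>)) \<in> borel_measurable \<Omega>" for u :: "'i \<Rightarrow> 'b"
    by (rule simple_Omega_measurable[OF \<iota>'(1)])
  have law: "Law (\<lambda>\<omega>. X \<omega> + r *\<^sub>R y (\<iota>' \<omega>)) = Law (\<lambda>\<omega>. x (\<iota> \<omega>) + r *\<^sub>R y (\<iota> \<omega>))" for r
  proof -
    have "Law (\<lambda>\<omega>. X \<omega> + r *\<^sub>R y (\<iota>' \<omega>)) = Law (\<lambda>\<omega>. x (\<iota>' \<omega>) + r *\<^sub>R y (\<iota>' \<omega>))"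
      by (rule Law_cong_AE) (measurable, use ae in auto)
    also have "\<dots> = Law (\<lambda>\<omega>. (\<lambda>i. x i + r *\<^sub>R y i) (\<iota> \<omega>))"
      using Law_simple_cong[OF simple \<iota>'(1) finite_labels order_refl \<iota>'(2), of "\<lambda>i. x i + r *\<^sub>R y i"] \<iota>'(3)
      by (simp add: weight_def)
    finally show ?thesis .
  qed
  have "(\<integral>\<omega>. \<phi> (X \<omega>) \<bullet> y (\<iota>' \<omega>) \<partial>\<Omega>) = (\<integral>\<omega>. \<phi> (x (\<iota>' \<omega>)) \<bullet> y (\<iota>' \<omega>) \<partial>\<Omega>)"
    by (rule integral_cong_AE) (measurable, use ae in auto)
  also have "\<dots> = (\<Sum>i\<in>range \<iota>. measure \<Omega> (\<iota>' -` {i}) *\<^sub>R (\<phi> (x i) \<bullet> y i))"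
    by (rule integral_simple_Omega[OF \<iota>'(1) finite_labels \<iota>'(2)])
  finally have eq: "(\<integral>\<omega>. \<phi> (X \<omega>) \<bullet> y (\<iota>' \<omega>) \<partial>\<Omega>) = (\<Sum>i\<in>range \<iota>. weight i * (\<phi> (x i) \<bullet> y i))"
    using \<iota>'(3) by simp
  show ?thesis using lift_derivative_line[OF lift simple_Omega_L2[OF \<iota>'(1)], of y]
    unfolding eq law .
qed

section \<open>Second-order expansion in the measure\<close>

lemma has_derivative_Dif:
  assumes "\<phi> differentiable (at x)"
  shows "(\<phi> has_derivative blinfun_apply (Dif \<phi> x)) (at x)"
  using assms has_derivative_bounded_linear[of \<phi> "frechet_derivative \<phi> (at x)" "at x"]
  by (simp add: frechet_derivative_works Dif_def bounded_linear_Blinfun_apply)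

lemma has_derivative_blinfun_diff:
  "(f has_derivative (\<lambda>u. blinfun_apply A u - blinfun_apply B u)) F \<Longrightarrow> (f has_derivative blinfun_apply (A - B)) F"
  by (simp add: minus_blinfun.rep_eq)

lemma Dif_eqI: "(\<phi> has_derivative blinfun_apply A) (at x) \<Longrightarrow> Dif \<phi> x = A"
  unfolding Dif_def by (metis frechet_derivative_at blinfun_apply_inverse)

lemma Dif_lipschitz:
  assumes "\<And>x. \<phi> differentiable (at x)" "\<And>x. norm (Dif \<phi> x) \<le> c"
  shows "norm (\<phi> y - \<phi> x) \<le> c * norm (y - x)"
proof (rule differentiable_bound[where S=UNIV and f'="\<lambda>x. blinfun_apply (Dif \<phi> x)"])
  show "onorm (blinfun_apply (Dif \<phi> z)) \<le> c" for z
    using assms(2)[of z] by (simp add: norm_blinfun.rep_eq)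
qed (simp_all add: has_derivative_Dif[OF assms(1)])

text \<open>On the segment, \<open>Dif \<phi>\<close> deviates from its value at x by at most c |y -
  x|; the mean value inequality for \<open>\<phi>\<close> minus its linear part then yields the
  constant c, without the factor 1/2. The convex set \<open>S\<close> admits bounds that hold only
  locally.\<close>

lemma Dif_taylor:
  assumes S: "convex S" "x \<in> S" "y \<in> S"
    and d: "\<And>x. x \<in> S \<Longrightarrow> \<phi> differentiable (at x)" "\<And>x. x \<in> S \<Longrightarrow> Dif \<phi> differentiable (at x)"
    and c: "\<And>x. x \<in> S \<Longrightarrow> norm (Dif (Dif \<phi>) x) \<le> c"
  shows "norm (\<phi> y - \<phi> x - blinfun_apply (Dif \<phi> x) (y - x)) \<le> c * (norm (y - x))\<^sup>2"
proof -
  let ?T = "closed_segment x y"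
  have TS: "z \<in> S" if "z \<in> ?T" for z
    using closed_segment_subset[OF S(2,3,1)] that by (rule subsetD)
  have c0: "0 \<le> c" using order_trans[OF norm_ge_zero c[OF S(2)]] .
  have b: "norm (Dif \<phi> z - Dif \<phi> x) \<le> c * norm (y - x)" if z: "z \<in> ?T" for z
  proof -
    have "norm (Dif \<phi> z - Dif \<phi> x) \<le> c * norm (z - x)"
    proof (rule differentiable_bound[where S="?T" and f'="\<lambda>x. blinfun_apply (Dif (Dif \<phi>) x)"])
      show "onorm (blinfun_apply (Dif (Dif \<phi>) z)) \<le> c" if "z \<in> ?T" for z
        using c[OF TS[OF that]] by (simp add: norm_blinfun.rep_eq)
      show "(Dif \<phi> has_derivative blinfun_apply (Dif (Dif \<phi>) z)) (at z within ?T)" if "z \<in> ?T" for z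
        by (rule has_derivative_at_withinI[OF has_derivative_Dif[OF d(2)[OF TS[OF that]]]])
    qed (use z in auto)
    also have "\<dots> \<le> c * norm (y - x)"
      using c0 segment_bound1[OF z] by (intro mult_left_mono) auto
    finally show ?thesis .
  qed
  have "norm ((\<phi> y - blinfun_apply (Dif \<phi> x) y) - (\<phi> x - blinfun_apply (Dif \<phi> x) x)) \<le> (c * norm (y - x)) * norm (y - x)"
  proof (rule differentiable_bound[where S="?T" and f="\<lambda>z. \<phi> z - blinfun_apply (Dif \<phi> x) z"
        and f'="\<lambda>z. blinfun_apply (Dif \<phi> z - Dif \<phi> x)"])
    show "((\<lambda>z. \<phi> z - blinfun_apply (Dif \<phi> x) z) has_derivative blinfun_apply (Dif \<phi> z - Dif \<phi> x)) (at z within ?T)"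
      if "z \<in> ?T" for z
    proof -
      have "((\<lambda>z. \<phi> z - blinfun_apply (Dif \<phi> x) z) has_derivative
          (\<lambda>u. blinfun_apply (Dif \<phi> z) u - blinfun_apply (Dif \<phi> x) u)) (at z)"
        by (intro has_derivative_diff has_derivative_Dif[OF d(1)[OF TS[OF that]]]
            bounded_linear_imp_has_derivative blinfun.bounded_linear_right)
      then show ?thesis by (rule has_derivative_at_withinI[OF has_derivative_blinfun_diff])
    qed
    show "onorm (blinfun_apply (Dif \<phi> z - Dif \<phi> x)) \<le> c * norm (y - x)" if "z \<in> ?T" for z
      using b[OF that] by (simp add: norm_blinfun.rep_eq)
  qed auto
  then show ?thesis by (simp add: blinfun.diff_right power2_eq_square algebra_simps)
qed

text \<open>The mean value inequality twice: in the first variable for the partial derivative in the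
  second one, then in the second variable for \<open>A x1 - A x2\<close>.\<close>

lemma dd_four_points:
  assumes d1: "\<And>x x'. (\<lambda>w. A x w) differentiable (at x')"
    and d2: "\<And>x x'. (\<lambda>u. Dif (\<lambda>w. A u w) x') differentiable (at x)"
    and c: "\<And>x x'. norm (dd A x x') \<le> c"
  shows "norm ((A x1 y1 - A x2 y1) - (A x1 y2 - A x2 y2)) \<le> c * norm (x1 - x2) * norm (y1 - y2)"
proof -
  have D: "norm (Dif (A x1) w - Dif (A x2) w) \<le> c * norm (x1 - x2)" for w
    by (rule Dif_lipschitz[where \<phi>="\<lambda>u. Dif (\<lambda>w. A u w) w"]) (use d2 c in \<open>auto simp: dd_def\<close>)
  show ?thesis
  proof (rule differentiable_bound[where S=UNIV and f="\<lambda>w. A x1 w - A x2 w" and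
        f'="\<lambda>w. blinfun_apply (Dif (A x1) w - Dif (A x2) w)"])
    fix w
    have "((\<lambda>w. A x1 w - A x2 w) has_derivative
          (\<lambda>u. blinfun_apply (Dif (A x1) w) u - blinfun_apply (Dif (A x2) w) u)) (at w)"
      using d1 by (intro has_derivative_diff has_derivative_Dif)
    then show "((\<lambda>w. A x1 w - A x2 w) has_derivative blinfun_apply (Dif (A x1) w - Dif (A x2) w)) (at w within UNIV)"
      by (simp add: has_derivative_blinfun_diff)
    show "onorm (blinfun_apply (Dif (A x1) w - Dif (A x2) w)) \<le> c * norm (x1 - x2)"
      using D by (simp add: norm_blinfun.rep_eq)
  qed auto
qed

section \<open>Mixtures of laws\<close>

lemma P2_D: "\<mu> \<in> P2 \<Longrightarrow> sets \<mu> = sets borel" "\<mu> \<in> P2 \<Longrightarrow> prob_space \<mu>"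
  "\<mu> \<in> P2 \<Longrightarrow> integrable \<mu> (\<lambda>x. (norm x)\<^sup>2)"
  by (auto simp: P2_def)

lemma sets_mix [simp, measurable_cong]: "sets (mix \<theta> \<mu> \<nu>) = sets borel"
  by (simp add: mix_def sets.sigma_sets_eq[of borel, simplified])

lemma space_mix [simp]: "space (mix \<theta> \<mu> \<nu>) = UNIV"
  using sets_eq_imp_space_eq[OF sets_mix[of \<theta> \<mu> \<nu>]] by simp

lemma emeasure_mix:
  assumes [simp]: "sets \<mu> = sets borel" "sets \<nu> = sets borel" and A: "A \<in> sets borel"
  shows "emeasure (mix \<theta> \<mu> \<nu>) A = ennreal \<theta> * emeasure \<mu> A + ennreal (1 - \<theta>) * emeasure \<nu> A"
proof (rule emeasure_measure_of[OF mix_def])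
  show "A \<in> sets (mix \<theta> \<mu> \<nu>)" using A by simp
  show "countably_additive (sets (mix \<theta> \<mu> \<nu>)) (\<lambda>A. ennreal \<theta> * emeasure \<mu> A + ennreal (1 - \<theta>) * emeasure \<nu> A)"
    unfolding countably_additive_def
  proof (intro allI impI)
    fix B :: "nat \<Rightarrow> 'a set" assume "range B \<subseteq> sets (mix \<theta> \<mu> \<nu>)" "disjoint_family B"
    then show "(\<Sum>i. ennreal \<theta> * emeasure \<mu> (B i) + ennreal (1 - \<theta>) * emeasure \<nu> (B i)) =
      ennreal \<theta> * emeasure \<mu> (\<Union> (range B)) + ennreal (1 - \<theta>) * emeasure \<nu> (\<Union> (range B))"
      by (simp add: suminf_add[symmetric] ennreal_suminf_cmult suminf_emeasure)
  qed
qed (auto simp: positive_def)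

lemma nn_integral_mix:
  assumes [simp, measurable_cong]: "sets \<mu> = sets borel" "sets \<nu> = sets borel" and f: "f \<in> borel_measurable borel"
  shows "(\<integral>\<^sup>+x. f x \<partial>mix \<theta> \<mu> \<nu>) = ennreal \<theta> * (\<integral>\<^sup>+x. f x \<partial>\<mu>) + ennreal (1 - \<theta>) * (\<integral>\<^sup>+x. f x \<partial>\<nu>)"
  using f
proof (induction rule: borel_measurable_induct)
  case (cong f g)
  then show ?case by simp
next
  case (set A)
  then show ?case by (simp add: emeasure_mix)
next
  case (mult u c)
  then show ?case by (simp add: nn_integral_cmult distrib_left mult.left_commute)
next
  case (add u v)
  then show ?case by (simp add: nn_integral_add distrib_left ac_simps)
next
  case (seq U)
  note inc = \<open>incseq U\<close>
  have [measurable]: "U i \<in> borel_measurable borel" for i by fact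
  have incI: "incseq (\<lambda>i. c * (\<integral>\<^sup>+x. U i x \<partial>M))" for M :: "'a measure" and c
    using inc by (auto simp: incseq_def le_fun_def intro!: nn_integral_mono mult_left_mono)
  have S: "(\<integral>\<^sup>+x. (SUP i. U i) x \<partial>M) = (SUP i. \<integral>\<^sup>+x. U i x \<partial>M)" if [measurable_cong]: "sets M = sets borel" for M
    unfolding SUP_apply by (rule nn_integral_monotone_convergence_SUP[OF inc]) measurable
  have "(\<integral>\<^sup>+x. (SUP i. U i) x \<partial>mix \<theta> \<mu> \<nu>)
      = (SUP i. ennreal \<theta> * (\<integral>\<^sup>+x. U i x \<partial>\<mu>) + ennreal (1 - \<theta>) * (\<integral>\<^sup>+x. U i x \<partial>\<nu>))"
    unfolding S[OF sets_mix] using seq.IH by simp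
  also have "\<dots> = ennreal \<theta> * (\<integral>\<^sup>+x. (SUP i. U i) x \<partial>\<mu>) + ennreal (1 - \<theta>) * (\<integral>\<^sup>+x. (SUP i. U i) x \<partial>\<nu>)"
    unfolding S[OF assms(1)] S[OF assms(2)] SUP_mult_left_ennreal by (rule ennreal_SUP_add[OF incI incI])
  finally show ?case .
qed

lemma emeasure_UNIV_P2: "\<mu> \<in> P2 \<Longrightarrow> emeasure \<mu> UNIV = 1"
  using prob_space.emeasure_space_1[OF P2_D(2)] sets_eq_imp_space_eq[OF P2_D(1)] by fastforce

lemma nn_integral_norm_square_P2: "\<mu> \<in> P2 \<Longrightarrow> (\<integral>\<^sup>+x. ennreal ((norm x)\<^sup>2) \<partial>\<mu>) = ennreal (\<integral>x. (norm x)\<^sup>2 \<partial>\<mu>)"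
  by (rule nn_integral_eq_integral) (auto dest: P2_D)

lemma mix_P2:
  assumes "\<mu> \<in> P2" "\<nu> \<in> P2" "0 \<le> \<theta>" "\<theta> \<le> 1"
  shows "mix \<theta> \<mu> \<nu> \<in> P2"
    and "(\<integral>x. (norm x)\<^sup>2 \<partial>mix \<theta> \<mu> \<nu>) = \<theta> * (\<integral>x. (norm x)\<^sup>2 \<partial>\<mu>) + (1 - \<theta>) * (\<integral>x. (norm x)\<^sup>2 \<partial>\<nu>)"
proof -
  note s = P2_D(1)[OF assms(1)] P2_D(1)[OF assms(2)]
  have nn: "(\<integral>\<^sup>+x. ennreal ((norm x)\<^sup>2) \<partial>mix \<theta> \<mu> \<nu>)
      = ennreal (\<theta> * (\<integral>x. (norm x)\<^sup>2 \<partial>\<mu>) + (1 - \<theta>) * (\<integral>x. (norm x)\<^sup>2 \<partial>\<nu>))"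
    using assms by (simp add: nn_integral_mix[OF s] nn_integral_norm_square_P2 ennreal_mult[symmetric] ennreal_plus[symmetric] del: ennreal_plus)
  have "emeasure (mix \<theta> \<mu> \<nu>) UNIV = 1"
    using assms by (simp add: emeasure_mix[OF s] emeasure_UNIV_P2 ennreal_plus[symmetric] del: ennreal_plus)
  then have "prob_space (mix \<theta> \<mu> \<nu>)" by (intro prob_spaceI) simp
  moreover have "integrable (mix \<theta> \<mu> \<nu>) (\<lambda>x. (norm x)\<^sup>2)"
    by (rule integrableI_nonneg) (auto simp: nn)
  ultimately show "mix \<theta> \<mu> \<nu> \<in> P2" unfolding P2_def by simp
  show "(\<integral>x. (norm x)\<^sup>2 \<partial>mix \<theta> \<mu> \<nu>) = \<theta> * (\<integral>x. (norm x)\<^sup>2 \<partial>\<mu>) + (1 - \<theta>) * (\<integral>x. (norm x)\<^sup>2 \<partial>\<nu>)"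
    by (rule integral_eq_nn_integral[THEN trans]) (use assms in \<open>simp_all add: nn del: ennreal_plus\<close>)
qed

lemma W2_dirac0_le:
  fixes \<mu> :: "'a::euclidean_space measure"
  assumes "\<mu> \<in> P2" shows "W2 \<mu> dirac0 \<le> sqrt (\<integral>x. (norm x)\<^sup>2 \<partial>\<mu>)"
proof -
  note [measurable_cong] = P2_D(1)[OF assms]
  interpret prob_space \<mu> by (rule P2_D(2)[OF assms])
  have [measurable]: "(\<lambda>x. (x, 0::'a)) \<in> borel_measurable \<mu>" by (rule borel_measurable_Pair) measurable
  let ?\<pi> = "distr \<mu> borel (\<lambda>x. (x, 0::'a))"
  have "distr \<mu> borel (\<lambda>x. x) = \<mu>" by (rule distr_id2) (simp add: P2_D(1)[OF assms])
  then have "?\<pi> \<in> couplings \<mu> dirac0"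
    unfolding couplings_def by (simp add: distr_distr o_def distr_const)
  from W2_le[OF this] show ?thesis by (simp add: integral_distr)
qed

lemma W2_self: assumes "\<mu> \<in> P2" shows "W2 \<mu> \<mu> \<le> 0"
proof -
  note [measurable_cong] = P2_D(1)[OF assms]
  have [measurable]: "(\<lambda>x. (x, x)) \<in> borel_measurable \<mu>" by (rule borel_measurable_Pair) measurable
  let ?\<pi> = "distr \<mu> borel (\<lambda>x. (x, x))"
  have "distr \<mu> borel (\<lambda>x. x) = \<mu>" by (rule distr_id2) (simp add: P2_D(1)[OF assms])
  then have "?\<pi> \<in> couplings \<mu> \<mu>"
    unfolding couplings_def by (simp add: distr_distr o_def)
  from W2_le[OF this] show ?thesis by (simp add: integral_distr)
qed

lemma jcont_continuous:
  assumes "jcont UNIV F" "\<mu> \<in> P2" shows "continuous_on UNIV (F \<mu>)"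
  unfolding continuous_on_iff
proof (intro ballI allI impI)
  fix x and e :: real assume e: "0 < e"
  from assms(1)[unfolded jcont_def, THEN bspec, OF assms(2), THEN bspec, OF UNIV_I[of x], THEN spec, THEN mp, OF e]
  obtain d where d: "d > 0" and D: "\<forall>\<nu>\<in>P2. \<forall>w\<in>UNIV. W2 \<mu> \<nu> < d \<longrightarrow> dist x w < d \<longrightarrow> dist (F \<mu> x) (F \<nu> w) < e"
    by (elim exE conjE)
  have W: "W2 \<mu> \<mu> < d" using W2_self[OF assms(2)] d by linarith
  show "\<exists>d>0. \<forall>x'\<in>UNIV. dist x' x < d \<longrightarrow> dist (F \<mu> x') (F \<mu> x) < e"
  proof (intro exI[of _ d] conjI ballI impI d)
    fix x' assume "dist x' x < d"
    then show "dist (F \<mu> x') (F \<mu> x) < e" using D[rule_format, OF assms(2) UNIV_I W, of x'] by (simp add: dist_commute)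
  qed
qed

section \<open>Integrals against differences of laws, and the quadratic remainder\<close>

text \<open>If \<open>f\<close> is not integrable, its integral is 0 and the bound holds as well.
  Measurability of the remainder in the mixing parameters therefore need not be discussed.\<close>

lemma norm_LINT_unit_le:
  fixes f :: "real \<Rightarrow> 'b::euclidean_space"
  assumes "\<And>s. 0 \<le> s \<Longrightarrow> s \<le> 1 \<Longrightarrow> norm (f s) \<le> B" "0 \<le> B"
  shows "norm (LINT s:{0..1}|lborel. f s) \<le> B"
proof (cases "integrable lborel (\<lambda>s. indicat_real {0..1} s *\<^sub>R f s)")
  case True
  have "norm (LINT s:{0..1}|lborel. f s) \<le> (\<integral>s. norm (indicat_real {0..1} s *\<^sub>R f s) \<partial>lborel)"
    unfolding set_lebesgue_integral_def by (rule integral_norm_bound)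
  also have "\<dots> \<le> (\<integral>s. B * indicat_real {0..1::real} s \<partial>lborel)"
  proof (rule Bochner_Integration.integral_mono)
    show "integrable lborel (\<lambda>s. norm (indicat_real {0..1} s *\<^sub>R f s))" using True by (rule integrable_norm)
    show "integrable lborel (\<lambda>s. B * indicat_real {0..1::real} s)" by simp
    show "norm (indicat_real {0..1} s *\<^sub>R f s) \<le> B * indicat_real {0..1} s" for s
      using assms by (auto simp: indicator_def)
  qed
  also have "\<dots> = B" by simp
  finally show ?thesis .
next
  case False
  then show ?thesis using assms(2) by (simp add: set_lebesgue_integral_def not_integrable_integral_eq)
qed

lemma integrable_quadratic_growth:
  fixes \<phi> :: "'x::euclidean_space \<Rightarrow> 'y::euclidean_space"
  assumes X: "X \<in> L2" and m: "\<phi> \<in> borel_measurable borel"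
    and b: "\<And>x. norm (\<phi> x) \<le> a + c * (norm x)\<^sup>2"
  shows "integrable \<Omega> (\<lambda>\<omega>. \<phi> (X \<omega>))"
proof (rule Bochner_Integration.integrable_bound)
  show "integrable \<Omega> (\<lambda>\<omega>. a + c * (norm (X \<omega>))\<^sup>2)" using L2_square[OF X] by simp
  show "(\<lambda>\<omega>. \<phi> (X \<omega>)) \<in> borel_measurable \<Omega>" using m L2_measurable[OF X] by measurable
  show "AE \<omega> in \<Omega>. norm (\<phi> (X \<omega>)) \<le> norm (a + c * (norm (X \<omega>))\<^sup>2)"
    using b by (intro AE_I2) (metis abs_ge_self order_trans real_norm_def)
qed

lemma dint_Law:
  fixes \<phi> :: "'x::euclidean_space \<Rightarrow> 'y::euclidean_space"
  assumes "X \<in> L2" "X' \<in> L2" "\<phi> \<in> borel_measurable borel" "\<And>x. norm (\<phi> x) \<le> a + c * (norm x)\<^sup>2"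
  shows "dint (Law X') (Law X) \<phi> = (\<integral>\<omega>. \<phi> (X' \<omega>) - \<phi> (X \<omega>) \<partial>\<Omega>)"
proof -
  have "integrable \<Omega> (\<lambda>\<omega>. \<phi> (X \<omega>))" "integrable \<Omega> (\<lambda>\<omega>. \<phi> (X' \<omega>))"
    using assms by (auto intro: integrable_quadratic_growth)
  then show ?thesis unfolding dint_def using assms by (simp add: integral_Law L2_measurable)
qed

lemma dint_lipschitz:
  fixes \<psi> :: "'x::euclidean_space \<Rightarrow> 'y::euclidean_space"
  assumes X: "X \<in> L2" "X' \<in> L2" and c: "0 \<le> c" and l: "\<And>x y. norm (\<psi> x - \<psi> y) \<le> c * norm (x - y)"
  shows "norm (dint (Law X') (Law X) \<psi>) \<le> c * (\<integral>\<omega>. norm (X' \<omega> - X \<omega>) \<partial>\<Omega>)"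
proof -
  have "c-lipschitz_on UNIV \<psi>" using l c by (auto intro!: lipschitz_onI simp: dist_norm)
  then have m: "\<psi> \<in> borel_measurable borel"
    by (intro borel_measurable_continuous_onI lipschitz_on_continuous_on)
  have b: "norm (\<psi> x) \<le> (norm (\<psi> 0) + c) + c * (norm x)\<^sup>2" for x
  proof -
    have "norm x \<le> 1 + (norm x)\<^sup>2"
      using sum_squares_bound[of 1 "norm x"] norm_ge_zero[of x] unfolding power2_eq_square by linarith
    then have "c * norm x \<le> c * (1 + (norm x)\<^sup>2)" using c by (intro mult_left_mono)
    then show ?thesis using norm_triangle_sub[of "\<psi> x" "\<psi> 0"] l[of x 0] by (simp add: algebra_simps)
  qed
  have "norm (dint (Law X') (Law X) \<psi>) \<le> (\<integral>\<omega>. norm (\<psi> (X' \<omega>) - \<psi> (X \<omega>)) \<partial>\<Omega>)"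
    unfolding dint_Law[OF X m b] by (rule integral_norm_bound)
  also have "\<dots> \<le> (\<integral>\<omega>. c * norm (X' \<omega> - X \<omega>) \<partial>\<Omega>)"
    using integrable_quadratic_growth[OF X(1) m b] integrable_quadratic_growth[OF X(2) m b] L2_norm_integrable[OF L2_diff[OF X(2,1)]] l
    by (intro Bochner_Integration.integral_mono) auto
  finally show ?thesis by simp
qed

text \<open>By the four-point bound the inner difference of integrals is Lipschitz in the outer
  variable, with constant c E|X' - X|. Applying \<open>dint_lipschitz\<close> once more gives c
  (E|X' - X|)^2, which the L2 norm dominates.\<close>

lemma dint_dint_le:
  fixes A :: "'x::euclidean_space \<Rightarrow> 'x \<Rightarrow> 'y::euclidean_space"
  assumes X: "X \<in> L2" "X' \<in> L2" and c: "0 \<le> c"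
    and cont: "continuous_on UNIV (\<lambda>(x, x'). A x x')"
    and growth: "\<And>x x'. norm (A x x') \<le> a * (1 + (norm x)\<^sup>2 + (norm x')\<^sup>2)"
    and four: "\<And>x1 x2 y1 y2. norm ((A x1 y1 - A x2 y1) - (A x1 y2 - A x2 y2)) \<le> c * norm (x1 - x2) * norm (y1 - y2)"
  shows "norm (dint (Law X') (Law X) (\<lambda>x'. dint (Law X') (Law X) (\<lambda>x. A x x'))) \<le> c * (L2norm (\<lambda>\<omega>. X' \<omega> - X \<omega>))\<^sup>2"
proof -
  let ?E = "\<integral>\<omega>. norm (X' \<omega> - X \<omega>) \<partial>\<Omega>"
  have E: "0 \<le> ?E" "?E \<le> L2norm (\<lambda>\<omega>. X' \<omega> - X \<omega>)"
    using L1_le_L2norm[OF L2_diff[OF X(2,1)]] by auto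
  have m: "(\<lambda>x. A x y) \<in> borel_measurable borel" for y
  proof (rule borel_measurable_continuous_onI)
    have "continuous_on UNIV ((\<lambda>(x, x'). A x x') \<circ> (\<lambda>x. (x, y)))"
      by (intro continuous_on_compose continuous_on_subset[OF cont] continuous_intros) auto
    then show "continuous_on UNIV (\<lambda>x. A x y)" by (simp add: o_def)
  qed
  have b: "norm (A x y) \<le> a * (1 + (norm y)\<^sup>2) + a * (norm x)\<^sup>2" for x y
    using growth[of x y] by (simp add: algebra_simps)
  define \<psi> where "\<psi> y = dint (Law X') (Law X) (\<lambda>x. A x y)" for y
  have "norm (\<psi> y1 - \<psi> y2) \<le> (c * ?E) * norm (y1 - y2)" for y1 y2
  proof -
    have i: "integrable \<Omega> (\<lambda>\<omega>. A (X \<omega>) y)" "integrable \<Omega> (\<lambda>\<omega>. A (X' \<omega>) y)" for y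
      using integrable_quadratic_growth[OF X(1) m b] integrable_quadratic_growth[OF X(2) m b] by auto
    have "\<psi> y1 - \<psi> y2 = (\<integral>\<omega>. (A (X' \<omega>) y1 - A (X \<omega>) y1) - (A (X' \<omega>) y2 - A (X \<omega>) y2) \<partial>\<Omega>)"
      unfolding \<psi>_def dint_Law[OF X m b] using i by simp
    also have "norm \<dots> \<le> (\<integral>\<omega>. norm ((A (X' \<omega>) y1 - A (X \<omega>) y1) - (A (X' \<omega>) y2 - A (X \<omega>) y2)) \<partial>\<Omega>)"
      by (rule integral_norm_bound)
    also have "\<dots> \<le> (\<integral>\<omega>. c * norm (y1 - y2) * norm (X' \<omega> - X \<omega>) \<partial>\<Omega>)"
      using i L2_norm_integrable[OF L2_diff[OF X(2,1)]] four
      by (intro Bochner_Integration.integral_mono) (auto simp: mult.assoc mult.commute[of "norm (y1 - y2)"])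
    finally show ?thesis by (simp add: mult_ac)
  qed
  from dint_lipschitz[OF X _ this] have "norm (dint (Law X') (Law X) \<psi>) \<le> c * (?E * ?E)"
    using c E by (simp add: mult_ac)
  also have "\<dots> \<le> c * (L2norm (\<lambda>\<omega>. X' \<omega> - X \<omega>))\<^sup>2"
    using c E unfolding power2_eq_square by (intro mult_left_mono mult_mono) (auto simp: L2norm_nonneg)
  finally show ?thesis unfolding \<psi>_def .
qed

lemma blinfun_apply_Basis: "blinfun_apply A u = (\<Sum>b\<in>Basis. (u \<bullet> b) *\<^sub>R blinfun_apply A b)"
  for u :: "'b::euclidean_space"
proof -
  have "blinfun_apply A u = blinfun_apply A (\<Sum>b\<in>Basis. (u \<bullet> b) *\<^sub>R b)"
    by (simp only: euclidean_representation)
  also have "\<dots> = (\<Sum>b\<in>Basis. (u \<bullet> b) *\<^sub>R blinfun_apply A b)"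
    by (simp only: blinfun.sum_right blinfun.scaleR_right)
  finally show ?thesis .
qed

lemma borel_measurable_blinfun_apply:
  fixes \<Phi> :: "'b::euclidean_space \<Rightarrow> 'c::euclidean_space \<Rightarrow>\<^sub>L 'd::euclidean_space"
  assumes c: "continuous_on UNIV \<Phi>" and [measurable]: "X \<in> borel_measurable M" "Y \<in> borel_measurable M"
  shows "(\<lambda>\<omega>. blinfun_apply (\<Phi> (X \<omega>)) (Y \<omega>)) \<in> borel_measurable M"
proof -
  have [measurable]: "(\<lambda>x. blinfun_apply (\<Phi> x) b) \<in> borel_measurable borel" for b
    by (intro borel_measurable_continuous_onI continuous_intros c)
  show ?thesis unfolding blinfun_apply_Basis[of _ "Y _"] by measurable
qed

text \<open>Each half of the constant \<open>2 * c\<close> has its own source: the Taylor remainder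
  of \<open>D1 (Law X)\<close> between X and X', and the double integral of \<open>D2\<close> along
  the mixtures of both laws. The two vectors are coupled arbitrarily, so the laws may be joined by
  any displacement.\<close>

lemma lfd2_expansion:
  fixes h :: "'x::euclidean_space measure \<Rightarrow> 'y::euclidean_space"
  assumes h1: "has_lfd h D1" and h2: "has_lfd2 h D1 D2" and X: "X \<in> L2" "X' \<in> L2"
    and tw: "twice_differentiable (D1 (Law X))"
    and c1: "\<And>x. norm (Dif (Dif (D1 (Law X))) x) \<le> c"
    and d2: "\<And>\<mu> x x'. \<mu> \<in> P2 \<Longrightarrow> (\<lambda>w. D2 \<mu> x w) differentiable (at x') \<and>
           (\<lambda>u. Dif (\<lambda>w. D2 \<mu> u w) x') differentiable (at x)"
    and c2: "\<And>s x x'. 0 \<le> s \<Longrightarrow> s \<le> 1 \<Longrightarrow> norm (dd (D2 (mix s (Law X') (Law X))) x x') \<le> c"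
  shows "integrable \<Omega> (\<lambda>\<omega>. blinfun_apply (Dif (D1 (Law X)) (X \<omega>)) (X' \<omega> - X \<omega>))"
    and "norm (h (Law X') - h (Law X) - (\<integral>\<omega>. blinfun_apply (Dif (D1 (Law X)) (X \<omega>)) (X' \<omega> - X \<omega>) \<partial>\<Omega>))
      \<le> 2 * c * (L2norm (\<lambda>\<omega>. X' \<omega> - X \<omega>))\<^sup>2"
proof -
  let ?D = "D1 (Law X)" and ?N = "L2norm (\<lambda>\<omega>. X' \<omega> - X \<omega>)"
  note [measurable] = L2_measurable[OF X(1)] L2_measurable[OF X(2)]
  have P: "Law X \<in> P2" "Law X' \<in> P2" using X by (auto intro: Law_P2)
  have c0: "0 \<le> c" using order_trans[OF norm_ge_zero c1] .
  note h1u = h1[unfolded has_lfd_def] and h2u = h2[unfolded has_lfd2_def]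
  obtain k where k: "\<And>\<mu> x. \<mu> \<in> P2 \<Longrightarrow> norm (D1 \<mu> x) \<le> k \<mu> * (1 + (norm x)\<^sup>2)"
    using h1u[THEN conjunct2, THEN conjunct1] by blast
  have b: "norm (?D x) \<le> k (Law X) + k (Law X) * (norm x)\<^sup>2" for x
    using k[OF P(1), of x] by (simp add: algebra_simps)
  have m: "?D \<in> borel_measurable borel"
    by (intro borel_measurable_continuous_onI jcont_continuous[OF h1u[THEN conjunct1] P(1)])
  have DX: "integrable \<Omega> (\<lambda>\<omega>. ?D (X \<omega>))" "integrable \<Omega> (\<lambda>\<omega>. ?D (X' \<omega>))"
    using integrable_quadratic_growth[OF X(1) m b] integrable_quadratic_growth[OF X(2) m b] by auto
  have cD: "continuous_on UNIV (Dif ?D)"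
    using tw unfolding twice_differentiable_def
    by (auto intro!: continuous_at_imp_continuous_on differentiable_imp_continuous_within)
  have mD: "(\<lambda>\<omega>. blinfun_apply (Dif ?D (X \<omega>)) (X' \<omega> - X \<omega>)) \<in> borel_measurable \<Omega>"
    by (rule borel_measurable_blinfun_apply[OF cD]) measurable
  have pt: "norm (?D (X' \<omega>) - ?D (X \<omega>) - blinfun_apply (Dif ?D (X \<omega>)) (X' \<omega> - X \<omega>)) \<le> c * (norm (X' \<omega> - X \<omega>))\<^sup>2" for \<omega>
    by (rule Dif_taylor[where S=UNIV]) (use tw c1 in \<open>auto simp: twice_differentiable_def\<close>)
  have iN: "integrable \<Omega> (\<lambda>\<omega>. c * (norm (X' \<omega> - X \<omega>))\<^sup>2)" using L2_square[OF L2_diff[OF X(2,1)]] by simp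
  have iR: "integrable \<Omega> (\<lambda>\<omega>. ?D (X' \<omega>) - ?D (X \<omega>) - blinfun_apply (Dif ?D (X \<omega>)) (X' \<omega> - X \<omega>))"
    by (rule Bochner_Integration.integrable_bound[OF iN])
       (use m mD pt c0 in \<open>auto intro!: AE_I2\<close>)
  from Bochner_Integration.integrable_diff[OF Bochner_Integration.integrable_diff[OF DX(2,1)] this]
  show iD: "integrable \<Omega> (\<lambda>\<omega>. blinfun_apply (Dif ?D (X \<omega>)) (X' \<omega> - X \<omega>))" by simp
  have eq: "dint (Law X') (Law X) ?D - (\<integral>\<omega>. blinfun_apply (Dif ?D (X \<omega>)) (X' \<omega> - X \<omega>) \<partial>\<Omega>)
     = (\<integral>\<omega>. ?D (X' \<omega>) - ?D (X \<omega>) - blinfun_apply (Dif ?D (X \<omega>)) (X' \<omega> - X \<omega>) \<partial>\<Omega>)"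
    unfolding dint_Law[OF X m b] using DX iD by simp
  have "norm (dint (Law X') (Law X) ?D - (\<integral>\<omega>. blinfun_apply (Dif ?D (X \<omega>)) (X' \<omega> - X \<omega>) \<partial>\<Omega>))
     \<le> (\<integral>\<omega>. norm (?D (X' \<omega>) - ?D (X \<omega>) - blinfun_apply (Dif ?D (X \<omega>)) (X' \<omega> - X \<omega>)) \<partial>\<Omega>)"
    unfolding eq by (rule integral_norm_bound)
  also have "\<dots> \<le> (\<integral>\<omega>. c * (norm (X' \<omega> - X \<omega>))\<^sup>2 \<partial>\<Omega>)"
    using integrable_norm[OF iR] iN by (rule Bochner_Integration.integral_mono) (rule pt)
  also have "\<dots> = c * ?N\<^sup>2" unfolding L2norm_sq by (rule integral_mult_right_zero)
  finally have first: "norm (dint (Law X') (Law X) ?D - (\<integral>\<omega>. blinfun_apply (Dif ?D (X \<omega>)) (X' \<omega> - X \<omega>) \<partial>\<Omega>)) \<le> c * ?N\<^sup>2" .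
  obtain k2 where k2: "\<And>\<mu> x x'. \<mu> \<in> P2 \<Longrightarrow> norm (D2 \<mu> x x') \<le> k2 \<mu> * (1 + (norm x)\<^sup>2 + (norm x')\<^sup>2)"
    using h2u[THEN conjunct2, THEN conjunct1] by blast
  define R where "R = (LINT \<theta>:{0..1}|lborel. LINT l:{0..1}|lborel.
           \<theta> *\<^sub>R dint (Law X') (Law X) (\<lambda>x'. dint (Law X') (Law X) (\<lambda>x. D2 (mix (l * \<theta>) (Law X') (Law X)) x x')))"
  have cN: "0 \<le> c * ?N\<^sup>2" using c0 by simp
  have second: "norm R \<le> c * ?N\<^sup>2"
    unfolding R_def
  proof (intro norm_LINT_unit_le cN)
    fix \<theta> l :: real assume \<theta>: "0 \<le> \<theta>" "\<theta> \<le> 1" and l: "0 \<le> l" "l \<le> 1"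
    then have s: "0 \<le> l * \<theta>" "l * \<theta> \<le> 1" by (auto simp: mult_le_one)
    let ?m = "mix (l * \<theta>) (Law X') (Law X)"
    have mP: "?m \<in> P2" by (rule mix_P2(1)[OF P(2,1) s])
    have "norm (dint (Law X') (Law X) (\<lambda>x'. dint (Law X') (Law X) (\<lambda>x. D2 ?m x x'))) \<le> c * ?N\<^sup>2"
    proof (rule dint_dint_le[OF X c0])
      show "continuous_on UNIV (\<lambda>(x, x'). D2 ?m x x')"
        using jcont_continuous[OF h2u[THEN conjunct1] mP] by simp
      show "norm ((D2 ?m x1 y1 - D2 ?m x2 y1) - (D2 ?m x1 y2 - D2 ?m x2 y2)) \<le> c * norm (x1 - x2) * norm (y1 - y2)" for x1 x2 y1 y2
        by (rule dd_four_points) (use d2[OF mP] c2[OF s] in auto)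
    qed (rule k2[OF mP])
    then show "norm (\<theta> *\<^sub>R dint (Law X') (Law X) (\<lambda>x'. dint (Law X') (Law X) (\<lambda>x. D2 ?m x x'))) \<le> c * ?N\<^sup>2"
      using \<theta> mult_mono[of \<theta> 1 "norm (dint (Law X') (Law X) (\<lambda>x'. dint (Law X') (Law X) (\<lambda>x. D2 ?m x x')))" "c * ?N\<^sup>2"] by simp
  qed
  have "h (Law X') - h (Law X) = dint (Law X') (Law X) ?D + R"
    unfolding R_def by (rule h2u[THEN conjunct2, THEN conjunct2, THEN conjunct2, rule_format, OF P(2,1)])
  then have "norm (h (Law X') - h (Law X) - (\<integral>\<omega>. blinfun_apply (Dif ?D (X \<omega>)) (X' \<omega> - X \<omega>) \<partial>\<Omega>))
     = norm ((dint (Law X') (Law X) ?D - (\<integral>\<omega>. blinfun_apply (Dif ?D (X \<omega>)) (X' \<omega> - X \<omega>) \<partial>\<Omega>)) + R)"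
    by (simp add: algebra_simps)
  also have "\<dots> \<le> c * ?N\<^sup>2 + c * ?N\<^sup>2" by (intro norm_triangle_mono first second)
  finally show "norm (h (Law X') - h (Law X) - (\<integral>\<omega>. blinfun_apply (Dif ?D (X \<omega>)) (X' \<omega> - X \<omega>) \<partial>\<Omega>))
      \<le> 2 * c * ?N\<^sup>2" by simp
qed

section \<open>The L-derivative of a regularly differentiable function\<close>

lemma riesz_inner: "linear A \<Longrightarrow> riesz A \<bullet> u = A u"
  for A :: "'b::euclidean_space \<Rightarrow> real"
proof -
  assume A: "linear A"
  have "A u = A (\<Sum>b\<in>Basis. (u \<bullet> b) *\<^sub>R b)" by (simp only: euclidean_representation)
  also have "\<dots> = (\<Sum>b\<in>Basis. (u \<bullet> b) * A b)"
    using A by (simp add: linear_sum linear_scale)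
  also have "\<dots> = riesz A \<bullet> u"
    unfolding riesz_def inner_sum_left by (intro sum.cong) (simp_all add: inner_commute)
  finally show ?thesis ..
qed

lemma linear_blinfun2: "linear (\<lambda>u. blinfun_apply l (blinfun_apply A u))"
  by (intro linearI) (simp_all add: blinfun.add_right blinfun.scaleR_right)

lemma norm_riesz_le: "norm (riesz (\<lambda>u. blinfun_apply l (blinfun_apply A u))) \<le> norm l * norm A"
  for A :: "'b::euclidean_space \<Rightarrow>\<^sub>L 'c::real_normed_vector"
proof -
  let ?r = "riesz (\<lambda>u. blinfun_apply l (blinfun_apply A u))"
  have "(norm ?r)\<^sup>2 = blinfun_apply l (blinfun_apply A ?r)"
    unfolding power2_norm_eq_inner by (rule riesz_inner[OF linear_blinfun2])
  also have "\<dots> \<le> norm l * (norm A * norm ?r)"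
    using norm_blinfun[of l "blinfun_apply A ?r"] mult_left_mono[OF norm_blinfun[of A ?r], of "norm l"] by simp
  finally have "norm ?r * norm ?r \<le> (norm l * norm A) * norm ?r" by (simp add: power2_eq_square mult.assoc)
  then show ?thesis by (cases "norm ?r = 0") auto
qed

lemma jcontI_seq:
  assumes "\<And>\<mu> z \<mu>s zs. \<mu> \<in> P2 \<Longrightarrow> (\<And>k. \<mu>s k \<in> P2) \<Longrightarrow>
    (\<lambda>k::nat. W2 \<mu> (\<mu>s k)) \<longlonglongrightarrow> 0 \<Longrightarrow> zs \<longlonglongrightarrow> z \<Longrightarrow> (\<lambda>k. F (\<mu>s k) (zs k)) \<longlonglongrightarrow> F \<mu> z"
    and W2_nonneg: "\<And>\<mu> \<nu> :: 'x::euclidean_space measure. 0 \<le> W2 \<mu> \<nu>"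
  shows "jcont UNIV (F :: 'x measure \<Rightarrow> 'z::metric_space \<Rightarrow> 'y::metric_space)"
  unfolding jcont_def
proof (intro ballI allI impI)
  fix \<mu> :: "'x measure" and z :: 'z and e :: real
  assume \<mu>: "\<mu> \<in> P2" and e: "0 < e"
  show "\<exists>d>0. \<forall>\<nu>\<in>P2. \<forall>w\<in>UNIV. W2 \<mu> \<nu> < d \<longrightarrow> dist z w < d \<longrightarrow> dist (F \<mu> z) (F \<nu> w) < e"
  proof (rule ccontr)
    assume neg: "\<not> ?thesis"
    define P where "P k w \<longleftrightarrow> fst w \<in> P2 \<and> W2 \<mu> (fst w) < 1 / real (Suc k) \<and> dist z (snd w) < 1 / real (Suc k)
      \<and> \<not> dist (F \<mu> z) (F (fst w) (snd w)) < e" for k w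
    have neg': "\<exists>\<nu>\<in>P2. \<exists>w. W2 \<mu> \<nu> < d \<and> dist z w < d \<and> \<not> dist (F \<mu> z) (F \<nu> w) < e" if "0 < d" for d
      using neg that by auto
    have "\<exists>w. P k w" for k
    proof -
      have "(1 / real (Suc k)) > 0" by simp
      from neg'[OF this] obtain \<nu> w where "P k (\<nu>, w)" unfolding P_def by auto
      then show ?thesis by blast
    qed
    then obtain w where w: "\<And>k. P k (w k)" by metis
    have z: "(\<lambda>k. 1 / real (Suc k)) \<longlonglongrightarrow> 0"
      using LIMSEQ_inverse_real_of_nat by (simp add: inverse_eq_divide)
    have "(\<lambda>k. F (fst (w k)) (snd (w k))) \<longlonglongrightarrow> F \<mu> z"
    proof (rule assms(1)[OF \<mu>])
      show "fst (w k) \<in> P2" for k using w unfolding P_def by blast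
      show "(\<lambda>k. W2 \<mu> (fst (w k))) \<longlonglongrightarrow> 0"
        by (rule Lim_null_comparison[OF _ z], rule always_eventually)
           (use w W2_nonneg[of \<mu>] in \<open>auto simp: P_def less_imp_le\<close>)
      have "(\<lambda>k. dist (snd (w k)) z) \<longlonglongrightarrow> 0"
        by (rule Lim_null_comparison[OF _ z], rule always_eventually)
           (use w in \<open>auto simp: P_def less_imp_le dist_commute\<close>)
      then show "(\<lambda>k. snd (w k)) \<longlonglongrightarrow> z" by (rule iffD2[OF tendsto_dist_iff])
    qed
    from tendstoD[OF this e] have "\<forall>\<^sub>F k in sequentially. dist (F (fst (w k)) (snd (w k))) (F \<mu> z) < e" .
    then show False using w unfolding P_def by (auto simp: eventually_sequentially dist_commute)
  qed
qed

lemma W2_nonneg: "0 \<le> W2 \<mu> \<nu>"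
  by (simp add: wasserstein_def)

text \<open>Difference quotients of \<open>D\<close> converge, and their errors are controlled by the locally bounded
  second derivative.\<close>

lemma jcont_Dif:
  fixes D :: "'x::euclidean_space measure \<Rightarrow> 'x \<Rightarrow> 'y::euclidean_space"
  assumes D: "jcont UNIV D" and tw: "\<And>\<mu>. \<mu> \<in> P2 \<Longrightarrow> twice_differentiable (D \<mu>)"
    and H: "jcont UNIV (\<lambda>\<mu> x. Dif (Dif (D \<mu>)) x)"
  shows "jcont UNIV (\<lambda>\<mu> x. Dif (D \<mu>) x)"
proof (rule jcontI_seq[OF _ W2_nonneg])
  fix \<mu> :: "'x measure" and x :: 'x and \<mu>s xs
  assume \<mu>: "\<mu> \<in> P2" "\<And>k. \<mu>s k \<in> P2" and W: "(\<lambda>k::nat. W2 \<mu> (\<mu>s k)) \<longlonglongrightarrow> 0" and xs: "xs \<longlonglongrightarrow> x"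
  from H[unfolded jcont_def, THEN bspec, OF \<mu>(1), THEN bspec, OF UNIV_I[of x], THEN spec, THEN mp, OF zero_less_one]
  obtain d where d: "d > 0" and dd: "\<forall>\<nu>\<in>P2. \<forall>w\<in>UNIV. W2 \<mu> \<nu> < d \<longrightarrow> dist x w < d \<longrightarrow>
      dist (Dif (Dif (D \<mu>)) x) (Dif (Dif (D \<nu>)) w) < 1"
    by (elim exE conjE)
  define M where "M = norm (Dif (Dif (D \<mu>)) x) + 1"
  have M: "0 < M" by (simp add: M_def add_nonneg_pos)
  have bound: "norm (D \<nu> (w + u) - D \<nu> w - blinfun_apply (Dif (D \<nu>) w) u) \<le> M * (norm u)\<^sup>2"
    if \<nu>: "\<nu> \<in> P2" "W2 \<mu> \<nu> < d" and w: "dist x w < d / 2" "norm u < d / 2" for \<nu> w u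
  proof -
    have "norm (D \<nu> (w + u) - D \<nu> w - blinfun_apply (Dif (D \<nu>) w) ((w + u) - w)) \<le> M * (norm ((w + u) - w))\<^sup>2"
    proof (rule Dif_taylor[of "ball x d"])
      have "dist x (w + u) \<le> dist x w + dist w (w + u)" by (rule dist_triangle)
      then show "w + u \<in> ball x d" using w by (simp add: dist_norm)
      show "w \<in> ball x d" using w d by simp
      show "norm (Dif (Dif (D \<nu>)) z) \<le> M" if "z \<in> ball x d" for z
      proof -
        have "dist (Dif (Dif (D \<mu>)) x) (Dif (Dif (D \<nu>)) z) < 1"
          using dd[rule_format, OF \<nu>(1) UNIV_I \<nu>(2)] that by simp
        then show ?thesis
          using norm_triangle_sub[of "Dif (Dif (D \<nu>)) z" "Dif (Dif (D \<mu>)) x"]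
          by (simp add: M_def dist_norm norm_minus_commute)
      qed
    qed (use tw[OF \<nu>(1)] in \<open>auto simp: twice_differentiable_def\<close>)
    then show ?thesis by simp
  qed
  show "(\<lambda>k. Dif (D (\<mu>s k)) (xs k)) \<longlonglongrightarrow> Dif (D \<mu>) x"
  \<comment> \<open>In finite dimension, linear maps converge in norm once they converge on the
    basis.\<close>
  proof (rule tendsto_componentwise1)
    fix b :: 'x assume b: "b \<in> Basis"
    show "(\<lambda>k. blinfun_apply (Dif (D (\<mu>s k)) (xs k)) b) \<longlonglongrightarrow> blinfun_apply (Dif (D \<mu>) x) b"
    proof (rule tendstoI)
      fix e :: real assume e: "0 < e"
      \<comment> \<open>Step of the difference quotient: below \<open>d / 2\<close>, so that the
        local bound applies, and with \<open>M * s\<close> at most \<open>e / 4\<close>, so that the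
        two Taylor errors together use at most half of \<open>s * e\<close>.\<close>
      define s where "s = min (d / 4) (e / (4 * M))"
      have s: "0 < s" "s < d / 2" "M * s \<le> e / 4" using d e M by (auto simp: s_def min_def field_simps)
      have nb: "norm (s *\<^sub>R b) = s" using b s by simp
      have c1: "(\<lambda>k. D (\<mu>s k) (xs k + s *\<^sub>R b) - D (\<mu>s k) (xs k)) \<longlonglongrightarrow> D \<mu> (x + s *\<^sub>R b) - D \<mu> x"
        by (intro tendsto_diff jcontD[OF D \<mu>(1) UNIV_I \<mu>(2) UNIV_I W] tendsto_add xs tendsto_const)
      have "0 < s * e / 2" using s e by simp
      from tendstoD[OF c1 this] have ev: "\<forall>\<^sub>F k in sequentially. dist (D (\<mu>s k) (xs k + s *\<^sub>R b) - D (\<mu>s k) (xs k)) (D \<mu> (x + s *\<^sub>R b) - D \<mu> x) < s * e / 2" .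
      have ev2: "\<forall>\<^sub>F k in sequentially. W2 \<mu> (\<mu>s k) < d" by (rule order_tendstoD(2)[OF W d])
      have ev3: "\<forall>\<^sub>F k in sequentially. dist (xs k) x < d / 2" by (rule tendstoD[OF xs]) (use d in simp)
      have b0: "norm (D \<mu> (x + s *\<^sub>R b) - D \<mu> x - blinfun_apply (Dif (D \<mu>) x) (s *\<^sub>R b)) \<le> M * s\<^sup>2"
        using bound[OF \<mu>(1), of x "s *\<^sub>R b"] W2_self[OF \<mu>(1)] d s(2) nb by simp
      show "\<forall>\<^sub>F k in sequentially. dist (blinfun_apply (Dif (D (\<mu>s k)) (xs k)) b) (blinfun_apply (Dif (D \<mu>) x) b) < e"
        using ev ev2 ev3
      proof eventually_elim
        case (elim k)
        let ?P = "D (\<mu>s k) (xs k + s *\<^sub>R b) - D (\<mu>s k) (xs k)" and ?Q = "D \<mu> (x + s *\<^sub>R b) - D \<mu> x"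
        let ?p = "blinfun_apply (Dif (D (\<mu>s k)) (xs k)) b" and ?q = "blinfun_apply (Dif (D \<mu>) x) b"
        have bk: "norm (?P - s *\<^sub>R ?p) \<le> M * s\<^sup>2"
          using bound[OF \<mu>(2) elim(2), of "xs k" "s *\<^sub>R b"] elim(3) s(2) nb
          by (simp add: dist_commute blinfun.scaleR_right)
        have b0': "norm (?Q - s *\<^sub>R ?q) \<le> M * s\<^sup>2" using b0 by (simp add: blinfun.scaleR_right)
        have "s *\<^sub>R (?p - ?q) = (?P - ?Q) - (?P - s *\<^sub>R ?p) + (?Q - s *\<^sub>R ?q)" by (simp add: algebra_simps)
        then have "norm (s *\<^sub>R (?p - ?q)) \<le> norm (?P - ?Q) + norm (?P - s *\<^sub>R ?p) + norm (?Q - s *\<^sub>R ?q)"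
          using norm_triangle_ineq[of "(?P - ?Q) - (?P - s *\<^sub>R ?p)" "?Q - s *\<^sub>R ?q"]
            norm_triangle_ineq4[of "?P - ?Q" "?P - s *\<^sub>R ?p"] by simp
        also have "\<dots> < s * e / 2 + M * s\<^sup>2 + M * s\<^sup>2" using elim(1) bk b0' by (simp add: dist_norm)
        also have "\<dots> \<le> s * e"
        proof -
          have "M * s\<^sup>2 = s * (M * s)" by (simp add: power2_eq_square)
          moreover have "s * (M * s) \<le> s * (e / 4)" using s by (intro mult_left_mono) auto
          ultimately show ?thesis by linarith
        qed
        finally have "s * norm (?p - ?q) < s * e" using s(1) by simp
        then show ?case using s(1) by (simp add: dist_norm)
      qed
    qed
  qed
qed

lemma linear_growth_square_integrable:
  fixes \<phi> :: "'x::euclidean_space \<Rightarrow> 'y::euclidean_space"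
  assumes X: "X \<in> L2" and m: "\<phi> \<in> borel_measurable borel" and b: "\<And>x. norm (\<phi> x) \<le> a + c * norm x"
  shows "(\<lambda>\<omega>. \<phi> (X \<omega>)) \<in> L2"
proof (rule L2_I)
  note [measurable] = L2_measurable[OF X] m
  show "(\<lambda>\<omega>. \<phi> (X \<omega>)) \<in> borel_measurable \<Omega>" by measurable
  show "integrable \<Omega> (\<lambda>\<omega>. (norm (\<phi> (X \<omega>)))\<^sup>2)"
  proof (rule integrable_quadratic_growth[OF X])
    fix x
    have "(norm (\<phi> x))\<^sup>2 \<le> (a + c * norm x)\<^sup>2" using b by (intro power_mono) auto
    also have "\<dots> \<le> 2 * a\<^sup>2 + 2 * (c * norm x)\<^sup>2" using norm_add_square_le[of a "c * norm x"] by simp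
    finally show "norm ((norm (\<phi> x))\<^sup>2) \<le> 2 * a\<^sup>2 + (2 * c\<^sup>2) * (norm x)\<^sup>2" by (simp add: power_mult_distrib)
  qed measurable
qed

text \<open>A quadratic error is of smaller order than \<open>L2norm Y\<close>. Linear growth puts
  \<open>\<phi> (X \<omega>)\<close> into L2, which makes the candidate derivative a bounded
  functional by Cauchy-Schwarz. The expansion is asked on the unit ball only, because bounds
  \<open>c(\<mu>)\<close> are merely locally uniform.\<close>

lemma has_L_derivative_expansion:
  fixes h :: "'x::euclidean_space measure \<Rightarrow> real"
  assumes X: "X \<in> L2" and m: "\<phi> \<in> borel_measurable borel" and growth: "\<And>x. norm (\<phi> x) \<le> a + b * norm x"
    and ex: "\<And>Y. Y \<in> L2 \<Longrightarrow> L2norm Y < 1 \<Longrightarrow>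
      \<bar>h (Law (\<lambda>\<omega>. X \<omega> + Y \<omega>)) - h (Law X) - (\<integral>\<omega>. \<phi> (X \<omega>) \<bullet> Y \<omega> \<partial>\<Omega>)\<bar> \<le> C * (L2norm Y)\<^sup>2"
  shows "has_L_derivative h (Law X) \<phi>"
proof -
  note [measurable] = L2_measurable[OF X] m
  have \<phi>X: "(\<lambda>\<omega>. \<phi> (X \<omega>)) \<in> L2" by (rule linear_growth_square_integrable[OF X m growth])
  have bd: "\<bar>\<phi> (X \<omega>) \<bullet> Y \<omega>\<bar> \<le> norm (\<phi> (X \<omega>)) * norm (Y \<omega>)" for Y \<omega> by (rule Cauchy_Schwarz_ineq2)
  have int: "integrable \<Omega> (\<lambda>\<omega>. \<phi> (X \<omega>) \<bullet> Y \<omega>)" if Y: "Y \<in> L2" for Y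
    by (rule Bochner_Integration.integrable_bound[OF L2_mult_integrable[OF \<phi>X Y]])
       (use L2_measurable[OF Y] bd in auto)
  have "lift_has_derivative h X (\<lambda>Y. \<integral>\<omega>. \<phi> (X \<omega>) \<bullet> Y \<omega> \<partial>\<Omega>)"
    unfolding lift_has_derivative_def
  proof (intro conjI ballI allI impI)
    fix Y Z :: "real \<Rightarrow> 'x" and r s :: real assume YZ: "Y \<in> L2" "Z \<in> L2"
    show "(\<integral>\<omega>. \<phi> (X \<omega>) \<bullet> (r *\<^sub>R Y \<omega> + s *\<^sub>R Z \<omega>) \<partial>\<Omega>) = r * (\<integral>\<omega>. \<phi> (X \<omega>) \<bullet> Y \<omega> \<partial>\<Omega>) + s * (\<integral>\<omega>. \<phi> (X \<omega>) \<bullet> Z \<omega> \<partial>\<Omega>)"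
      using int[OF YZ(1)] int[OF YZ(2)] by (simp add: inner_add_right)
  next
    show "\<exists>C. \<forall>Y\<in>L2. \<bar>\<integral>\<omega>. \<phi> (X \<omega>) \<bullet> Y \<omega> \<partial>\<Omega>\<bar> \<le> C * L2norm Y"
    proof (intro exI ballI)
      fix Y :: "real \<Rightarrow> 'x" assume Y: "Y \<in> L2"
      have "\<bar>\<integral>\<omega>. \<phi> (X \<omega>) \<bullet> Y \<omega> \<partial>\<Omega>\<bar> \<le> (\<integral>\<omega>. norm (\<phi> (X \<omega>) \<bullet> Y \<omega>) \<partial>\<Omega>)"
        using integral_norm_bound[of \<Omega> "\<lambda>\<omega>. \<phi> (X \<omega>) \<bullet> Y \<omega>"] by simp
      also have "\<dots> \<le> (\<integral>\<omega>. norm (\<phi> (X \<omega>)) * norm (Y \<omega>) \<partial>\<Omega>)"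
        using integrable_norm[OF int[OF Y]] L2_mult_integrable[OF \<phi>X Y]
        by (rule Bochner_Integration.integral_mono) (use bd in simp)
      also have "\<dots> \<le> L2norm (\<lambda>\<omega>. \<phi> (X \<omega>)) * L2norm Y" by (rule L2_Cauchy_Schwarz[OF \<phi>X Y])
      finally show "\<bar>\<integral>\<omega>. \<phi> (X \<omega>) \<bullet> Y \<omega> \<partial>\<Omega>\<bar> \<le> L2norm (\<lambda>\<omega>. \<phi> (X \<omega>)) * L2norm Y" .
    qed
  next
    fix e :: real assume e: "0 < e"
    define d where "d = min 1 (e / (\<bar>C\<bar> + 1))"
    have d: "0 < d" "d \<le> 1" "\<bar>C\<bar> * d \<le> e"
    proof -
      have "\<bar>C\<bar> * d \<le> \<bar>C\<bar> * (e / (\<bar>C\<bar> + 1))" by (intro mult_left_mono) (auto simp: d_def)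
      also have "\<dots> \<le> e" using e by (simp add: field_simps)
      finally show "\<bar>C\<bar> * d \<le> e" .
    qed (use e in \<open>auto simp: d_def\<close>)
    show "\<exists>d>0. \<forall>Y\<in>L2. L2norm Y < d \<longrightarrow>
        \<bar>h (Law (\<lambda>\<omega>. X \<omega> + Y \<omega>)) - h (Law X) - (\<integral>\<omega>. \<phi> (X \<omega>) \<bullet> Y \<omega> \<partial>\<Omega>)\<bar> \<le> e * L2norm Y"
    proof (intro exI[of _ d] conjI ballI impI d(1))
      fix Y :: "real \<Rightarrow> 'x" assume Y: "Y \<in> L2" "L2norm Y < d"
      have "\<bar>h (Law (\<lambda>\<omega>. X \<omega> + Y \<omega>)) - h (Law X) - (\<integral>\<omega>. \<phi> (X \<omega>) \<bullet> Y \<omega> \<partial>\<Omega>)\<bar> \<le> C * (L2norm Y)\<^sup>2"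
        using ex[OF Y(1)] Y(2) d by simp
      also have "\<dots> \<le> \<bar>C\<bar> * (d * L2norm Y)"
        unfolding power2_eq_square using Y(2) L2norm_nonneg[of Y] by (intro mult_mono mult_right_mono) auto
      also have "\<dots> \<le> e * L2norm Y"
        using mult_right_mono[OF d(3) L2norm_nonneg[of Y]] by (simp add: mult.assoc)
      finally show "\<bar>h (Law (\<lambda>\<omega>. X \<omega> + Y \<omega>)) - h (Law X) - (\<integral>\<omega>. \<phi> (X \<omega>) \<bullet> Y \<omega> \<partial>\<Omega>)\<bar> \<le> e * L2norm Y" .
    qed
  qed
  then show ?thesis
    unfolding has_L_derivative_def using X m L2_square[OF \<phi>X] by (auto simp: integrable_Law L2_measurable)
qed

text \<open>The spatial derivative of the linear functional derivative is the L-derivative: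
  \<open>lfd2_expansion\<close> applied to X and X + Y supplies the quadratic error, and its
  derivative term becomes an inner product after applying \<open>l\<close>. The hypothesis
  \<open>real\<close> supplies the representing vector at every law.\<close>

lemma regular2_is_LD:
  fixes h :: "'x::euclidean_space measure \<Rightarrow> 'y::euclidean_space"
  assumes real: "\<forall>\<mu>\<in>(P2 :: 'x measure set). \<exists>X\<in>L2. Law X = \<mu>"
    and reg: "regular2 h D2"
  shows "\<exists>D1. has_lfd h D1 \<and> has_lfd2 h D1 D2 \<and> (\<forall>\<mu>\<in>P2. twice_differentiable (D1 \<mu>)) \<and>
     is_LD h (\<lambda>\<mu> x. Dif (D1 \<mu>) x)"
proof -
  from reg[unfolded regular2_def] obtain D1 c where
    D: "has_lfd h D1" "has_lfd2 h D1 D2" and tw: "\<forall>\<mu>\<in>P2. twice_differentiable (D1 \<mu>)"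
    and d2: "\<forall>\<mu>\<in>P2. \<forall>x x'. (\<lambda>w. D2 \<mu> x w) differentiable (at x') \<and>
           (\<lambda>u. Dif (\<lambda>w. D2 \<mu> u w) x') differentiable (at x)"
    and H: "jcont UNIV (\<lambda>\<mu> x. Dif (Dif (D1 \<mu>)) x)"
    and c: "bounded_on_bounded c" and c1: "\<forall>\<mu>\<in>P2. \<forall>x. norm (Dif (Dif (D1 \<mu>)) x) \<le> c \<mu>"
    and c2: "\<forall>\<mu>\<in>P2. \<forall>x x'. norm (dd (D2 \<mu>) x x') \<le> c \<mu>"
    by (elim exE conjE)
  have "is_LD h (\<lambda>\<mu> x. Dif (D1 \<mu>) x)"
    unfolding is_LD_def
  proof (intro conjI ballI allI)
    show "jcont UNIV (\<lambda>\<mu> x. Dif (D1 \<mu>) x)"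
      by (rule jcont_Dif[OF D(1)[unfolded has_lfd_def, THEN conjunct1] tw[rule_format] H])
    fix \<mu> :: "'x measure" and l :: "'y \<Rightarrow>\<^sub>L real" assume \<mu>: "\<mu> \<in> P2"
    from bspec[OF real \<mu>] obtain X where X: "X \<in> L2" and lX: "Law X = \<mu>" by blast
    let ?D = "Dif (D1 \<mu>)"
    define \<phi> where "\<phi> x = riesz (\<lambda>u. blinfun_apply l (blinfun_apply (?D x) u))" for x
    have twm: "twice_differentiable (D1 \<mu>)" using tw \<mu> by blast
    have cD: "continuous_on UNIV ?D"
      using twm unfolding twice_differentiable_def
      by (auto intro!: continuous_at_imp_continuous_on differentiable_imp_continuous_within)
    have m: "\<phi> \<in> borel_measurable borel"
      unfolding \<phi>_def riesz_def
      by (intro borel_measurable_continuous_onI continuous_on_sum continuous_on_scaleR continuous_on_const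
          bounded_linear.continuous_on[OF blinfun.bounded_linear_right] bounded_linear.continuous_on[OF blinfun.bounded_linear_left] cD)
    have growth: "norm (\<phi> x) \<le> norm l * norm (?D 0) + norm l * c \<mu> * norm x" for x
    proof -
      have "norm (?D x - ?D 0) \<le> c \<mu> * norm (x - 0)"
        by (rule Dif_lipschitz) (use twm c1 \<mu> in \<open>auto simp: twice_differentiable_def\<close>)
      then have "norm (?D x) \<le> norm (?D 0) + c \<mu> * norm x" using norm_triangle_sub[of "?D x" "?D 0"] by simp
      then have "norm l * norm (?D x) \<le> norm l * (norm (?D 0) + c \<mu> * norm x)" by (intro mult_left_mono) auto
      then show ?thesis using norm_riesz_le[of l "?D x"] by (simp add: \<phi>_def algebra_simps)
    qed
    \<comment> \<open>Second moments of mixtures of the laws of X and X + Y, with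
      \<open>L2norm Y < 1\<close>, are at most (2 |X|^2 + 2) + |X|^2, where |X| is the L2 norm; this
      bounds their distance to \<open>dirac0\<close>.\<close>
    define R where "R = sqrt (3 * (L2norm X)\<^sup>2 + 2)"
    from c obtain B where B: "\<And>\<nu>. \<nu> \<in> P2 \<Longrightarrow> W2 \<nu> dirac0 \<le> R \<Longrightarrow> \<bar>c \<nu>\<bar> \<le> B"
      unfolding bounded_on_bounded_def by blast
    have "has_L_derivative (\<lambda>\<nu>. blinfun_apply l (h \<nu>)) (Law X) \<phi>"
    proof (rule has_L_derivative_expansion[OF X m growth])
      fix Y :: "real \<Rightarrow> 'x" assume Y: "Y \<in> L2" "L2norm Y < 1"
      let ?X' = "\<lambda>\<omega>. X \<omega> + Y \<omega>"
      have X': "?X' \<in> L2" by (rule L2_add[OF X Y(1)])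
      have sq: "(\<integral>x. (norm x)\<^sup>2 \<partial>Law Z) = (L2norm Z)\<^sup>2" if "Z \<in> L2" for Z :: "real \<Rightarrow> 'x"
        using that by (simp add: integral_Law L2_measurable L2norm_sq)
      have X'le: "(L2norm ?X')\<^sup>2 \<le> 2 * (L2norm X)\<^sup>2 + 2"
      proof -
        have "(L2norm ?X')\<^sup>2 \<le> (\<integral>\<omega>. 2 * (norm (X \<omega>))\<^sup>2 + 2 * (norm (Y \<omega>))\<^sup>2 \<partial>\<Omega>)"
          unfolding L2norm_sq using L2_square[OF X'] L2_square[OF X] L2_square[OF Y(1)] norm_add_square_le
          by (intro Bochner_Integration.integral_mono) auto
        also have "\<dots> = 2 * (L2norm X)\<^sup>2 + 2 * (L2norm Y)\<^sup>2"
          using L2_square[OF X] L2_square[OF Y(1)] by (simp add: L2norm_sq)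
        also have "(L2norm Y)\<^sup>2 \<le> 1" using Y(2) L2norm_nonneg[of Y] by (intro power_le_one) auto
        finally show ?thesis by simp
      qed
      have bnd: "c (mix s (Law ?X') (Law X)) \<le> B" if s: "0 \<le> s" "s \<le> 1" for s
      proof -
        note mp = mix_P2[OF Law_P2[OF X'] Law_P2[OF X] s]
        have "s * (L2norm ?X')\<^sup>2 + (1 - s) * (L2norm X)\<^sup>2 \<le> 1 * (2 * (L2norm X)\<^sup>2 + 2) + 1 * (L2norm X)\<^sup>2"
          using s X'le by (intro add_mono mult_mono) auto
        then have "W2 (mix s (Law ?X') (Law X)) dirac0 \<le> R"
          unfolding R_def using W2_dirac0_le[OF mp(1)] mp(2) sq[OF X] sq[OF X']
          by (intro order_trans[OF W2_dirac0_le[OF mp(1)]] real_sqrt_le_mono) simp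
        from B[OF mp(1) this] show ?thesis by simp
      qed
      have bX: "c (Law X) \<le> B"
      proof -
        have "W2 (Law X) dirac0 \<le> R" unfolding R_def
          by (rule order_trans[OF W2_dirac0_le[OF Law_P2[OF X]]], rule real_sqrt_le_mono) (simp add: sq[OF X])
        from B[OF Law_P2[OF X] this] show ?thesis by simp
      qed
      have P: "Law X \<in> P2" by (rule Law_P2[OF X])
      have b1: "norm (Dif (Dif (D1 (Law X))) x) \<le> B" for x
        using c1[rule_format, OF P, of x] bX by linarith
      have b2: "norm (dd (D2 (mix s (Law ?X') (Law X))) x x') \<le> B" if "0 \<le> s" "s \<le> 1" for s x x'
        using c2[rule_format, OF mix_P2(1)[OF Law_P2[OF X'] P that], of x x'] bnd[OF that] by linarith
      note e = lfd2_expansion[OF D X X' tw[rule_format, OF P] b1 d2[rule_format] b2]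
      let ?E = "\<integral>\<omega>. blinfun_apply (?D (X \<omega>)) (Y \<omega>) \<partial>\<Omega>"
      have i: "integrable \<Omega> (\<lambda>\<omega>. blinfun_apply (?D (X \<omega>)) (Y \<omega>))" using e(1) by (simp add: lX)
      have "(\<integral>\<omega>. \<phi> (X \<omega>) \<bullet> Y \<omega> \<partial>\<Omega>) = (\<integral>\<omega>. blinfun_apply l (blinfun_apply (?D (X \<omega>)) (Y \<omega>)) \<partial>\<Omega>)"
        unfolding \<phi>_def riesz_inner[OF linear_blinfun2] ..
      also have "\<dots> = blinfun_apply l ?E" by (rule integral_bounded_linear[OF blinfun.bounded_linear_right i])
      finally have "blinfun_apply l (h (Law ?X')) - blinfun_apply l (h (Law X)) - (\<integral>\<omega>. \<phi> (X \<omega>) \<bullet> Y \<omega> \<partial>\<Omega>)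
          = blinfun_apply l (h (Law ?X') - h (Law X) - ?E)" by (simp add: blinfun.diff_right)
      then have "\<bar>blinfun_apply l (h (Law ?X')) - blinfun_apply l (h (Law X)) - (\<integral>\<omega>. \<phi> (X \<omega>) \<bullet> Y \<omega> \<partial>\<Omega>)\<bar>
          \<le> norm l * norm (h (Law ?X') - h (Law X) - ?E)"
        using norm_blinfun[of l "h (Law ?X') - h (Law X) - ?E"] by simp
      also have "\<dots> \<le> norm l * (2 * B * (L2norm Y)\<^sup>2)" using e(2) by (intro mult_left_mono) (simp_all add: lX)
      finally show "\<bar>blinfun_apply l (h (Law ?X')) - blinfun_apply l (h (Law X)) - (\<integral>\<omega>. \<phi> (X \<omega>) \<bullet> Y \<omega> \<partial>\<Omega>)\<bar>
          \<le> norm l * 2 * B * (L2norm Y)\<^sup>2" by (simp add: mult.assoc)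
    qed
    then show "has_L_derivative (\<lambda>\<nu>. blinfun_apply l (h \<nu>)) \<mu>
        (\<lambda>x. riesz (\<lambda>u. blinfun_apply l (blinfun_apply (?D x) u)))"
      unfolding \<phi>_def lX .
  qed
  then show ?thesis using D tw by blast
qed

section \<open>Uniqueness of jointly continuous L-derivatives\<close>

text \<open>The perturbation is a function of the value of \<open>X\<close>, so the perturbed law is
  determined by \<open>Law X\<close>. Two L-derivatives attained at different vectors can thus be
  tested on the same curve of laws.\<close>

lemma Law_shift_atom:
  fixes X :: "real \<Rightarrow> 'x::euclidean_space"
  assumes X: "X \<in> borel_measurable \<Omega>"
  shows "Law (\<lambda>\<omega>. X \<omega> + r *\<^sub>R (indicat_real {y} (X \<omega>) *\<^sub>R \<xi>)) = distr (Law X) borel (\<lambda>z. z + r *\<^sub>R (indicat_real {y} z *\<^sub>R \<xi>))"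
proof -
  note [measurable] = X
  show ?thesis unfolding Law_def by (subst distr_distr) (auto simp: o_def)
qed

text \<open>Moving only the mass at \<open>y\<close> in the direction \<open>\<xi>\<close> has the
  derivative \<open>measure \<mu> {y} * (\<phi> y \<bullet> \<xi>)\<close>, which reads off
  \<open>\<phi> y\<close> when the mass is positive.\<close>

lemma has_L_derivative_atom_unique:
  fixes h :: "'x::euclidean_space measure \<Rightarrow> real"
  assumes "has_L_derivative h \<mu> \<phi>" "has_L_derivative h \<mu> \<psi>" and atom: "0 < measure \<mu> {y}"
  shows "\<phi> y = \<psi> y"
proof -
  have key: "((\<lambda>r. h (distr \<mu> borel (\<lambda>z. z + r *\<^sub>R (indicat_real {y} z *\<^sub>R \<xi>)))) has_real_derivative measure \<mu> {y} * (\<phi> y \<bullet> \<xi>)) (at 0)"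
    if "has_L_derivative h \<mu> \<phi>" for \<phi> \<xi>
  proof -
    from that obtain X where X: "X \<in> L2" "Law X = \<mu>" and lift: "lift_has_derivative h X (\<lambda>Y. \<integral>\<omega>. \<phi> (X \<omega>) \<bullet> Y \<omega> \<partial>\<Omega>)"
      unfolding has_L_derivative_def by blast
    note [measurable] = L2_measurable[OF X(1)]
    let ?Y = "\<lambda>\<omega>. indicat_real {y} (X \<omega>) *\<^sub>R \<xi>"
    have Y: "?Y \<in> L2"
    proof (rule L2_I)
      show "integrable \<Omega> (\<lambda>\<omega>. (norm (?Y \<omega>))\<^sup>2)"
        by (rule \<Omega>.integrable_const_bound[of _ "(norm \<xi>)\<^sup>2"]) (auto simp: indicator_def)
    qed measurable
    have "(\<integral>\<omega>. \<phi> (X \<omega>) \<bullet> ?Y \<omega> \<partial>\<Omega>) = (\<integral>\<omega>. indicat_real (X -` {y}) \<omega> * (\<phi> y \<bullet> \<xi>) \<partial>\<Omega>)"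
      by (rule Bochner_Integration.integral_cong) (auto simp: indicator_def)
    also have "\<dots> = measure \<Omega> (X -` {y}) * (\<phi> y \<bullet> \<xi>)"
      using measurable_sets[OF L2_measurable[OF X(1)], of "{y}"] by simp
    also have "measure \<Omega> (X -` {y}) = measure \<mu> {y}"
      unfolding X(2)[symmetric] Law_def by (subst measure_distr) auto
    finally show ?thesis
      using lift_derivative_line[OF lift Y] unfolding Law_shift_atom[OF L2_measurable[OF X(1)]] X(2) by simp
  qed
  have "\<phi> y \<bullet> \<xi> = \<psi> y \<bullet> \<xi>" for \<xi>
    using DERIV_unique[OF key[OF assms(1)] key[OF assms(2)]] atom by simp
  then show ?thesis by (metis inner_commute vector_eq_rdot)
qed

lemma return_P2: "return borel y \<in> P2"
  using Law_P2[OF L2_const[of y]] \<Omega>.distr_const[of y borel] by (simp add: Law_def)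

text \<open>Mixing in a small atom at \<open>y\<close> makes the value at \<open>y\<close> of an L-derivative visible.\<close>

lemma mix_return_tendsto:
  fixes \<mu> :: "'x::euclidean_space measure" and y :: 'x
  assumes \<mu>: "\<mu> \<in> P2"
  defines "m \<equiv> \<lambda>k. mix (1 - 1 / real (Suc k)) \<mu> (return borel y)"
  shows "m k \<in> P2" "0 < measure (m k) {y}" "(\<lambda>k. W2 \<mu> (m k)) \<longlonglongrightarrow> 0"
proof -
  note [measurable_cong] = P2_D(1)[OF \<mu>]
  interpret \<mu>: prob_space \<mu> by (rule P2_D(2)[OF \<mu>])
  have th: "0 \<le> 1 - 1 / real (Suc k)" "1 - 1 / real (Suc k) \<le> 1" for k by auto
  show mP: "m k \<in> P2" for k unfolding m_def by (rule mix_P2(1)[OF \<mu> return_P2 th])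
  have "emeasure (m k) {y} \<noteq> 0"
    unfolding m_def by (subst emeasure_mix) (auto simp: P2_D(1)[OF \<mu>])
  then show "0 < measure (m k) {y}"
    using prob_space.finite_measure[OF P2_D(2)[OF mP]]
    by (metis finite_measure.emeasure_eq_measure ennreal_0 zero_less_measure_iff)
  define C where "C = (\<integral>x. (norm (x - y))\<^sup>2 \<partial>\<mu>)"
  have C0: "0 \<le> C" unfolding C_def by simp
  have ic: "integrable \<mu> (\<lambda>x. (norm (x - y))\<^sup>2)"
  proof (rule Bochner_Integration.integrable_bound)
    show "integrable \<mu> (\<lambda>x. 2 * (norm x)\<^sup>2 + 2 * (norm (- y))\<^sup>2)" using P2_D(3)[OF \<mu>] by simp
    show "AE x in \<mu>. norm ((norm (x - y))\<^sup>2) \<le> norm (2 * (norm x)\<^sup>2 + 2 * (norm (- y))\<^sup>2)"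
      using norm_add_square_le[of _ "- y"] by (intro AE_I2) auto
  qed measurable
  have W: "W2 \<mu> (m k) \<le> sqrt (1 / real (Suc k) * C)" for k
  proof -
    let ?t = "1 - 1 / real (Suc k)"
    have [measurable]: "(\<lambda>x::'x. (x, x)) \<in> borel_measurable borel" "(\<lambda>x::'x. (x, y)) \<in> borel_measurable borel"
      by (rule borel_measurable_Pair; measurable)+
    let ?A = "distr \<mu> borel (\<lambda>x. (x, x))" and ?B = "distr \<mu> borel (\<lambda>x. (x, y))"
    \<comment> \<open>Mass 1 - 1/(k+1) stays in place and the rest is sent to \<open>y\<close>: the
      mixture of the diagonal coupling and of the coupling with the point mass, at cost
      \<open>C / (k+1)\<close>.\<close>
    let ?\<pi> = "mix ?t ?A ?B"
    have dm: "distr ?\<pi> borel p = mix ?t (distr ?A borel p) (distr ?B borel p)" if [measurable]: "p \<in> borel_measurable borel"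
      for p :: "'x \<times> 'x \<Rightarrow> 'x"
    proof (rule measure_eqI)
      fix S assume "S \<in> sets (distr ?\<pi> borel p)"
      then have [measurable]: "S \<in> sets borel" by simp
      have "p -` S \<in> sets borel" using measurable_sets[OF that, of S] by simp
      then show "emeasure (distr ?\<pi> borel p) S = emeasure (mix ?t (distr ?A borel p) (distr ?B borel p)) S"
        by (simp add: emeasure_distr emeasure_mix)
    qed simp
    have i: "distr \<mu> borel (\<lambda>x. x) = \<mu>" by (rule distr_id2) (simp add: P2_D(1)[OF \<mu>])
    have "mix ?t \<mu> \<mu> = \<mu>"
    proof (rule measure_eqI)
      fix S assume S: "S \<in> sets (mix ?t \<mu> \<mu>)"
      have "ennreal ?t * emeasure \<mu> S + ennreal (1 - ?t) * emeasure \<mu> S = (ennreal ?t + ennreal (1 - ?t)) * emeasure \<mu> S"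
        by (simp add: distrib_right)
      also have "ennreal ?t + ennreal (1 - ?t) = 1" using th[of k] by (subst ennreal_plus[symmetric]) auto
      finally show "emeasure (mix ?t \<mu> \<mu>) S = emeasure \<mu> S" using S by (simp add: emeasure_mix P2_D(1)[OF \<mu>])
    qed (simp add: P2_D(1)[OF \<mu>])
    then have "distr ?\<pi> borel fst = \<mu>" by (subst dm) (auto simp: distr_distr o_def i)
    moreover have "distr ?\<pi> borel snd = m k"
      unfolding m_def by (subst dm) (auto simp: distr_distr o_def i \<mu>.distr_const)
    ultimately have "?\<pi> \<in> couplings \<mu> (m k)" unfolding couplings_def by simp
    from W2_le[OF this] have "W2 \<mu> (m k) \<le> sqrt (\<integral>z. (norm (fst z - snd z))\<^sup>2 \<partial>?\<pi>)" .
    also have "(\<integral>z. (norm (fst z - snd z))\<^sup>2 \<partial>?\<pi>) = 1 / real (Suc k) * C"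
    proof (rule integral_eq_nn_integral[THEN trans])
      have "(\<integral>\<^sup>+z. ennreal ((norm (fst z - snd z))\<^sup>2) \<partial>?\<pi>) = ennreal (1 - ?t) * (\<integral>\<^sup>+x. ennreal ((norm (x - y))\<^sup>2) \<partial>\<mu>)"
        by (subst nn_integral_mix) (auto simp: nn_integral_distr)
      also have "(\<integral>\<^sup>+x. ennreal ((norm (x - y))\<^sup>2) \<partial>\<mu>) = ennreal C"
        unfolding C_def by (rule nn_integral_eq_integral[OF ic]) simp
      finally show "enn2real (\<integral>\<^sup>+z. ennreal ((norm (fst z - snd z))\<^sup>2) \<partial>?\<pi>) = 1 / real (Suc k) * C"
        using C0 by (simp add: ennreal_mult[symmetric])
    qed (auto simp: measurable_cong_sets[OF sets_mix refl])
    finally show ?thesis by simp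
  qed
  have "(\<lambda>k. sqrt (1 / real (Suc k) * C)) \<longlonglongrightarrow> sqrt (0 * C)"
    using LIMSEQ_inverse_real_of_nat by (intro tendsto_real_sqrt tendsto_mult tendsto_const) (simp add: inverse_eq_divide)
  then have lim: "(\<lambda>k. sqrt (1 / real (Suc k) * C)) \<longlonglongrightarrow> 0" by simp
  have "norm (W2 \<mu> (m k)) \<le> sqrt (1 / real (Suc k) * C)" for k
    unfolding real_norm_def abs_of_nonneg[OF W2_nonneg] by (rule W)
  then show "(\<lambda>k. W2 \<mu> (m k)) \<longlonglongrightarrow> 0"
    by (rule Lim_null_comparison[OF always_eventually[OF allI] lim])
qed

text \<open>Two versions agree at \<open>y\<close> for the laws \<open>?m k\<close>, which have an
  atom there; joint continuity carries the equality to the limit \<open>\<mu>\<close>.\<close>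

lemma is_LD_unique:
  fixes F :: "'x::euclidean_space measure \<Rightarrow> 'y::euclidean_space"
  assumes \<Phi>: "is_LD F \<Phi>" and \<Psi>: "is_LD F \<Psi>" and \<mu>: "\<mu> \<in> P2"
  shows "\<Phi> \<mu> y = \<Psi> \<mu> y"
proof -
  let ?m = "\<lambda>k. mix (1 - 1 / real (Suc k)) \<mu> (return borel y)"
  note m = mix_return_tendsto[OF \<mu>, where y=y]
  have eq: "\<Phi> (?m k) y = \<Psi> (?m k) y" for k
  proof (rule blinfun_eqI)
    fix u
    have "blinfun_apply (\<Phi> (?m k) y) u \<bullet> w = blinfun_apply (\<Psi> (?m k) y) u \<bullet> w" for w
    proof -
      let ?l = "blinfun_inner_left w"
      have "riesz (\<lambda>u. blinfun_apply ?l (blinfun_apply (\<Phi> (?m k) y) u)) = riesz (\<lambda>u. blinfun_apply ?l (blinfun_apply (\<Psi> (?m k) y) u))"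
        by (rule has_L_derivative_atom_unique[OF _ _ m(2)[of k], where h="\<lambda>\<nu>. blinfun_apply ?l (F \<nu>)"
              and \<phi>="\<lambda>x. riesz (\<lambda>u. blinfun_apply ?l (blinfun_apply (\<Phi> (?m k) x) u))"
              and \<psi>="\<lambda>x. riesz (\<lambda>u. blinfun_apply ?l (blinfun_apply (\<Psi> (?m k) x) u))"])
           (use \<Phi> \<Psi> m(1)[of k] in \<open>simp_all only: is_LD_def\<close>)
      from arg_cong[OF this, of "\<lambda>r. r \<bullet> u"] show ?thesis
        unfolding riesz_inner[OF linear_blinfun2] by (simp add: inner_commute)
    qed
    then show "blinfun_apply (\<Phi> (?m k) y) u = blinfun_apply (\<Psi> (?m k) y) u"
      by (metis inner_commute vector_eq_rdot)
  qed
  note lim = jcontD[OF _ \<mu> UNIV_I m(1) UNIV_I m(3) tendsto_const]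
  have "(\<lambda>k. \<Phi> (?m k) y) \<longlonglongrightarrow> \<Phi> \<mu> y" "(\<lambda>k. \<Psi> (?m k) y) \<longlonglongrightarrow> \<Psi> \<mu> y"
    by (rule lim[OF \<Phi>[unfolded is_LD_def, THEN conjunct2]], rule lim[OF \<Psi>[unfolded is_LD_def, THEN conjunct2]])
  then show ?thesis unfolding eq by (rule LIMSEQ_unique)
qed

lemma LD_is_LD:
  fixes h :: "'x::euclidean_space measure \<Rightarrow> 'y::euclidean_space"
  assumes "\<forall>\<mu>\<in>(P2 :: 'x measure set). \<exists>X\<in>L2. Law X = \<mu>" "regular2 h D2"
  shows "is_LD h (LD h)"
proof -
  from regular2_is_LD[OF assms] have "\<exists>\<Phi>. is_LD h \<Phi>" by blast
  then show ?thesis unfolding LD_def by (rule someI_ex)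
qed

text \<open>The bounds in the assumptions on the data concern \<open>LD h\<close>, whereas
  regularity provides a first-order derivative \<open>D1\<close> under an existential quantifier.
  Uniqueness identifies \<open>LD h \<mu>\<close> with \<open>Dif (D1 \<mu>)\<close>.\<close>

lemma LD_expansion:
  fixes h :: "'x::euclidean_space measure \<Rightarrow> 'y::euclidean_space"
  assumes real: "\<forall>\<mu>\<in>(P2 :: 'x measure set). \<exists>X\<in>L2. Law X = \<mu>" and reg: "regular2 h D2"
    and c1: "\<And>\<mu> x. \<mu> \<in> P2 \<Longrightarrow> norm (Dif (LD h \<mu>) x) \<le> c"
    and c2: "\<And>\<mu> x x'. \<mu> \<in> P2 \<Longrightarrow> norm (dd (D2 \<mu>) x x') \<le> c"
    and X: "X \<in> L2" "X' \<in> L2"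
  shows "norm (h (Law X') - h (Law X) - (\<integral>\<omega>. blinfun_apply (LD h (Law X) (X \<omega>)) (X' \<omega> - X \<omega>) \<partial>\<Omega>))
      \<le> 2 * c * (L2norm (\<lambda>\<omega>. X' \<omega> - X \<omega>))\<^sup>2"
proof -
  from regular2_is_LD[OF real reg] obtain D1 where D: "has_lfd h D1" "has_lfd2 h D1 D2"
    and tw: "\<forall>\<mu>\<in>P2. twice_differentiable (D1 \<mu>)" and LD1: "is_LD h (\<lambda>\<mu> x. Dif (D1 \<mu>) x)"
    by (elim exE conjE)
  have eq: "LD h \<mu> = Dif (D1 \<mu>)" if "\<mu> \<in> P2" for \<mu>
    using is_LD_unique[OF LD_is_LD[OF real reg] LD1 that] by (rule ext)
  have P: "Law X \<in> P2" by (rule Law_P2[OF X(1)])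
  have d2: "(\<lambda>w. D2 \<mu> x w) differentiable (at x') \<and> (\<lambda>u. Dif (\<lambda>w. D2 \<mu> u w) x') differentiable (at x)"
    if "\<mu> \<in> P2" for \<mu> x x'
    using reg[unfolded regular2_def] that by (elim exE conjE) (elim ballE[where x=\<mu>] allE[where x=x] allE[where x=x'], auto)
  have b1: "norm (Dif (Dif (D1 (Law X))) x) \<le> c" for x
    using c1[OF P, of x] unfolding eq[OF P] .
  have b2: "norm (dd (D2 (mix s (Law X') (Law X))) x x') \<le> c" if "0 \<le> s" "s \<le> 1" for s x x'
    by (rule c2[OF mix_P2(1)[OF Law_P2[OF X(2)] P that]])
  show ?thesis
    using lfd2_expansion(2)[OF D X tw[rule_format, OF P] b1 d2 b2] unfolding eq[OF P] .
qed

section \<open>Growth of the data\<close>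

lemma Dif_partial_fst:
  assumes "\<phi> differentiable (at (x, a))"
  shows "(\<lambda>u. \<phi> (u, a)) differentiable (at x)"
    and "Dif (\<lambda>u. \<phi> (u, a)) x = Dif \<phi> (x, a) o\<^sub>L Blinfun (\<lambda>u. (u, 0))"
proof -
  have bl: "bounded_linear (\<lambda>u::'a. (u, 0::'b))" by (intro bounded_linear_Pair bounded_linear_ident bounded_linear_zero)
  have "((\<lambda>u. (u, a)) has_derivative (\<lambda>u. (u, 0))) (at x)"
    by (intro has_derivative_Pair has_derivative_ident has_derivative_const)
  from has_derivative_compose[OF this has_derivative_Dif[OF assms]]
  have "((\<lambda>u. \<phi> (u, a)) has_derivative blinfun_apply (Dif \<phi> (x, a) o\<^sub>L Blinfun (\<lambda>u. (u, 0)))) (at x)"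
    by (simp add: blinfun_compose.rep_eq o_def bounded_linear_Blinfun_apply[OF bl])
  then show "(\<lambda>u. \<phi> (u, a)) differentiable (at x)"
    "Dif (\<lambda>u. \<phi> (u, a)) x = Dif \<phi> (x, a) o\<^sub>L Blinfun (\<lambda>u. (u, 0))"
    by (auto simp: differentiable_def intro: Dif_eqI)
qed

lemma Dif_partial_snd:
  assumes "\<phi> differentiable (at (x, a))"
  shows "(\<lambda>b. \<phi> (x, b)) differentiable (at a)"
    and "Dif (\<lambda>b. \<phi> (x, b)) a = Dif \<phi> (x, a) o\<^sub>L Blinfun (\<lambda>b. (0, b))"
proof -
  have bl: "bounded_linear (\<lambda>u::'b. (0::'a, u))" by (intro bounded_linear_Pair bounded_linear_ident bounded_linear_zero)
  have "((\<lambda>u. (x, u)) has_derivative (\<lambda>u. (0, u))) (at a)"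
    by (intro has_derivative_Pair has_derivative_ident has_derivative_const)
  from has_derivative_compose[OF this has_derivative_Dif[OF assms]]
  have "((\<lambda>u. \<phi> (x, u)) has_derivative blinfun_apply (Dif \<phi> (x, a) o\<^sub>L Blinfun (\<lambda>u. (0, u)))) (at a)"
    by (simp add: blinfun_compose.rep_eq o_def bounded_linear_Blinfun_apply[OF bl])
  then show "(\<lambda>b. \<phi> (x, b)) differentiable (at a)"
    "Dif (\<lambda>b. \<phi> (x, b)) a = Dif \<phi> (x, a) o\<^sub>L Blinfun (\<lambda>b. (0, b))"
    by (auto simp: differentiable_def intro: Dif_eqI)
qed

lemma differentiable_blinfun_compose_left:
  assumes "(\<Phi> :: 'a::real_normed_vector \<Rightarrow> 'b::real_normed_vector \<Rightarrow>\<^sub>L 'c::real_normed_vector) differentiable (at x)"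
  shows "(\<lambda>u. \<Phi> u o\<^sub>L B) differentiable (at x)"
  using assms bounded_linear.has_derivative[OF bounded_bilinear.bounded_linear_left[OF bounded_bilinear_blinfun_compose]]
  unfolding differentiable_def by blast

lemma twice_differentiable_partial:
  fixes G :: "'x::real_normed_vector \<Rightarrow> 'a::real_normed_vector \<Rightarrow> 'y::real_normed_vector"
  assumes "twice_differentiable (\<lambda>(x, a). G x a)"
  shows "(\<lambda>u. G u a) differentiable (at x)" "(\<lambda>b. G x b) differentiable (at a)"
    "(\<lambda>u. Dif (\<lambda>v. G v a) u) differentiable (at x)" "(\<lambda>b. Dif (G x) b) differentiable (at a)"
    "(\<lambda>u. Dif (G u) a) differentiable (at x)"
proof -
  let ?G = "\<lambda>(x, a). G x a"
  have d: "?G differentiable (at z)" "Dif ?G differentiable (at z)" for z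
    using assms[unfolded twice_differentiable_def] by blast+
  note p = Dif_partial_fst[OF d(1), simplified] Dif_partial_snd[OF d(1), simplified]
  note q = Dif_partial_fst(1)[OF d(2)] Dif_partial_snd(1)[OF d(2)]
  show "(\<lambda>u. G u a) differentiable (at x)" "(\<lambda>b. G x b) differentiable (at a)" by (rule p)+
  show "(\<lambda>u. Dif (\<lambda>v. G v a) u) differentiable (at x)"
    unfolding p(2) by (rule differentiable_blinfun_compose_left[OF q(1)])
  show "(\<lambda>b. Dif (G x) b) differentiable (at a)"
    unfolding p(4)[where x=x] by (rule differentiable_blinfun_compose_left[OF q(2)])
  show "(\<lambda>u. Dif (G u) a) differentiable (at x)"
    unfolding p(4) by (rule differentiable_blinfun_compose_left[OF q(1)])
qed

lemma Dif_diff: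
  assumes "\<phi> differentiable (at x)" "\<psi> differentiable (at x)"
  shows "(\<lambda>x. \<phi> x - \<psi> x) differentiable (at x)" "Dif (\<lambda>x. \<phi> x - \<psi> x) x = Dif \<phi> x - Dif \<psi> x"
  using assms has_derivative_blinfun_diff[OF has_derivative_diff[OF has_derivative_Dif[OF assms(1)] has_derivative_Dif[OF assms(2)]]]
  by (auto intro: differentiable_diff Dif_eqI)

lemma Dif_segment_bound:
  assumes d: "\<And>x. \<phi> differentiable (at x)" and b: "\<And>z. z \<in> closed_segment x y \<Longrightarrow> norm (Dif \<phi> z) \<le> B"
  shows "norm (\<phi> y - \<phi> x) \<le> B * norm (y - x)"
proof (rule differentiable_bound[where S="closed_segment x y" and f'="\<lambda>x. blinfun_apply (Dif \<phi> x)"])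
  show "onorm (blinfun_apply (Dif \<phi> z)) \<le> B" if "z \<in> closed_segment x y" for z
    using b[OF that] by (simp add: norm_blinfun.rep_eq)
  show "(\<phi> has_derivative blinfun_apply (Dif \<phi> z)) (at z within closed_segment x y)" for z
    by (rule has_derivative_at_withinI[OF has_derivative_Dif[OF d]])
qed auto

text \<open>On the ray through \<open>a\<close>, subtracting the parabola c/2 |a|^2 t^2 leaves a
  function with nonnegative second derivative and vanishing first derivative at 0, hence a
  nondecreasing one for t at least 0.\<close>

lemma strongly_convex_minimum:
  fixes \<phi> :: "'a::real_normed_vector \<Rightarrow> real"
  assumes d: "\<And>x. \<phi> differentiable (at x)" "\<And>x. Dif \<phi> differentiable (at x)"
    and zero: "Dif \<phi> 0 = 0"
    and conv: "\<And>x \<xi>. blinfun_apply (blinfun_apply (Dif (Dif \<phi>) x) \<xi>) \<xi> \<ge> c * (norm \<xi>)\<^sup>2"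
  shows "\<phi> a - \<phi> 0 \<ge> c / 2 * (norm a)\<^sup>2"
proof -
  define \<psi>' where "\<psi>' t = blinfun_apply (Dif \<phi> (t *\<^sub>R a)) a - c * (norm a)\<^sup>2 * t" for t
  have line: "((\<lambda>t. t *\<^sub>R a) has_derivative (\<lambda>s. s *\<^sub>R a)) (at t)" for t :: real
    by (intro has_derivative_scaleR_left has_derivative_ident)
  have d1: "((\<lambda>t. \<phi> (t *\<^sub>R a) - c / 2 * (norm a)\<^sup>2 * t\<^sup>2) has_real_derivative \<psi>' t) (at t)" for t
  proof -
    have "((\<lambda>t. \<phi> (t *\<^sub>R a)) has_derivative (\<lambda>s. blinfun_apply (Dif \<phi> (t *\<^sub>R a)) (s *\<^sub>R a))) (at t)"
      by (rule has_derivative_compose[OF line has_derivative_Dif[OF d(1)]])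
    then have "((\<lambda>t. \<phi> (t *\<^sub>R a)) has_real_derivative blinfun_apply (Dif \<phi> (t *\<^sub>R a)) a) (at t)"
      by (rule has_derivative_imp_has_field_derivative) (simp add: blinfun.scaleR_right)
    then show ?thesis unfolding \<psi>'_def
      by (auto intro!: derivative_eq_intros simp: power2_eq_square)
  qed
  have d2: "(\<psi>' has_real_derivative blinfun_apply (blinfun_apply (Dif (Dif \<phi>) (t *\<^sub>R a)) a) a - c * (norm a)\<^sup>2) (at t)" for t
  proof -
    have "((\<lambda>t. Dif \<phi> (t *\<^sub>R a)) has_derivative (\<lambda>s. blinfun_apply (Dif (Dif \<phi>) (t *\<^sub>R a)) (s *\<^sub>R a))) (at t)"
      by (rule has_derivative_compose[OF line has_derivative_Dif[OF d(2)]])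
    from bounded_linear.has_derivative[OF blinfun.bounded_linear_left this, of a]
    have "((\<lambda>t. blinfun_apply (Dif \<phi> (t *\<^sub>R a)) a) has_real_derivative blinfun_apply (blinfun_apply (Dif (Dif \<phi>) (t *\<^sub>R a)) a) a) (at t)"
      by (rule has_derivative_imp_has_field_derivative) (simp add: blinfun.scaleR_right blinfun.scaleR_left)
    then show ?thesis unfolding \<psi>'_def by (auto intro!: derivative_eq_intros)
  qed
  have nonneg: "\<psi>' t \<ge> 0" if "0 \<le> t" for t
  proof -
    have "\<psi>' 0 \<le> \<psi>' t"
      by (rule DERIV_nonneg_imp_nondecreasing[OF that]) (use d2 conv in \<open>force\<close>)
    then show ?thesis by (simp add: \<psi>'_def zero)
  qed
  have "\<phi> (0 *\<^sub>R a) - c / 2 * (norm a)\<^sup>2 * 0\<^sup>2 \<le> \<phi> (1 *\<^sub>R a) - c / 2 * (norm a)\<^sup>2 * 1\<^sup>2"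
    by (rule DERIV_nonneg_imp_nondecreasing[of 0 1]) (use d1 nonneg in force)+
  then show ?thesis by simp
qed

section \<open>Increments of functions of the law along configurations\<close>

context labelling begin

abbreviation conf :: "('i \<Rightarrow> 'x::euclidean_space) \<Rightarrow> 'x measure" where
  "conf x \<equiv> Law (\<lambda>\<omega>. x (\<iota> \<omega>))"

abbreviation sz :: "('i \<Rightarrow> 'x::euclidean_space) \<Rightarrow> real" where
  "sz x \<equiv> csize (range \<iota>) x"

lemma conf_P2: "conf x \<in> P2"
  by (rule Law_P2[OF simple_Omega_L2[OF simple]])

lemma conf_zero: "conf (\<lambda>_. 0) = dirac0"
  by (rule dirac0_Law[symmetric])

lemma sum_weight: "(\<Sum>i\<in>range \<iota>. weight i) = 1"
  using measure_simple_Omega[OF simple finite_labels order_refl, of "\<lambda>_. True"]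
  by (simp add: weight_def)

lemma norm_le_sz: "norm (x (\<iota> \<omega>)) \<le> sz x"
  by (rule norm_le_csize[OF finite_labels]) simp

lemma L2norm_conf_le: "L2norm (\<lambda>\<omega>. x (\<iota> \<omega>)) \<le> sz x"
proof -
  have "(\<integral>\<omega>. (norm (x (\<iota> \<omega>)))\<^sup>2 \<partial>\<Omega>) \<le> (\<integral>\<omega>. (sz x)\<^sup>2 \<partial>\<Omega>)"
    by (rule Bochner_Integration.integral_mono)
       (auto intro!: L2_square[OF simple_Omega_L2[OF simple]] power_mono norm_le_sz)
  then show ?thesis unfolding L2norm_def
    by (intro real_le_lsqrt) (auto simp: csize_nonneg)
qed

lemma W2_conf_le: "W2 (conf x) (conf y) \<le> sz (\<lambda>i. x i - y i)"
  by (rule order_trans[OF W2_Law_le L2norm_conf_le]) (intro simple_Omega_measurable simple)+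

lemma weighted_sum_le:
  assumes "\<And>i. i \<in> range \<iota> \<Longrightarrow> \<bar>t i\<bar> \<le> B"
  shows "\<bar>\<Sum>i\<in>range \<iota>. weight i * t i\<bar> \<le> B"
proof -
  have "\<bar>\<Sum>i\<in>range \<iota>. weight i * t i\<bar> \<le> (\<Sum>i\<in>range \<iota>. \<bar>weight i * t i\<bar>)" by (rule sum_abs)
  also have "\<dots> \<le> (\<Sum>i\<in>range \<iota>. weight i * B)"
    using assms weight_gt_0 by (intro sum_mono) (auto simp: abs_mult less_imp_le intro!: mult_left_mono)
  also have "\<dots> = B" by (simp add: sum_distrib_right[symmetric] sum_weight)
  finally show ?thesis .
qed

lemma is_LD_line:
  fixes h :: "'x::euclidean_space measure \<Rightarrow> 'y::real_normed_vector"
  assumes "is_LD h \<Phi>"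
  shows "((\<lambda>r. blinfun_apply l (h (conf (\<lambda>i. x i + r *\<^sub>R y i)))) has_real_derivative
     (\<Sum>i\<in>range \<iota>. weight i * blinfun_apply l (blinfun_apply (\<Phi> (conf x) (x i)) (y i)))) (at 0)"
proof -
  have "has_L_derivative (\<lambda>\<nu>. blinfun_apply l (h \<nu>)) (conf x) (\<lambda>z. riesz (\<lambda>u. blinfun_apply l (blinfun_apply (\<Phi> (conf x) z) u)))"
    using assms[unfolded is_LD_def, THEN conjunct1, rule_format, OF conf_P2] .
  from L_derivative_line[OF this, of y] show ?thesis
    unfolding riesz_inner[OF linear_blinfun2] .
qed

lemma config_mean_value:
  fixes x y :: "'i \<Rightarrow> 'x::euclidean_space"
  assumes D: "\<And>z. ((\<lambda>r. H (\<lambda>i. z i + r *\<^sub>R (y i - x i))) has_real_derivative D z) (at 0)"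
    and B: "\<And>z. \<bar>D z\<bar> \<le> B"
  shows "\<bar>H y - H x\<bar> \<le> B"
proof -
  let ?z = "\<lambda>r i. x i + r *\<^sub>R (y i - x i)"
  have "\<bar>H (?z 1) - H (?z 0) - (1 - 0) * 0\<bar> \<le> B * (1 - 0)"
  proof (rule mean_value_bound[where \<phi>="\<lambda>r. H (?z r)" and \<phi>'="\<lambda>r. D (?z r)"])
    show "((\<lambda>r. H (?z r)) has_real_derivative D (?z r)) (at r within {0..1})" for r
      by (rule has_field_derivative_at_within[OF config_line_derivative[where u=H, OF D]])
  qed (simp_all add: B)
  then show ?thesis by simp
qed

text \<open>A bound for second differences: with \<open>h1\<close> and \<open>h2\<close> the
  function \<open>g\<close> at two states or two actions, \<open>c\<close> is proportional to their
  distance, and the result is a product of two increments.\<close>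

lemma is_LD_diff_bound:
  fixes h1 h2 :: "'x::euclidean_space measure \<Rightarrow> real"
  assumes h: "is_LD h1 \<Phi>1" "is_LD h2 \<Phi>2"
    and c: "\<And>\<mu> z. \<mu> \<in> P2 \<Longrightarrow> norm (\<Phi>1 \<mu> z - \<Phi>2 \<mu> z) \<le> c"
  shows "\<bar>(h1 (conf y) - h2 (conf y)) - (h1 (conf x) - h2 (conf x))\<bar> \<le> c * sz (\<lambda>i. y i - x i)"
proof (rule config_mean_value[where H="\<lambda>x. h1 (conf x) - h2 (conf x)"])
  let ?w = "\<lambda>i. y i - x i"
  let ?D = "\<lambda>z. \<Sum>i\<in>range \<iota>. weight i * (blinfun_apply (\<Phi>1 (conf z) (z i)) (?w i) - blinfun_apply (\<Phi>2 (conf z) (z i)) (?w i))"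
  fix z :: "'i \<Rightarrow> 'x"
  show "((\<lambda>r. h1 (conf (\<lambda>i. z i + r *\<^sub>R ?w i)) - h2 (conf (\<lambda>i. z i + r *\<^sub>R ?w i))) has_real_derivative ?D z) (at 0)"
    using DERIV_diff[OF is_LD_line[OF h(1), of id_blinfun z ?w] is_LD_line[OF h(2), of id_blinfun z ?w]]
    by (simp add: sum_subtractf[symmetric] algebra_simps)
  have c0: "0 \<le> c" using order_trans[OF norm_ge_zero c[OF return_P2]] .
  show "\<bar>?D z\<bar> \<le> c * sz ?w"
  proof (rule weighted_sum_le)
    fix i assume i: "i \<in> range \<iota>"
    have "\<bar>blinfun_apply (\<Phi>1 (conf z) (z i) - \<Phi>2 (conf z) (z i)) (?w i)\<bar>
       \<le> norm (\<Phi>1 (conf z) (z i) - \<Phi>2 (conf z) (z i)) * norm (?w i)"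
      unfolding real_norm_def[symmetric] by (rule norm_blinfun)
    also have "\<dots> \<le> c * sz ?w"
      using c[OF conf_P2] c0 norm_le_csize[OF finite_labels i, of ?w] by (intro mult_mono) auto
    finally show "\<bar>blinfun_apply (\<Phi>1 (conf z) (z i)) (?w i) - blinfun_apply (\<Phi>2 (conf z) (z i)) (?w i)\<bar> \<le> c * sz ?w"
      by (simp add: blinfun.diff_left)
  qed
qed

lemma is_LD_bound:
  fixes h :: "'x::euclidean_space measure \<Rightarrow> 'y::euclidean_space"
  assumes h: "is_LD h \<Phi>" and c: "\<And>\<mu> z. \<mu> \<in> P2 \<Longrightarrow> norm (\<Phi> \<mu> z) \<le> c"
  shows "norm (h (conf y) - h (conf x)) \<le> c * sz (\<lambda>i. y i - x i)"
proof -
  let ?w = "\<lambda>i. y i - x i"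
  \<comment> \<open>The unit vector in the direction of the increment reduces the vector-valued
    estimate to a scalar one.\<close>
  define v where "v = sgn (h (conf y) - h (conf x))"
  let ?l = "blinfun_inner_left v"
  have c0: "0 \<le> c" using order_trans[OF norm_ge_zero c[OF return_P2]] .
  have v1: "norm v \<le> 1" by (simp add: v_def norm_sgn)
  have "\<bar>blinfun_apply ?l (h (conf y)) - blinfun_apply ?l (h (conf x))\<bar> \<le> c * sz ?w"
  proof (rule config_mean_value[where H="\<lambda>x. blinfun_apply ?l (h (conf x))", OF is_LD_line[OF h]], rule weighted_sum_le)
    fix z i assume i: "i \<in> range \<iota>"
    let ?q = "blinfun_apply (\<Phi> (conf z) (z i)) (?w i)"
    have "\<bar>blinfun_apply ?l ?q\<bar> \<le> norm ?q * norm v"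
      using Cauchy_Schwarz_ineq2[of ?q v] by (simp add: inner_commute mult.commute)
    also have "\<dots> \<le> norm ?q" using mult_left_mono[OF v1, of "norm ?q"] by simp
    also have "\<dots> \<le> norm (\<Phi> (conf z) (z i)) * norm (?w i)" by (rule norm_blinfun)
    also have "\<dots> \<le> c * sz ?w"
      using c[OF conf_P2] c0 norm_le_csize[OF finite_labels i, of ?w] by (intro mult_mono) auto
    finally show "\<bar>blinfun_apply ?l ?q\<bar> \<le> c * sz ?w" .
  qed
  then have "\<bar>blinfun_apply ?l (h (conf y) - h (conf x))\<bar> \<le> c * sz ?w" by (simp add: inner_diff_left)
  moreover have "blinfun_apply ?l (h (conf y) - h (conf x)) = norm (h (conf y) - h (conf x))"
    by (cases "h (conf y) = h (conf x)") (simp_all add: v_def sgn_div_norm power2_norm_eq_inner[symmetric] power2_eq_square)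
  ultimately show ?thesis by simp
qed

text \<open>A two-sided quadratic Taylor bound at all points makes the gradient Lipschitz continuous:
  compare the expansions of \<open>h\<close> at \<open>0 + (x + z)\<close> through the intermediate point \<open>x\<close>.\<close>

lemma quadratic_expansion_growth:
  fixes h :: "'x::euclidean_space measure \<Rightarrow> real"
  assumes ex: "\<And>X X'. X \<in> L2 \<Longrightarrow> X' \<in> L2 \<Longrightarrow>
      norm (h (Law X') - h (Law X) - (\<integral>\<omega>. blinfun_apply (\<Phi> (Law X) (X \<omega>)) (X' \<omega> - X \<omega>) \<partial>\<Omega>))
      \<le> 2 * c * (L2norm (\<lambda>\<omega>. X' \<omega> - X \<omega>))\<^sup>2"
    and c: "0 \<le> c"
  shows "\<bar>h (conf y) - h (conf x)\<bar> \<le> sz (\<lambda>i. y i - x i) * (norm (\<Phi> dirac0 0) + 14 * c * (sz x + sz y))"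
proof -
  define D where "D x z = (\<Sum>i\<in>range \<iota>. weight i * blinfun_apply (\<Phi> (conf x) (x i)) (z i))" for x z :: "'i \<Rightarrow> 'x"
  have D_scale: "D x (\<lambda>i. t *\<^sub>R z i) = t * D x z" for x z t
    unfolding D_def by (simp add: blinfun.scaleR_right sum_distrib_left algebra_simps)
  have D_add: "D x (\<lambda>i. z i + z' i) = D x z + D x z'" for x z z'
    unfolding D_def by (simp add: blinfun.add_right sum.distrib algebra_simps)
  have E: "\<bar>h (conf (\<lambda>i. x i + z i)) - h (conf x) - D x z\<bar> \<le> 2 * c * (sz z)\<^sup>2" for x z
  proof -
    have "\<bar>h (conf (\<lambda>i. x i + z i)) - h (conf x) - (\<integral>\<omega>. blinfun_apply (\<Phi> (conf x) (x (\<iota> \<omega>))) (z (\<iota> \<omega>)) \<partial>\<Omega>)\<bar>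
       \<le> 2 * c * (L2norm (\<lambda>\<omega>. z (\<iota> \<omega>)))\<^sup>2"
      using ex[OF simple_Omega_L2[OF simple, of x] simple_Omega_L2[OF simple, of "\<lambda>i. x i + z i"]] by simp
    also have "(\<integral>\<omega>. blinfun_apply (\<Phi> (conf x) (x (\<iota> \<omega>))) (z (\<iota> \<omega>)) \<partial>\<Omega>) = D x z"
      using integral_simple_Omega[OF simple finite_labels order_refl, of "\<lambda>i. blinfun_apply (\<Phi> (conf x) (x i)) (z i)"]
      by (simp add: D_def weight_def)
    also have "2 * c * (L2norm (\<lambda>\<omega>. z (\<iota> \<omega>)))\<^sup>2 \<le> 2 * c * (sz z)\<^sup>2"
      using c by (intro mult_left_mono power_mono L2norm_conf_le L2norm_nonneg) auto
    finally show ?thesis .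
  qed
  have lip: "\<bar>D x z - D (\<lambda>_. 0) z\<bar> \<le> 12 * c * sz x * sz z" for x z
  proof (cases "sz x = 0 \<or> sz z = 0")
    case True
    then show ?thesis
    proof
      assume "sz x = 0"
      then have "x i = 0" if "i \<in> range \<iota>" for i
        using norm_le_csize[OF finite_labels that, of x] by simp
      then have "D x z = D (\<lambda>_. 0) z" unfolding D_def by simp
      then show ?thesis using c by (simp add: csize_nonneg)
    next
      assume "sz z = 0"
      then have "z i = 0" if "i \<in> range \<iota>" for i
        using norm_le_csize[OF finite_labels that, of z] by simp
      then have "D x z = 0" "D (\<lambda>_. 0) z = 0" unfolding D_def by (auto intro!: sum.neutral)
      then show ?thesis using c by (simp add: csize_nonneg)
    qed
  next
    case False
    then have pos: "0 < sz x" "0 < sz z" using csize_nonneg[of "range \<iota>" x] csize_nonneg[of "range \<iota>" z] by auto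
    \<comment> \<open>Rescales \<open>z\<close> to the size of \<open>x\<close>, so that the three
      expansion errors (from x to x + w, from 0 to x + w, from 0 to x) are comparable: 2 + 8 + 2 =
      12 times c |x|^2. Linearity then removes the factor.\<close>
    define t where "t = sz x / sz z"
    define w where "w i = t *\<^sub>R z i" for i
    have t: "0 < t" using pos by (simp add: t_def)
    have "sz w = sz (\<lambda>i. t *\<^sub>R z i)" by (simp add: w_def[abs_def])
    then have szw: "sz w = sz x" using pos by (simp add: csize_scaleR t_def)
    have "sz (\<lambda>i. x i + w i) \<le> 2 * sz x" using csize_add[of "range \<iota>" x w] szw by simp
    then have "(sz (\<lambda>i. x i + w i))\<^sup>2 \<le> (2 * sz x)\<^sup>2" by (intro power_mono csize_nonneg)
    then have "2 * c * (sz (\<lambda>i. x i + w i))\<^sup>2 \<le> 2 * c * (2 * sz x)\<^sup>2" using c by (intro mult_left_mono) auto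
    then have "\<bar>D x w - D (\<lambda>_. 0) w\<bar> \<le> 12 * c * (sz x)\<^sup>2"
      using E[of x w] E[of "\<lambda>_. 0" "\<lambda>i. x i + w i"] E[of "\<lambda>_. 0" x] szw
      by (simp add: D_add power_mult_distrib)
    also have "\<bar>D x w - D (\<lambda>_. 0) w\<bar> = t * \<bar>D x z - D (\<lambda>_. 0) z\<bar>"
      using t unfolding w_def D_scale by (simp add: right_diff_distrib[symmetric] abs_mult)
    finally have "t * \<bar>D x z - D (\<lambda>_. 0) z\<bar> \<le> t * (12 * c * sz x * sz z)"
    proof -
      have "t * (12 * c * sz x * sz z) = 12 * c * (sz x)\<^sup>2" using pos by (simp add: t_def power2_eq_square)
      then show "t * \<bar>D x z - D (\<lambda>_. 0) z\<bar> \<le> 12 * c * (sz x)\<^sup>2 \<Longrightarrow> ?thesis" by linarith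
    qed
    then show ?thesis using t by simp
  qed
  let ?z = "\<lambda>i. y i - x i"
  have D0: "\<bar>D (\<lambda>_. 0) ?z\<bar> \<le> norm (\<Phi> dirac0 0) * sz ?z"
    unfolding D_def conf_zero
  proof (rule weighted_sum_le)
    fix i assume i: "i \<in> range \<iota>"
    have "\<bar>blinfun_apply (\<Phi> dirac0 0) (?z i)\<bar> \<le> norm (\<Phi> dirac0 0) * norm (?z i)"
      using norm_blinfun[of "\<Phi> dirac0 0" "?z i"] by simp
    also have "\<dots> \<le> norm (\<Phi> dirac0 0) * sz ?z"
      by (intro mult_left_mono norm_le_csize[OF finite_labels i]) simp
    finally show "\<bar>blinfun_apply (\<Phi> dirac0 0) (?z i)\<bar> \<le> norm (\<Phi> dirac0 0) * sz ?z" .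
  qed
  have "sz ?z \<le> sz y + sz x" using csize_add[of "range \<iota>" y "\<lambda>i. (-1) *\<^sub>R x i"] by (simp add: csize_def)
  then have "2 * c * (sz ?z)\<^sup>2 \<le> 2 * c * (sz ?z * (sz y + sz x))"
    using c unfolding power2_eq_square by (intro mult_left_mono) (auto simp: csize_nonneg)
  moreover have "12 * c * sz x * sz ?z \<le> 12 * c * (sz x + sz y) * sz ?z"
    using c by (intro mult_right_mono mult_left_mono) (auto simp: csize_nonneg)
  moreover have "\<bar>h (conf y) - h (conf x) - D x ?z\<bar> \<le> 2 * c * (sz ?z)\<^sup>2" using E[of x ?z] by simp
  ultimately have "\<bar>h (conf y) - h (conf x)\<bar> \<le> norm (\<Phi> dirac0 0) * sz ?z + 12 * c * (sz x + sz y) * sz ?z + 2 * c * (sz ?z * (sz y + sz x))"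
    using lip[of x ?z] D0 by linarith
  then show ?thesis by (simp add: algebra_simps)
qed

end

section \<open>The assumptions on \<open>f\<close> and \<open>g\<close> in usable form\<close>

lemma a1_facts:
  assumes "a1 f lamf Lamf lbf Lipf"
  shows "Lamf > 0"
    and "\<forall>\<mu>\<in>P2. twice_differentiable (\<lambda>(x, a). f x \<mu> a)"
    and "\<forall>x. \<forall>\<mu>\<in>P2. \<forall>a y.
        max (max (norm (Da f x \<mu> a)) (norm (Dm f x \<mu> a y))) (norm (Dx f x \<mu> a)) \<le> Lamf"
    and "\<exists>D2. (\<forall>x a. regular2 (\<lambda>\<mu>. f x \<mu> a) (D2 x a)) \<and>
        f_second_order lbf Lipf (\<lambda>x \<mu> a y z. dd (D2 x a \<mu>) y z)"
proof -
  note H = assms[unfolded a1_def]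
  show "Lamf > 0"
    using H by (elim conjE)
  show "\<forall>\<mu>\<in>P2. twice_differentiable (\<lambda>(x, a). f x \<mu> a)"
    using H by (elim conjE)
  show "\<forall>x. \<forall>\<mu>\<in>P2. \<forall>a y.
        max (max (norm (Da f x \<mu> a)) (norm (Dm f x \<mu> a y))) (norm (Dx f x \<mu> a)) \<le> Lamf"
    using H by (elim conjE)
  show "\<exists>D2. (\<forall>x a. regular2 (\<lambda>\<mu>. f x \<mu> a) (D2 x a)) \<and>
        f_second_order lbf Lipf (\<lambda>x \<mu> a y z. dd (D2 x a \<mu>) y z)"
    using H by (elim conjE)
qed

lemma a2_facts:
  assumes "a2 g lamg Lamg lbg lg"
  shows "lamg > 0" "Lamg > 0" "lbg > 0"
    and "\<forall>\<mu>\<in>P2. twice_differentiable (\<lambda>(x, a). g x \<mu> a)"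
    and "\<forall>x. \<forall>\<mu>\<in>P2. \<forall>a y. (\<lambda>u. Dm g u \<mu> a y) differentiable (at x)"
    and "\<forall>x. \<forall>\<mu>\<in>P2. \<forall>a y. (\<lambda>b. Dm g x \<mu> b y) differentiable (at a)"
    and "\<exists>D2. (\<forall>x a. regular2 (\<lambda>\<mu>. g x \<mu> a) (D2 x a)) \<and>
        jlipschitz (\<lambda>\<mu> (x, a, y, z). dd (D2 x a \<mu>) y z) \<and>
        (\<forall>x. \<forall>\<mu>\<in>P2. \<forall>a y z. norm (dd (D2 x a \<mu>) y z) \<le> Lamg)"
    and "\<forall>x. \<forall>\<mu>\<in>P2. \<forall>a y.
        norm (Da (Da g) x \<mu> a) \<le> Lamg \<and>
        norm (Dx (\<lambda>x \<mu> a. Dm g x \<mu> a y) x \<mu> a) \<le> Lamg \<and>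
        norm (Dx (Dx g) x \<mu> a) \<le> Lamg \<and>
        norm (Dif (Dm g x \<mu> a) y) \<le> Lamg \<and>
        norm (Dx (Da g) x \<mu> a) \<le> lbg \<and>
        norm (Da (\<lambda>x \<mu> a. Dm g x \<mu> a y) x \<mu> a) \<le> lbg"
    and "\<forall>x. \<forall>\<mu>\<in>P2. \<forall>a \<xi>.
        blinfun_apply (blinfun_apply (Da (Da g) x \<mu> a) \<xi>) \<xi> \<ge> lamg * (norm \<xi>)\<^sup>2"
proof -
  note H = assms[unfolded a2_def]
  show "lamg > 0"
    using H by (elim conjE)
  show "Lamg > 0"
    using H by (elim conjE)
  show "lbg > 0"
    using H by (elim conjE)
  show "\<forall>\<mu>\<in>P2. twice_differentiable (\<lambda>(x, a). g x \<mu> a)"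
    using H by (elim conjE)
  show "\<forall>x. \<forall>\<mu>\<in>P2. \<forall>a y. (\<lambda>u. Dm g u \<mu> a y) differentiable (at x)"
    using H by (elim conjE)
  show "\<forall>x. \<forall>\<mu>\<in>P2. \<forall>a y. (\<lambda>b. Dm g x \<mu> b y) differentiable (at a)"
    using H by (elim conjE)
  show "\<exists>D2. (\<forall>x a. regular2 (\<lambda>\<mu>. g x \<mu> a) (D2 x a)) \<and>
        jlipschitz (\<lambda>\<mu> (x, a, y, z). dd (D2 x a \<mu>) y z) \<and>
        (\<forall>x. \<forall>\<mu>\<in>P2. \<forall>a y z. norm (dd (D2 x a \<mu>) y z) \<le> Lamg)"
    using H by (elim conjE)
  show "\<forall>x. \<forall>\<mu>\<in>P2. \<forall>a y.
        norm (Da (Da g) x \<mu> a) \<le> Lamg \<and>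
        norm (Dx (\<lambda>x \<mu> a. Dm g x \<mu> a y) x \<mu> a) \<le> Lamg \<and>
        norm (Dx (Dx g) x \<mu> a) \<le> Lamg \<and>
        norm (Dif (Dm g x \<mu> a) y) \<le> Lamg \<and>
        norm (Dx (Da g) x \<mu> a) \<le> lbg \<and>
        norm (Da (\<lambda>x \<mu> a. Dm g x \<mu> a y) x \<mu> a) \<le> lbg"
    using H by (elim conjE)
  show "\<forall>x. \<forall>\<mu>\<in>P2. \<forall>a \<xi>.
        blinfun_apply (blinfun_apply (Da (Da g) x \<mu> a) \<xi>) \<xi> \<ge> lamg * (norm \<xi>)\<^sup>2"
    using H by (elim conjE)
qed

locale control_data =
  fixes f :: "real^'n \<Rightarrow> (real^'n) measure \<Rightarrow> real^'a \<Rightarrow> real^'n"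
    and g :: "real^'n \<Rightarrow> (real^'n) measure \<Rightarrow> real^'a \<Rightarrow> real"
    and k :: "real^'n \<Rightarrow> (real^'n) measure \<Rightarrow> real"
    and lamf Lamf lbf Lipf lamg Lamg lbg lg :: real
  assumes A1: "a1 f lamf Lamf lbf Lipf" and A2: "a2 g lamg Lamg lbg lg" and H1: "h1 f g k"
    and laws: "\<forall>\<mu>\<in>(P2 :: (real^'n) measure set). \<exists>X\<in>L2. Law X = \<mu>"
begin

lemma dirac0_P2: "(dirac0 :: (real^'n) measure) \<in> P2"
  by (rule return_P2)

lemma pos: "0 < Lamf" "0 < lamg" "0 < Lamg" "0 < lbg"
  using a1_facts(1)[OF A1] a2_facts(1-3)[OF A2] by auto

lemma f_twice: "\<mu> \<in> P2 \<Longrightarrow> twice_differentiable (\<lambda>(x, a). f x \<mu> a)"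
  using a1_facts(2)[OF A1] by blast

lemma g_twice: "\<mu> \<in> P2 \<Longrightarrow> twice_differentiable (\<lambda>(x, a). g x \<mu> a)"
  using a2_facts(4)[OF A2] by blast

lemma f_bounds:
  assumes "\<mu> \<in> P2"
  shows "norm (Dif (\<lambda>b. f x \<mu> b) a) \<le> Lamf" "norm (LD (\<lambda>\<nu>. f x \<nu> a) \<mu> y) \<le> Lamf" "norm (Dif (\<lambda>u. f u \<mu> a) x) \<le> Lamf"
  using a1_facts(3)[OF A1, rule_format, OF assms, of x a y] by (auto simp: Da_def Dm_def Dx_def)

lemma g_bounds:
  assumes "\<mu> \<in> P2"
  shows "norm (Dif (\<lambda>u. LD (\<lambda>\<nu>. g u \<nu> a) \<mu> y) x) \<le> Lamg"
    "norm (Dif (\<lambda>u. Dif (\<lambda>v. g v \<mu> a) u) x) \<le> Lamg"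
    "norm (Dif (LD (\<lambda>\<nu>. g x \<nu> a) \<mu>) y) \<le> Lamg"
    "norm (Dif (\<lambda>u. Dif (\<lambda>b. g u \<mu> b) a) x) \<le> lbg"
    "norm (Dif (\<lambda>b. LD (\<lambda>\<nu>. g x \<nu> b) \<mu> y) a) \<le> lbg"
  using a2_facts(8)[OF A2, rule_format, OF assms, of x a y]
  unfolding Da_def Dm_def Dx_def by auto

lemma LD_g_differentiable:
  assumes "\<mu> \<in> P2"
  shows "(\<lambda>u. LD (\<lambda>\<nu>. g u \<nu> a) \<mu> y) differentiable (at x)" "(\<lambda>b. LD (\<lambda>\<nu>. g x \<nu> b) \<mu> y) differentiable (at a)"
  using a2_facts(5)[OF A2, rule_format, OF assms, of a y x] a2_facts(6)[OF A2, rule_format, OF assms, of x y a]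
  unfolding Dm_def by auto

lemma f_LD: "is_LD (\<lambda>\<nu>. f x \<nu> a) (LD (\<lambda>\<nu>. f x \<nu> a))"
proof -
  from a1_facts(4)[OF A1] obtain D2 where "\<forall>x a. regular2 (\<lambda>\<mu>. f x \<mu> a) (D2 x a)" by (elim exE conjE)
  then have "regular2 (\<lambda>\<mu>. f x \<mu> a) (D2 x a)" by blast
  then show ?thesis by (rule LD_is_LD[OF laws])
qed

lemma g_LD: "is_LD (\<lambda>\<nu>. g x \<nu> a) (LD (\<lambda>\<nu>. g x \<nu> a))"
proof -
  from a2_facts(7)[OF A2] obtain D2 where "\<forall>x a. regular2 (\<lambda>\<mu>. g x \<mu> a) (D2 x a)" by (elim exE conjE)
  then have "regular2 (\<lambda>\<mu>. g x \<mu> a) (D2 x a)" by blast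
  then show ?thesis by (rule LD_is_LD[OF laws])
qed

lemma g_expansion:
  assumes "X \<in> L2" "X' \<in> L2"
  shows "norm (g x (Law X') a - g x (Law X) a - (\<integral>\<omega>. blinfun_apply (LD (\<lambda>\<nu>. g x \<nu> a) (Law X) (X \<omega>)) (X' \<omega> - X \<omega>) \<partial>\<Omega>))
      \<le> 2 * Lamg * (L2norm (\<lambda>\<omega>. X' \<omega> - X \<omega>))\<^sup>2"
proof -
  from a2_facts(7)[OF A2] obtain D2 where D2: "\<forall>x a. regular2 (\<lambda>\<mu>. g x \<mu> a) (D2 x a)"
    "\<forall>x. \<forall>\<mu>\<in>P2. \<forall>a y z. norm (dd (D2 x a \<mu>) y z) \<le> Lamg" by (elim exE conjE)
  show ?thesis
  proof (rule LD_expansion[OF laws _ _ _ assms, where h="\<lambda>\<nu>. g x \<nu> a" and ?D2.0="D2 x a"])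
    show "regular2 (\<lambda>\<nu>. g x \<nu> a) (D2 x a)" using D2(1) by blast
    show "norm (dd (D2 x a \<mu>) y z) \<le> Lamg" if "\<mu> \<in> P2" for \<mu> y z using D2(2) that by blast
  qed (rule g_bounds(3))
qed

lemma LD_g_lipschitz:
  assumes "\<mu> \<in> P2"
  shows "norm (LD (\<lambda>\<nu>. g x' \<nu> a) \<mu> y - LD (\<lambda>\<nu>. g x \<nu> a) \<mu> y) \<le> Lamg * norm (x' - x)"
    "norm (LD (\<lambda>\<nu>. g x \<nu> a') \<mu> y - LD (\<lambda>\<nu>. g x \<nu> a) \<mu> y) \<le> lbg * norm (a' - a)"
  using Dif_lipschitz[of "\<lambda>u. LD (\<lambda>\<nu>. g u \<nu> a) \<mu> y" Lamg x' x, OF LD_g_differentiable(1)[OF assms] g_bounds(1)[OF assms]]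
    Dif_lipschitz[of "\<lambda>b. LD (\<lambda>\<nu>. g x \<nu> b) \<mu> y" lbg a' a, OF LD_g_differentiable(2)[OF assms] g_bounds(5)[OF assms]]
  by auto

lemma LD_g_origin: "norm (LD (\<lambda>\<nu>. g x \<nu> a) dirac0 0) \<le> Lamg * norm x + lbg * norm a"
proof -
  have "LD (\<lambda>\<nu>. g 0 \<nu> 0) dirac0 0 = 0" using H1 unfolding h1_def Dm_def by auto
  then have "LD (\<lambda>\<nu>. g x \<nu> a) dirac0 0 = (LD (\<lambda>\<nu>. g x \<nu> a) dirac0 0 - LD (\<lambda>\<nu>. g 0 \<nu> a) dirac0 0)
      + (LD (\<lambda>\<nu>. g 0 \<nu> a) dirac0 0 - LD (\<lambda>\<nu>. g 0 \<nu> 0) dirac0 0)" by simp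
  also have "norm \<dots> \<le> Lamg * norm (x - 0) + lbg * norm (a - 0)"
    by (intro norm_triangle_mono LD_g_lipschitz dirac0_P2)
  finally show ?thesis by simp
qed

lemma g_mixed_difference:
  assumes "\<mu> \<in> P2"
  shows "\<bar>(g y \<mu> a' - g x \<mu> a') - (g y \<mu> a - g x \<mu> a)\<bar> \<le> lbg * norm (y - x) * norm (a' - a)"
proof -
  note p = twice_differentiable_partial[OF g_twice[OF assms]]
  have d: "norm (Dif (g y \<mu>) b - Dif (g x \<mu>) b) \<le> lbg * norm (y - x)" for b
    by (rule Dif_lipschitz[OF p(5) g_bounds(4)[OF assms]])
  have "norm ((g y \<mu> a' - g x \<mu> a') - (g y \<mu> a - g x \<mu> a)) \<le> (lbg * norm (y - x)) * norm (a' - a)"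
  proof (rule Dif_lipschitz[where \<phi>="\<lambda>b. g y \<mu> b - g x \<mu> b"])
    show "(\<lambda>b. g y \<mu> b - g x \<mu> b) differentiable (at b)" for b by (rule Dif_diff(1)[OF p(2) p(2)])
    show "norm (Dif (\<lambda>b. g y \<mu> b - g x \<mu> b) b) \<le> lbg * norm (y - x)" for b
      unfolding Dif_diff(2)[OF p(2) p(2)] by (rule d)
  qed
  then show ?thesis by simp
qed

lemma g_x_dirac0:
  "\<bar>g y dirac0 0 - g x dirac0 0\<bar> \<le> Lamg * (norm x + norm y) * norm (y - x)"
proof -
  note p = twice_differentiable_partial[OF g_twice[OF dirac0_P2]]
  have z: "Dif (\<lambda>u. g u dirac0 0) 0 = 0" using H1 unfolding h1_def Dx_def by auto
  have "norm (g y dirac0 0 - g x dirac0 0) \<le> (Lamg * (norm x + norm y)) * norm (y - x)"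
  proof (rule Dif_segment_bound[OF p(1)])
    fix u assume u: "u \<in> closed_segment x y"
    have nu: "norm u \<le> norm x + norm y"
    proof -
      from u obtain t where t: "u = (1 - t) *\<^sub>R x + t *\<^sub>R y" "0 \<le> t" "t \<le> 1" unfolding closed_segment_def by auto
      have "norm u \<le> (1 - t) * norm x + t * norm y"
        using norm_triangle_ineq[of "(1 - t) *\<^sub>R x" "t *\<^sub>R y"] t by simp
      also have "\<dots> \<le> 1 * norm x + 1 * norm y" using t by (intro add_mono mult_right_mono) auto
      finally show ?thesis by simp
    qed
    have "norm (Dif (\<lambda>u. g u dirac0 0) u - Dif (\<lambda>u. g u dirac0 0) 0) \<le> Lamg * norm (u - 0)"
      by (rule Dif_lipschitz[OF p(3) g_bounds(2)[OF dirac0_P2]])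
    also have "Lamg * norm (u - 0) \<le> Lamg * (norm x + norm y)"
      using nu pos(3) by (intro mult_left_mono) auto
    finally show "norm (Dif (\<lambda>u. g u dirac0 0) u) \<le> Lamg * (norm x + norm y)"
      unfolding z by simp
  qed
  then show ?thesis by simp
qed

lemma g_a_dirac0: "g 0 dirac0 a - g 0 dirac0 0 \<ge> lamg / 2 * (norm a)\<^sup>2"
proof (rule strongly_convex_minimum)
  note p = twice_differentiable_partial[OF g_twice[OF dirac0_P2]]
  show "g 0 dirac0 differentiable (at b)" for b using p(2) by simp
  show "Dif (g 0 dirac0) differentiable (at b)" for b using p(4) by simp
  show "Dif (g 0 dirac0) 0 = 0" using H1 unfolding h1_def Da_def by auto
  show "lamg * (norm \<xi>)\<^sup>2 \<le> blinfun_apply (blinfun_apply (Dif (Dif (g 0 dirac0)) b) \<xi>) \<xi>" for b \<xi>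
    using a2_facts(9)[OF A2, rule_format, OF dirac0_P2, of \<xi> 0 b] unfolding Da_def by simp
qed

end

section \<open>Growth of the data on configurations\<close>

locale particle_data = control_data f g k lamf Lamf lbf Lipf lamg Lamg lbg lg + labelling \<iota>
  for f :: "real^'n \<Rightarrow> (real^'n) measure \<Rightarrow> real^'a \<Rightarrow> real^'n"
    and g :: "real^'n \<Rightarrow> (real^'n) measure \<Rightarrow> real^'a \<Rightarrow> real"
    and k :: "real^'n \<Rightarrow> (real^'n) measure \<Rightarrow> real"
    and lamf Lamf lbf Lipf lamg Lamg lbg lg :: real
    and \<iota> :: "real \<Rightarrow> 'i"
begin

lemma f_lipschitz:
  "norm (f x' (conf X') a' - f x (conf X) a) \<le> Lamf * (norm (x' - x) + sz (\<lambda>i. X' i - X i) + norm (a' - a))"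
proof -
  note p = twice_differentiable_partial[OF f_twice[OF conf_P2]]
  have 1: "norm (f x' (conf X') a' - f x (conf X') a') \<le> Lamf * norm (x' - x)"
    by (rule Dif_lipschitz[where \<phi>="\<lambda>u. f u (conf X') a'", OF p(1) f_bounds(3)[OF conf_P2]])
  have 2: "norm (f x (conf X') a' - f x (conf X) a') \<le> Lamf * sz (\<lambda>i. X' i - X i)"
    by (rule is_LD_bound[OF f_LD f_bounds(2)])
  have 3: "norm (f x (conf X) a' - f x (conf X) a) \<le> Lamf * norm (a' - a)"
    by (rule Dif_lipschitz[where \<phi>="\<lambda>b. f x (conf X) b", OF p(2) f_bounds(1)[OF conf_P2]])
  have "f x' (conf X') a' - f x (conf X) a = (f x' (conf X') a' - f x (conf X') a') +
      ((f x (conf X') a' - f x (conf X) a') + (f x (conf X) a' - f x (conf X) a))" by simp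
  also have "norm \<dots> \<le> Lamf * norm (x' - x) + (Lamf * sz (\<lambda>i. X' i - X i) + Lamf * norm (a' - a))"
    by (intro norm_triangle_mono 1 2 3)
  finally show ?thesis by (simp add: algebra_simps)
qed

lemma f_growth: "norm (f x (conf X) a) \<le> Lamf * (norm x + sz X + norm a)"
proof -
  have "f 0 (conf (\<lambda>_. 0)) 0 = 0" unfolding conf_zero using H1 by (simp add: h1_def)
  then show ?thesis using f_lipschitz[of x X a 0 "\<lambda>_. 0" 0] by simp
qed

text \<open>The increment in x is compared first with the law \<open>dirac0\<close>, then with
  action 0, each time through a second difference with a bounded mixed derivative. At that base
  point the gradient in x vanishes at 0, so it grows linearly.\<close>

lemma g_x_lipschitz:
  "\<bar>g y (conf X) a - g x (conf X) a\<bar> \<le> norm (y - x) * (Lamg * (norm x + norm y) + lbg * norm a + Lamg * sz X)"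
proof -
  have "\<bar>(g y (conf X) a - g x (conf X) a) - (g y (conf (\<lambda>_. 0)) a - g x (conf (\<lambda>_. 0)) a)\<bar>
      \<le> (Lamg * norm (y - x)) * sz (\<lambda>i. X i - 0)"
    by (rule is_LD_diff_bound[OF g_LD g_LD LD_g_lipschitz(1)])
  moreover have "\<bar>(g y dirac0 a - g x dirac0 a) - (g y dirac0 0 - g x dirac0 0)\<bar> \<le> lbg * norm (y - x) * norm (a - 0)"
    by (rule g_mixed_difference[OF dirac0_P2])
  ultimately have "\<bar>g y (conf X) a - g x (conf X) a\<bar> \<le> (Lamg * norm (y - x)) * sz X + lbg * norm (y - x) * norm a
      + Lamg * (norm x + norm y) * norm (y - x)"
    using g_x_dirac0[of y x] unfolding conf_zero diff_0_right by linarith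
  then show ?thesis by (simp add: algebra_simps)
qed

text \<open>The variation of \<open>LD g\<close> with the measure is controlled indirectly, by the
  quadratic expansion, starting from its size at \<open>dirac0\<close> and 0.\<close>

lemma g_measure_lipschitz:
  "\<bar>g x (conf Y) a - g x (conf X) a\<bar> \<le> sz (\<lambda>i. Y i - X i) * (Lamg * norm x + lbg * norm a + 14 * Lamg * (sz X + sz Y))"
proof -
  have "\<bar>g x (conf Y) a - g x (conf X) a\<bar> \<le> sz (\<lambda>i. Y i - X i) * (norm (LD (\<lambda>\<nu>. g x \<nu> a) dirac0 0) + 14 * Lamg * (sz X + sz Y))"
    by (rule quadratic_expansion_growth[where h="\<lambda>\<nu>. g x \<nu> a", OF g_expansion]) (use pos in auto)
  also have "\<dots> \<le> sz (\<lambda>i. Y i - X i) * (Lamg * norm x + lbg * norm a + 14 * Lamg * (sz X + sz Y))"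
    using LD_g_origin[of x a] by (intro mult_left_mono) (auto simp: csize_nonneg)
  finally show ?thesis .
qed

text \<open>At x = 0 and \<open>dirac0\<close> the action 0 is critical, and strong convexity gives
  the quadratic term. Passing to x and \<open>conf X\<close> costs second differences, which are
  linear in |a| with the coefficient \<open>lbg\<close>.\<close>

lemma g_coercive:
  "g x (conf X) a - g x (conf X) 0 \<ge> lamg / 2 * (norm a)\<^sup>2 - lbg * norm a * (norm x + sz X)"
proof -
  have "\<bar>(g x (conf X) a - g x (conf X) 0) - (g x (conf (\<lambda>_. 0)) a - g x (conf (\<lambda>_. 0)) 0)\<bar>
      \<le> (lbg * norm (a - 0)) * sz (\<lambda>i. X i - 0)"
    by (rule is_LD_diff_bound[OF g_LD g_LD LD_g_lipschitz(2)])
  moreover have "\<bar>(g x dirac0 a - g 0 dirac0 a) - (g x dirac0 0 - g 0 dirac0 0)\<bar> \<le> lbg * norm (x - 0) * norm (a - 0)"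
    by (rule g_mixed_difference[OF dirac0_P2])
  ultimately have "g x (conf X) a - g x (conf X) 0 \<ge> lamg / 2 * (norm a)\<^sup>2 - lbg * norm x * norm a - (lbg * norm a) * sz X"
    using g_a_dirac0[of a] unfolding conf_zero diff_0_right by linarith
  then show ?thesis by (simp add: algebra_simps)
qed

lemma fg_continuous:
  "continuous_on UNIV (\<lambda>b. f x (conf X) b \<bullet> z + g x (conf X) b)"
  "continuous_on UNIV \<zeta> \<Longrightarrow> continuous_on UNIV (\<lambda>u. f u (conf X) a \<bullet> \<zeta> u + g u (conf X) a)"
proof -
  note p = twice_differentiable_partial(1,2)[OF f_twice[OF conf_P2]] twice_differentiable_partial(1,2)[OF g_twice[OF conf_P2]]
  have c: "continuous_on UNIV (\<lambda>u. f u (conf X) a)" "continuous_on UNIV (\<lambda>b. f x (conf X) b)"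
    "continuous_on UNIV (\<lambda>u. g u (conf X) a)" "continuous_on UNIV (\<lambda>b. g x (conf X) b)"
    by (intro continuous_at_imp_continuous_on ballI differentiable_imp_continuous_within p)+
  show "continuous_on UNIV (\<lambda>b. f x (conf X) b \<bullet> z + g x (conf X) b)"
    by (intro continuous_intros c)
  show "continuous_on UNIV (\<lambda>u. f u (conf X) a \<bullet> \<zeta> u + g u (conf X) a)" if "continuous_on UNIV \<zeta>"
    by (intro continuous_intros c that)
qed

section \<open>The Hamiltonian\<close>

text \<open>The term with \<open>f\<close> changes at most linearly in the action, whereas
  \<open>g\<close> grows quadratically, so beyond the radius \<open>R\<close>, the zero of r ->
  lamg/2 r - K, every action is worse than 0. Compactness of the ball does the rest and gives the
  linear bound on the minimiser.\<close>

lemma hamiltonian_attained: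
  shows "\<exists>a. hamiltonian f g x (conf X) z = f x (conf X) a \<bullet> z + g x (conf X) a \<and>
      norm a \<le> 2 / lamg * (Lamf * norm z + lbg * (norm x + sz X))"
    and "hamiltonian f g x (conf X) z \<le> f x (conf X) b \<bullet> z + g x (conf X) b"
proof -
  define F where "F a = f x (conf X) a \<bullet> z + g x (conf X) a" for a
  define K where "K = Lamf * norm z + lbg * (norm x + sz X)"
  define R where "R = 2 / lamg * K"
  have K: "0 \<le> K" unfolding K_def using pos by (simp add: csize_nonneg)
  have R: "0 \<le> R" unfolding R_def using K pos by simp
  have out: "F 0 < F a" if "R < norm a" for a
  proof -
    have "norm (f x (conf X) a - f x (conf X) 0) \<le> Lamf * norm a"
      using f_lipschitz[of x X a x X 0] by (simp add: csize_def)
    then have "\<bar>(f x (conf X) a - f x (conf X) 0) \<bullet> z\<bar> \<le> (Lamf * norm a) * norm z"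
      by (intro order_trans[OF Cauchy_Schwarz_ineq2] mult_right_mono) auto
    then have "F a - F 0 \<ge> - (Lamf * norm a * norm z) + (lamg / 2 * (norm a)\<^sup>2 - lbg * norm a * (norm x + sz X))"
      using g_coercive[of a x X] by (simp add: F_def inner_diff_left abs_le_iff)
    also have "- (Lamf * norm a * norm z) + (lamg / 2 * (norm a)\<^sup>2 - lbg * norm a * (norm x + sz X)) = norm a * (lamg / 2 * norm a - K)"
      by (simp add: K_def power2_eq_square algebra_simps)
    finally have 1: "F a - F 0 \<ge> norm a * (lamg / 2 * norm a - K)" .
    have "K < lamg / 2 * norm a" using that pos by (simp add: R_def field_simps)
    moreover have "0 < norm a" using that R by linarith
    ultimately have "0 < norm a * (lamg / 2 * norm a - K)" by simp
    then show ?thesis using 1 by linarith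
  qed
  have "continuous_on (cball 0 R) F"
    unfolding F_def using fg_continuous(1) by (rule continuous_on_subset) simp
  then obtain a where a: "a \<in> cball 0 R" "\<And>b. b \<in> cball 0 R \<Longrightarrow> F a \<le> F b"
    using continuous_attains_inf[OF compact_cball[of 0 R], of F] R by auto
  have min: "F a \<le> F b" for b
  proof (cases "b \<in> cball 0 R")
    case False
    then have "F 0 < F b" by (intro out) simp
    then show ?thesis using a(2)[of 0] R by simp
  qed (rule a(2))
  have H: "hamiltonian f g x (conf X) z = F a"
    unfolding hamiltonian_def F_def[symmetric]
    by (rule Least_equality) (use min in auto)
  show "\<exists>a. hamiltonian f g x (conf X) z = f x (conf X) a \<bullet> z + g x (conf X) a \<and>
      norm a \<le> 2 / lamg * (Lamf * norm z + lbg * (norm x + sz X))"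
    using H a(1) unfolding F_def R_def K_def by (intro exI[of _ a]) simp
  show "hamiltonian f g x (conf X) z \<le> f x (conf X) b \<bullet> z + g x (conf X) b"
    using min[of b] unfolding H F_def .
qed

text \<open>An infimum of functions continuous in x has open strict sublevel sets. Measurability
  permits evaluating the integral in the Bellman equation as a weighted sum over labels.\<close>

lemma hamiltonian_measurable:
  assumes "continuous_on UNIV \<zeta>"
  shows "(\<lambda>x. hamiltonian f g x (conf X) (\<zeta> x)) \<in> borel_measurable borel"
proof (rule borel_measurableI_less)
  fix c :: real
  have "{x. hamiltonian f g x (conf X) (\<zeta> x) < c} = (\<Union>a. {x. f x (conf X) a \<bullet> \<zeta> x + g x (conf X) a < c})"
  proof (intro set_eqI iffI)
    fix x assume "x \<in> {x. hamiltonian f g x (conf X) (\<zeta> x) < c}"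
    then show "x \<in> (\<Union>a. {x. f x (conf X) a \<bullet> \<zeta> x + g x (conf X) a < c})"
      using hamiltonian_attained(1)[of x X "\<zeta> x"] by auto
  next
    fix x assume "x \<in> (\<Union>a. {x. f x (conf X) a \<bullet> \<zeta> x + g x (conf X) a < c})"
    then obtain a where "f x (conf X) a \<bullet> \<zeta> x + g x (conf X) a < c" by auto
    then show "x \<in> {x. hamiltonian f g x (conf X) (\<zeta> x) < c}"
      using hamiltonian_attained(2)[of x X "\<zeta> x" a] by simp
  qed
  also have "open \<dots>"
    by (intro open_UN ballI open_Collect_less fg_continuous(2) assms continuous_intros)
  finally show "{x \<in> space borel. hamiltonian f g x (conf X) (\<zeta> x) < c} \<in> sets borel" by simp
qed

lemma integral_conf:
  fixes h :: "real^'n \<Rightarrow> real"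
  assumes "h \<in> borel_measurable borel"
  shows "(\<integral>x. h x \<partial>conf X) = (\<Sum>i\<in>range \<iota>. weight i * h (X i))"
  using integral_simple_Omega[OF simple finite_labels order_refl, of "\<lambda>i. h (X i)"]
  by (simp add: integral_Law[OF simple_Omega_measurable[OF simple] assms] weight_def)

section \<open>The particle system as a control problem\<close>

definition pb :: "('i \<Rightarrow> real^'n) \<Rightarrow> ('i \<Rightarrow> real^'a) \<Rightarrow> 'i \<Rightarrow> real^'n" where
  "pb x a i = f (x i) (conf x) (a i)"

definition pL :: "('i \<Rightarrow> real^'n) \<Rightarrow> ('i \<Rightarrow> real^'a) \<Rightarrow> real" where
  "pL x a = (\<Sum>i\<in>range \<iota>. weight i * g (x i) (conf x) (a i))"

text \<open>Dominates the constants of all four estimates: growth and Lipschitz bound of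
  \<open>pb\<close>, Lipschitz bound of \<open>pL\<close>, size of optimal actions. Sums over labels
  bring in the number of labels, which is harmless because every labelling is treated
  separately.\<close>

definition growth_const :: real where
  "growth_const = Lamf * (3 + card (range \<iota>)) + 17 * Lamg + 2 * lbg
     + 2 / lamg * (Lamf + lbg * (1 + card (range \<iota>)))"

lemma growth_const:
  "Lamf * (1 + card (range \<iota>)) \<le> growth_const" "2 * Lamf \<le> growth_const" "17 * Lamg + 2 * lbg \<le> growth_const"
  "2 / lamg * (Lamf + lbg * (1 + card (range \<iota>))) \<le> growth_const" "0 < growth_const"
proof -
  define E where "E = 2 / lamg * (Lamf + lbg * (1 + card (range \<iota>)))"
  have n: "0 \<le> Lamf * real (card (range \<iota>))" "0 \<le> E" using pos by (auto simp: E_def)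
  have e: "growth_const = 3 * Lamf + Lamf * real (card (range \<iota>)) + 17 * Lamg + 2 * lbg + E"
    unfolding growth_const_def E_def[symmetric] by (simp add: distrib_left)
  show "Lamf * (1 + card (range \<iota>)) \<le> growth_const" "2 * Lamf \<le> growth_const" "17 * Lamg + 2 * lbg \<le> growth_const"
    "2 / lamg * (Lamf + lbg * (1 + card (range \<iota>))) \<le> growth_const"
    unfolding e E_def[symmetric] using n pos by (simp_all add: distrib_left)
  show "0 < growth_const" unfolding e using n pos by linarith
qed

lemma norm_label_le: "i \<in> range \<iota> \<Longrightarrow> norm (x i) \<le> sz x"
  by (rule norm_le_csize[OF finite_labels])

lemma particle_control: "particle_control (range \<iota>) weight pb pL growth_const"
proof
  show "finite (range \<iota>)" by (rule finite_labels)
  show "0 < weight i" if "i \<in> range \<iota>" for i using that by (rule weight_gt_0)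
  show "weight i \<le> 1" for i by (rule weight_le_1)
  show "0 < growth_const" by (rule growth_const)
next
  fix x :: "'i \<Rightarrow> real^'n" and a :: "'i \<Rightarrow> real^'a"
  have "sz (pb x a) \<le> (\<Sum>i\<in>range \<iota>. Lamf * (norm (x i) + sz x + norm (a i)))"
    unfolding csize_def[of _ "pb x a"] pb_def by (intro sum_mono f_growth)
  also have "\<dots> = Lamf * ((1 + card (range \<iota>)) * sz x + sz a)"
    by (simp add: sum_distrib_left[symmetric] sum.distrib csize_def[symmetric] algebra_simps)
  also have "\<dots> \<le> Lamf * ((1 + card (range \<iota>)) * (sz x + sz a))"
    using pos csize_nonneg[of "range \<iota>" a] by (intro mult_left_mono) (auto simp: algebra_simps)
  also have "\<dots> \<le> growth_const * (sz x + sz a)"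
    using mult_right_mono[OF growth_const(1), of "sz x + sz a"] csize_nonneg[of "range \<iota>" a] csize_nonneg[of "range \<iota>" x]
    by (simp add: mult.assoc)
  finally show "sz (pb x a) \<le> growth_const * (sz x + sz a)" .
next
  fix x y :: "'i \<Rightarrow> real^'n" and a :: "'i \<Rightarrow> real^'a" and i
  assume i: "i \<in> range \<iota>"
  have "norm (pb y a i - pb x a i) \<le> Lamf * (norm (y i - x i) + sz (\<lambda>i. y i - x i) + norm (a i - a i))"
    unfolding pb_def by (rule f_lipschitz)
  also have "\<dots> \<le> (2 * Lamf) * sz (\<lambda>i. y i - x i)"
    using norm_label_le[OF i, of "\<lambda>i. y i - x i"] pos by simp
  also have "\<dots> \<le> growth_const * sz (\<lambda>i. y i - x i)"
    by (intro mult_right_mono growth_const csize_nonneg)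
  finally show "norm (pb y a i - pb x a i) \<le> growth_const * sz (\<lambda>i. y i - x i)" .
next
  fix x y :: "'i \<Rightarrow> real^'n" and a :: "'i \<Rightarrow> real^'a"
  let ?N = "sz (\<lambda>i. y i - x i)" and ?S = "sz x + sz y + sz a"
  have S: "0 \<le> ?S" "0 \<le> ?N" by (simp_all add: csize_nonneg)
  have "pL y a - pL x a = (\<Sum>i\<in>range \<iota>. weight i * (g (y i) (conf y) (a i) - g (x i) (conf x) (a i)))"
    unfolding pL_def by (simp add: sum_subtractf[symmetric] right_diff_distrib)
  also have "\<bar>\<dots>\<bar> \<le> ?N * ((17 * Lamg + 2 * lbg) * ?S)"
  proof (rule weighted_sum_le)
    fix i assume i: "i \<in> range \<iota>"
    note n = norm_label_le[OF i, of x] norm_label_le[OF i, of y] norm_label_le[OF i, of a]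
    have "\<bar>g (y i) (conf y) (a i) - g (x i) (conf y) (a i)\<bar> \<le> norm (y i - x i) * (Lamg * (norm (x i) + norm (y i)) + lbg * norm (a i) + Lamg * sz y)"
      by (rule g_x_lipschitz)
    also have "\<dots> \<le> ?N * (Lamg * (sz x + sz y) + lbg * sz a + Lamg * sz y)"
      using n pos norm_label_le[OF i, of "\<lambda>i. y i - x i"] S
      by (intro mult_mono add_mono mult_left_mono) (auto simp: csize_nonneg)
    finally have 1: "\<bar>g (y i) (conf y) (a i) - g (x i) (conf y) (a i)\<bar> \<le> ?N * (Lamg * (sz x + sz y) + lbg * sz a + Lamg * sz y)" .
    have "\<bar>g (x i) (conf y) (a i) - g (x i) (conf x) (a i)\<bar> \<le> ?N * (Lamg * norm (x i) + lbg * norm (a i) + 14 * Lamg * (sz x + sz y))"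
      by (rule g_measure_lipschitz)
    also have "\<dots> \<le> ?N * (Lamg * sz x + lbg * sz a + 14 * Lamg * (sz x + sz y))"
      using n pos S by (intro mult_left_mono add_mono) auto
    finally have 2: "\<bar>g (x i) (conf y) (a i) - g (x i) (conf x) (a i)\<bar> \<le> ?N * (Lamg * sz x + lbg * sz a + 14 * Lamg * (sz x + sz y))" .
    have "(Lamg * (sz x + sz y) + lbg * sz a + Lamg * sz y) + (Lamg * sz x + lbg * sz a + 14 * Lamg * (sz x + sz y)) \<le> (17 * Lamg + 2 * lbg) * ?S"
    proof -
      have "0 \<le> Lamg * sz x" "0 \<le> Lamg * sz y" "0 \<le> Lamg * sz a" "0 \<le> lbg * sz x" "0 \<le> lbg * sz y" "0 \<le> lbg * sz a"
        using pos by (auto simp: csize_nonneg)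
      then show ?thesis by (simp add: algebra_simps)
    qed
    from mult_left_mono[OF this S(2)] 1 2
    show "\<bar>g (y i) (conf y) (a i) - g (x i) (conf x) (a i)\<bar> \<le> ?N * ((17 * Lamg + 2 * lbg) * ?S)"
      unfolding distrib_left[of ?N] by linarith
  qed
  also have "\<dots> \<le> ?N * (growth_const * ?S)"
    using S by (intro mult_left_mono mult_right_mono growth_const)
  finally show "\<bar>pL y a - pL x a\<bar> \<le> growth_const * ?N * ?S" by (simp add: mult_ac)
qed

lemma conf_tendsto:
  assumes "\<forall>i\<in>range \<iota>. (\<lambda>k. x k i) \<longlonglongrightarrow> y i"
  shows "(\<lambda>k::nat. W2 (conf y) (conf (x k))) \<longlonglongrightarrow> 0"
proof (rule Lim_null_comparison[OF always_eventually[OF allI]])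
  show "norm (W2 (conf y) (conf (x k))) \<le> sz (\<lambda>i. y i - x k i)" for k
    unfolding real_norm_def abs_of_nonneg[OF W2_nonneg] by (rule W2_conf_le)
  have "(\<lambda>k. sz (\<lambda>i. y i - x k i)) \<longlonglongrightarrow> (\<Sum>i\<in>range \<iota>. norm (y i - y i))"
    unfolding csize_def by (intro tendsto_sum tendsto_norm tendsto_diff tendsto_const) (use assms in blast)
  then show "(\<lambda>k. sz (\<lambda>i. y i - x k i)) \<longlonglongrightarrow> 0" by simp
qed

text \<open>At \<open>conf x\<close> the Bellman equation is a weighted sum of Hamiltonians, one per
  label. As the actions of different labels are independent, the sum of the minima is the minimum
  over all action configurations.\<close>

lemma regular_solution_particles:
  assumes v: "regular_solution T f g k v" and T: "0 < T"
  shows "\<exists>ut Z. particle_control.solution (range \<iota>) weight pb pL growth_const T (\<lambda>t x. v t (conf x)) ut Z"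
proof -
  interpret particle_control "range \<iota>" weight pb pL growth_const T by (rule particle_control)
  from v[unfolded regular_solution_def] obtain vt vm where
    der: "\<forall>t\<in>{0..T}. \<forall>m\<in>P2. ((\<lambda>s. v s m) has_real_derivative vt t m) (at t within {0..T}) \<and>
        has_L_derivative (v t) m (vm t m)"
    and ct: "jcont {0..T} (\<lambda>m t. vt t m)" and cm: "jcont ({0..T} \<times> UNIV) (\<lambda>m (t, x). vm t m x)"
    and dm: "\<forall>t\<in>{0..T}. \<forall>m\<in>P2. \<forall>x. (\<lambda>s. vm s m x) differentiable (at t within {0..T}) \<and>
        vm t m differentiable (at x) \<and> (\<forall>i. L_differentiable (\<lambda>\<nu>. vm t \<nu> x $ i) m)"
    and eq: "\<forall>t\<in>{0..T}. \<forall>m\<in>P2. vt t m + (\<integral>x. hamiltonian f g x m (vm t m x) \<partial>m) = 0"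
    by (elim exE conjE)
  define ut where "ut t x = vt t (conf x)" for t and x :: "'i \<Rightarrow> real^'n"
  define Z where "Z t x i = vm t (conf x) (x i)" for t and x :: "'i \<Rightarrow> real^'n" and i
  have C1: "config_C1 (range \<iota>) weight T (\<lambda>t x. v t (conf x)) ut Z"
    unfolding config_C1_def
  proof (intro conjI ballI allI)
    fix t x assume t: "t \<in> {0..T}"
    show "((\<lambda>s. v s (conf x)) has_real_derivative ut t x) (at t within {0..T})"
      unfolding ut_def using der t conf_P2 by blast
  next
    fix t and x y :: "'i \<Rightarrow> real^'n" assume t: "t \<in> {0..T}"
    have "has_L_derivative (v t) (conf x) (vm t (conf x))" using der t conf_P2 by blast
    from L_derivative_line[OF this, of y]
    show "((\<lambda>r. v t (conf (\<lambda>i. x i + r *\<^sub>R y i))) has_real_derivative cpair (range \<iota>) weight (Z t x) y) (at 0)"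
      by (simp add: cpair_def Z_def)
  next
    show "config_cont (range \<iota>) T ut"
      unfolding config_cont_def ut_def
    proof (intro allI impI)
      fix s t and x :: "nat \<Rightarrow> 'i \<Rightarrow> real^'n" and y
      assume s: "\<forall>k. s k \<in> {0..T}" "t \<in> {0..T}" "s \<longlonglongrightarrow> t" and x: "\<forall>i\<in>range \<iota>. (\<lambda>k. x k i) \<longlonglongrightarrow> y i"
      show "(\<lambda>k. vt (s k) (conf (x k))) \<longlonglongrightarrow> vt t (conf y)"
        by (rule jcontD[OF ct conf_P2 s(2) conf_P2 s(1)[rule_format] conf_tendsto[OF x] s(3)])
    qed
  next
    fix i assume i: "i \<in> range \<iota>"
    show "config_cont (range \<iota>) T (\<lambda>t x. Z t x i)"
      unfolding config_cont_def Z_def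
    proof (intro allI impI)
      fix s t and x :: "nat \<Rightarrow> 'i \<Rightarrow> real^'n" and y
      assume s: "\<forall>k. s k \<in> {0..T}" "t \<in> {0..T}" "s \<longlonglongrightarrow> t" and x: "\<forall>i\<in>range \<iota>. (\<lambda>k. x k i) \<longlonglongrightarrow> y i"
      have "(\<lambda>k. (\<lambda>(t, z). vm t (conf (x k)) z) (s k, x k i)) \<longlonglongrightarrow> (\<lambda>(t, z). vm t (conf y) z) (t, y i)"
        by (rule jcontD[OF cm conf_P2 _ conf_P2 _ conf_tendsto[OF x] tendsto_Pair[OF s(3) x[rule_format, OF i]]])
           (use s in auto)
      then show "(\<lambda>k. vm (s k) (conf (x k)) (x k i)) \<longlonglongrightarrow> vm t (conf y) (y i)" by simp
    qed
  qed
  have H: "ut t x = - (\<Sum>i\<in>range \<iota>. weight i * hamiltonian f g (x i) (conf x) (Z t x i))" if t: "t \<in> {0..T}" for t x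
  proof -
    have "continuous_on UNIV (vm t (conf x))"
      by (intro continuous_at_imp_continuous_on ballI differentiable_imp_continuous_within) (use dm t conf_P2 in blast)
    then have "(\<lambda>z. hamiltonian f g z (conf x) (vm t (conf x) z)) \<in> borel_measurable borel"
      by (rule hamiltonian_measurable)
    from integral_conf[OF this, of x] eq[rule_format, OF t conf_P2, of x] show ?thesis
      by (simp add: ut_def Z_def)
  qed
  have sum_eq: "cpair (range \<iota>) weight (Z t x) (pb x a) + pL x a
      = (\<Sum>i\<in>range \<iota>. weight i * (f (x i) (conf x) (a i) \<bullet> Z t x i + g (x i) (conf x) (a i)))" for t x a
    by (simp add: cpair_def pb_def pL_def sum.distrib[symmetric] distrib_left inner_commute)
  have sub: "subsolution (\<lambda>t x. v t (conf x)) ut Z"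
    unfolding subsolution_def
  proof (intro conjI C1 ballI allI)
    fix t x a assume t: "t \<in> {0..T}"
    have "(\<Sum>i\<in>range \<iota>. weight i * hamiltonian f g (x i) (conf x) (Z t x i))
      \<le> (\<Sum>i\<in>range \<iota>. weight i * (f (x i) (conf x) (a i) \<bullet> Z t x i + g (x i) (conf x) (a i)))"
      by (intro sum_mono mult_left_mono hamiltonian_attained(2) less_imp_le weight_gt_0)
    then show "0 \<le> ut t x + cpair (range \<iota>) weight (Z t x) (pb x a) + pL x a"
      using H[OF t, of x] sum_eq[of t x a] by linarith
  qed
  have "solution (\<lambda>t x. v t (conf x)) ut Z"
    unfolding solution_def
  proof (intro conjI sub ballI allI)
    fix t and x :: "'i \<Rightarrow> real^'n" assume t: "t \<in> {0..T}"
    \<comment> \<open>Actions are chosen label by label, so that labels at the same position may use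
      different ones.\<close>
    have "\<forall>i. \<exists>a. hamiltonian f g (x i) (conf x) (Z t x i) = f (x i) (conf x) a \<bullet> Z t x i + g (x i) (conf x) a \<and>
      norm a \<le> 2 / lamg * (Lamf * norm (Z t x i) + lbg * (norm (x i) + sz x))"
      using hamiltonian_attained(1) by blast
    then obtain a where a: "\<And>i. hamiltonian f g (x i) (conf x) (Z t x i) = f (x i) (conf x) (a i) \<bullet> Z t x i + g (x i) (conf x) (a i)"
      "\<And>i. norm (a i) \<le> 2 / lamg * (Lamf * norm (Z t x i) + lbg * (norm (x i) + sz x))" by metis
    have "ut t x + cpair (range \<iota>) weight (Z t x) (pb x a) + pL x a = 0"
      using H[OF t, of x] sum_eq[of t x a] unfolding a(1) by linarith
    moreover have "sz a \<le> growth_const * (sz x + sz (Z t x))"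
    proof -
      have "sz a \<le> (\<Sum>i\<in>range \<iota>. 2 / lamg * (Lamf * norm (Z t x i) + lbg * (norm (x i) + sz x)))"
        unfolding csize_def[of _ a] by (intro sum_mono a(2))
      also have "\<dots> = 2 / lamg * (Lamf * sz (Z t x) + lbg * (1 + card (range \<iota>)) * sz x)"
      proof -
        have "(\<Sum>i\<in>range \<iota>. Lamf * norm (Z t x i) + lbg * (norm (x i) + sz x))
            = Lamf * sz (Z t x) + lbg * (1 + card (range \<iota>)) * sz x"
          by (simp add: sum_distrib_left[symmetric] sum.distrib csize_def[symmetric] algebra_simps)
        then show ?thesis unfolding sum_distrib_left[symmetric] by simp
      qed
      also have "\<dots> \<le> 2 / lamg * ((Lamf + lbg * (1 + card (range \<iota>))) * (sz x + sz (Z t x)))"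
      proof (rule mult_left_mono)
        have "0 \<le> Lamf * sz x" "0 \<le> lbg * (1 + card (range \<iota>)) * sz (Z t x)"
          using pos by (auto simp: csize_nonneg)
        then show "Lamf * sz (Z t x) + lbg * (1 + card (range \<iota>)) * sz x \<le> (Lamf + lbg * (1 + card (range \<iota>))) * (sz x + sz (Z t x))"
          unfolding distrib_left distrib_right by linarith
      qed (use pos in auto)
      also have "\<dots> \<le> growth_const * (sz x + sz (Z t x))"
        unfolding mult.assoc[symmetric] by (intro mult_right_mono growth_const add_nonneg_nonneg csize_nonneg)
      finally show ?thesis .
    qed
    ultimately show "\<exists>a. ut t x + cpair (range \<iota>) weight (Z t x) (pb x a) + pL x a = 0 \<and> sz a \<le> growth_const * (sz x + sz (Z t x))"
      by blast
  qed
  then show ?thesis by blast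
qed

lemma regular_solution_le:
  assumes v1: "regular_solution T f g k v1" and v2: "regular_solution T f g k v2" and T: "0 < T" and t: "t \<in> {0..T}"
  shows "v1 t (conf x) \<le> v2 t (conf x)"
proof -
  interpret particle_control "range \<iota>" weight pb pL growth_const T by (rule particle_control)
  from regular_solution_particles[OF v1 T] obtain u1 Z1 where 1: "solution (\<lambda>t x. v1 t (conf x)) u1 Z1" by blast
  from regular_solution_particles[OF v2 T] obtain u2 Z2 where 2: "solution (\<lambda>t x. v2 t (conf x)) u2 Z2" by blast
  have "v1 T m = v2 T m" if "m \<in> P2" for m
    using v1 v2 that unfolding regular_solution_def by (elim exE conjE) simp
  then show ?thesis
    using comparison[OF 1[unfolded solution_def, THEN conjunct1] 2 _ t, of x] conf_P2 by blast
qed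

end

section \<open>Approximation by finitely supported laws\<close>

text \<open>Values taken with probability 0 are redirected to a value \<open>v0\<close> of positive
  probability, which changes the vector on a null set only.\<close>

lemma ex_labelling:
  fixes \<phi> :: "real \<Rightarrow> 'b::euclidean_space"
  assumes s: "simple_function \<Omega> \<phi>"
  shows "\<exists>\<iota>. labelling \<iota> \<and> Law \<iota> = Law \<phi>"
proof -
  let ?V = "{v \<in> range \<phi>. 0 < measure \<Omega> (\<phi> -` {v})}"
  have fin: "finite (range \<phi>)" using s by (simp add: simple_function_def)
  have m: "\<phi> -` A \<in> sets borel" for A using simple_functionD(2)[OF s, of A] by simp
  define N where "N = \<phi> -` (- ?V)"
  have "measure \<Omega> {\<omega>. \<phi> \<omega> \<in> - ?V} = (\<Sum>i\<in>range \<phi>. if i \<in> - ?V then measure \<Omega> (\<phi> -` {i}) else 0)"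
    by (rule measure_simple_Omega[OF s fin order_refl])
  also have "\<dots> = 0"
    by (intro sum.neutral ballI) (auto simp: not_less intro!: antisym)
  finally have N0: "measure \<Omega> N = 0" by (simp add: N_def vimage_def)
  have "?V \<noteq> {}"
  proof
    assume "?V = {}"
    then have "N = UNIV" by (auto simp: N_def)
    then show False using N0 by simp
  qed
  then obtain v0 where v0: "v0 \<in> ?V" by blast
  define \<iota> where "\<iota> \<omega> = (if \<phi> \<omega> \<in> ?V then \<phi> \<omega> else v0)" for \<omega>
  have si: "simple_function \<Omega> \<iota>"
    using simple_function_compose1[OF s, of "\<lambda>v. if v \<in> ?V then v else v0"] by (simp add: \<iota>_def[abs_def])
  have "AE \<omega> in \<Omega>. \<omega> \<notin> N"
    using m N0 by (intro AE_not_in) (auto simp: null_sets_def \<Omega>.emeasure_eq_measure N_def)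
  then have ae: "AE \<omega> in \<Omega>. \<iota> \<omega> = \<phi> \<omega>" by eventually_elim (simp add: N_def \<iota>_def)
  have "labelling \<iota>"
  proof
    fix i assume "i \<in> range \<iota>"
    then have i: "i \<in> ?V" using v0 by (auto simp: \<iota>_def)
    have "\<phi> -` {i} \<subseteq> \<iota> -` {i}" using i by (auto simp: \<iota>_def)
    then have "measure \<Omega> (\<phi> -` {i}) \<le> measure \<Omega> (\<iota> -` {i})"
      using simple_functionD(2)[OF si, of "{i}"] by (intro \<Omega>.finite_measure_mono) auto
    then show "0 < measure \<Omega> (\<iota> -` {i})" using i by auto
  qed (rule si)
  moreover have "Law \<iota> = Law \<phi>"
    by (rule Law_cong_AE[OF _ _ ae]) (auto intro: borel_measurable_simple_function si s)
  ultimately show ?thesis by blast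
qed

text \<open>Differentiability of the lift at \<open>X\<close> gives continuity at \<open>X\<close>
  in L2, with the local Lipschitz constant 1 + C.\<close>

lemma lift_derivative_continuous:
  assumes h: "lift_has_derivative h X A" and Y: "\<And>k. Y k \<in> L2" and lim: "(\<lambda>k::nat. L2norm (Y k)) \<longlonglongrightarrow> 0"
  shows "(\<lambda>k. h (Law (\<lambda>\<omega>. X \<omega> + Y k \<omega>))) \<longlonglongrightarrow> h (Law X)"
proof -
  from h[unfolded lift_has_derivative_def] obtain C where C: "\<forall>Y\<in>L2. \<bar>A Y\<bar> \<le> C * L2norm Y" by (elim exE conjE)
  from h[unfolded lift_has_derivative_def, THEN conjunct2, THEN conjunct2, THEN spec, THEN mp, OF zero_less_one]
  obtain d where d: "d > 0" and D: "\<forall>Y\<in>L2. L2norm Y < d \<longrightarrow>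
        \<bar>h (Law (\<lambda>\<omega>. X \<omega> + Y \<omega>)) - h (Law X) - A Y\<bar> \<le> 1 * L2norm Y" by (elim exE conjE)
  have "(\<lambda>k. h (Law (\<lambda>\<omega>. X \<omega> + Y k \<omega>)) - h (Law X)) \<longlonglongrightarrow> 0"
  proof (rule Lim_null_comparison)
    have "\<forall>\<^sub>F k in sequentially. L2norm (Y k) < d" by (rule order_tendstoD(2)[OF lim d])
    then show "\<forall>\<^sub>F k in sequentially. norm (h (Law (\<lambda>\<omega>. X \<omega> + Y k \<omega>)) - h (Law X)) \<le> (1 + C) * L2norm (Y k)"
    proof eventually_elim
      case (elim k)
      have "\<bar>h (Law (\<lambda>\<omega>. X \<omega> + Y k \<omega>)) - h (Law X) - A (Y k)\<bar> \<le> 1 * L2norm (Y k)"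
        using D Y elim by blast
      moreover have "\<bar>A (Y k)\<bar> \<le> C * L2norm (Y k)" using C Y by blast
      ultimately show ?case unfolding real_norm_def distrib_right by linarith
    qed
    show "(\<lambda>k. (1 + C) * L2norm (Y k)) \<longlonglongrightarrow> 0" using tendsto_mult_right_zero[OF lim, of "1 + C"] .
  qed
  then show ?thesis by (rule LIM_zero_cancel)
qed

text \<open>The approximations are functions of the value of \<open>X\<close>, so their laws depend on \<open>m\<close> only; this
  matters because the lifts of different functions may be differentiable at different \<open>X\<close>.\<close>

lemma ex_simple_approximation:
  fixes m :: "'x::euclidean_space measure"
  assumes X0: "X0 \<in> L2" "Law X0 = m"
  shows "\<exists>\<mu>s. (\<forall>k. \<exists>\<iota>. labelling \<iota> \<and> \<mu>s k = Law \<iota>) \<and>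
    (\<forall>h \<phi>. has_L_derivative h m \<phi> \<longrightarrow> (\<lambda>k::nat. h (\<mu>s k)) \<longlonglongrightarrow> h m)"
proof -
  have "(\<lambda>x::'x. x) \<in> borel_measurable borel" by simp
  \<comment> \<open>Simple functions that approximate the identity and satisfy
    \<open>norm (F k x) \<le> 2 * norm x\<close>; hence |F k x - x| is at most 3 |x|, and 9 |X|^2
    dominates below.\<close>
  from borel_measurable_implies_sequence_metric[OF this, of 0] obtain F where
    F': "\<forall>k. simple_function borel (F k)" "\<forall>x\<in>space borel. (\<lambda>k. F k x) \<longlonglongrightarrow> x"
      "\<forall>k. \<forall>x\<in>space borel. dist (F k x) 0 \<le> 2 * dist x (0::'x)"
    by (elim exE conjE)
  then have F: "\<And>k. simple_function borel (F k)" "\<And>x. (\<lambda>k. F k x) \<longlonglongrightarrow> x" "\<And>k x. norm (F k x) \<le> 2 * norm x"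
    by simp_all
  have Fm [measurable]: "F k \<in> borel_measurable borel" for k by (rule borel_measurable_simple_function[OF F(1)])
  let ?\<mu> = "\<lambda>k. distr m borel (F k)"
  have law: "?\<mu> k = Law (\<lambda>\<omega>. F k (X \<omega>))" if X: "X \<in> L2" "Law X = m" for X k
  proof -
    note [measurable] = L2_measurable[OF X(1)]
    show ?thesis unfolding X(2)[symmetric] Law_def by (subst distr_distr) (auto simp: o_def)
  qed
  have lab: "\<exists>\<iota>. labelling \<iota> \<and> ?\<mu> k = Law \<iota>" if X: "X \<in> L2" "Law X = m" for X k
  proof -
    have "simple_function \<Omega> (\<lambda>\<omega>. F k (X \<omega>))"
      unfolding simple_function_def
    proof
      show "finite ((\<lambda>\<omega>. F k (X \<omega>)) ` space \<Omega>)"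
        using F(1)[of k] by (auto simp: simple_function_def intro: finite_subset[of _ "range (F k)"])
      have "(\<lambda>\<omega>. F k (X \<omega>)) -` {v} \<in> sets borel" for v
        using measurable_sets[OF L2_measurable[OF X(1)], of "F k -` {v}"] simple_functionD(2)[OF F(1), of k "{v}"]
        by (simp add: vimage_def)
      then show "\<forall>v\<in>(\<lambda>\<omega>. F k (X \<omega>)) ` space \<Omega>. (\<lambda>\<omega>. F k (X \<omega>)) -` {v} \<inter> space \<Omega> \<in> sets \<Omega>" by simp
    qed
    from ex_labelling[OF this] show ?thesis unfolding law[OF X] by (auto simp: eq_commute)
  qed
  have conv: "(\<lambda>k. h (?\<mu> k)) \<longlonglongrightarrow> h m" if h: "has_L_derivative h m \<phi>" for h \<phi>
  proof -
    from h obtain X A where X: "X \<in> L2" "Law X = m" and lift: "lift_has_derivative h X A"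
      unfolding has_L_derivative_def by blast
    note [measurable] = L2_measurable[OF X(1)]
    let ?Y = "\<lambda>k \<omega>. F k (X \<omega>) - X \<omega>"
    have bound: "(norm (?Y k \<omega>))\<^sup>2 \<le> 9 * (norm (X \<omega>))\<^sup>2" for k \<omega>
    proof -
      have "norm (?Y k \<omega>) \<le> 3 * norm (X \<omega>)"
        using norm_triangle_ineq4[of "F k (X \<omega>)" "X \<omega>"] F(3)[of k "X \<omega>"] by linarith
      then have "(norm (?Y k \<omega>))\<^sup>2 \<le> (3 * norm (X \<omega>))\<^sup>2" by (intro power_mono) auto
      then show ?thesis by (simp add: power_mult_distrib)
    qed
    have i9: "integrable \<Omega> (\<lambda>\<omega>. 9 * (norm (X \<omega>))\<^sup>2)" using L2_square[OF X(1)] by simp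
    have Y: "?Y k \<in> L2" for k
    proof (rule L2_I)
      show "integrable \<Omega> (\<lambda>\<omega>. (norm (?Y k \<omega>))\<^sup>2)"
        by (rule Bochner_Integration.integrable_bound[OF i9]) (use bound in auto)
    qed measurable
    have "(\<lambda>k. \<integral>\<omega>. (norm (?Y k \<omega>))\<^sup>2 \<partial>\<Omega>) \<longlonglongrightarrow> (\<integral>\<omega>. 0 \<partial>\<Omega>)"
    proof (rule integral_dominated_convergence[OF _ _ i9])
      show "AE \<omega> in \<Omega>. (\<lambda>k. (norm (?Y k \<omega>))\<^sup>2) \<longlonglongrightarrow> 0"
      proof (rule AE_I2)
        fix \<omega>
        have "(\<lambda>k. (norm (?Y k \<omega>))\<^sup>2) \<longlonglongrightarrow> (norm (X \<omega> - X \<omega>))\<^sup>2"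
          by (intro tendsto_power tendsto_norm tendsto_diff F(2) tendsto_const)
        then show "(\<lambda>k. (norm (?Y k \<omega>))\<^sup>2) \<longlonglongrightarrow> 0" by simp
      qed
    qed (use bound in auto)
    from tendsto_real_sqrt[OF this] have "(\<lambda>k. L2norm (?Y k)) \<longlonglongrightarrow> 0" by (simp add: L2norm_def)
    from lift_derivative_continuous[OF lift Y this] show ?thesis
      unfolding law[OF X] X(2) by simp
  qed
  show ?thesis
  proof (intro exI[of _ ?\<mu>] conjI allI impI)
    fix k
    show "\<exists>\<iota>. labelling \<iota> \<and> ?\<mu> k = Law \<iota>"
      by (rule lab[OF X0])
  qed (rule conv)
qed

theorem theorem9p4:
  fixes T :: real
    and f :: "real^'n \<Rightarrow> (real^'n) measure \<Rightarrow> real^'a \<Rightarrow> real^'n"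
    and g :: "real^'n \<Rightarrow> (real^'n) measure \<Rightarrow> real^'a \<Rightarrow> real"
    and k :: "real^'n \<Rightarrow> (real^'n) measure \<Rightarrow> real"
    and lamf Lamf lbf Lipf lamg Lamg lbg lg lamk Lamk lk :: real
    and v1 v2 :: "real \<Rightarrow> (real^'n) measure \<Rightarrow> real"
  assumes "T > 0"
    and "a1 f lamf Lamf lbf Lipf"
    and "a2 g lamg Lamg lbg lg"
    and "a3 k lamk Lamk lk"
    and "h1 f g k"
    and "h2 CARD('n) lamf Lamf lbf lamg Lamg lbg lamk Lamk"
    and "regular_solution T f g k v1"
    and "regular_solution T f g k v2"
  shows "\<forall>t\<in>{0..T}. \<forall>m\<in>P2. v1 t m = v2 t m"
proof (intro ballI)
  fix t and m :: "(real^'n) measure" assume t: "t \<in> {0..T}" and m: "m \<in> P2"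
  have L: "\<exists>\<phi>. has_L_derivative (v t) \<mu> \<phi>" if v: "regular_solution T f g k v" and t: "t \<in> {0..T}" and \<mu>: "\<mu> \<in> P2" for v t \<mu>
  proof -
    from v[unfolded regular_solution_def] obtain vt vm where
      "\<forall>t\<in>{0..T}. \<forall>m\<in>P2. ((\<lambda>s. v s m) has_real_derivative vt t m) (at t within {0..T}) \<and>
        has_L_derivative (v t) m (vm t m)" by (elim exE conjE)
    then show ?thesis using t \<mu> by blast
  qed
  \<comment> \<open>Read off from the solution \<open>v1\<close>: an L-derivative at a law includes
    a vector on \<open>\<Omega>\<close> with that law.\<close>
  have laws: "\<forall>\<mu>\<in>(P2 :: (real^'n) measure set). \<exists>X\<in>L2. Law X = \<mu>"
  proof
    fix \<mu> :: "(real^'n) measure" assume "\<mu> \<in> P2"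
    from L[OF assms(7) t this] show "\<exists>X\<in>L2. Law X = \<mu>" unfolding has_L_derivative_def by blast
  qed
  then obtain X0 where X0: "X0 \<in> L2" "Law X0 = m" using m by blast
  from ex_simple_approximation[OF X0] obtain \<mu>s where
    lab: "\<forall>k. \<exists>\<iota>. labelling \<iota> \<and> \<mu>s k = Law \<iota>" and
    lim: "\<forall>h \<phi>. has_L_derivative h m \<phi> \<longrightarrow> (\<lambda>k. h (\<mu>s k)) \<longlonglongrightarrow> h m" by (elim exE conjE)
  have eq: "v1 t (\<mu>s j) = v2 t (\<mu>s j)" for j
  proof -
    from lab obtain \<iota> where \<iota>: "labelling \<iota>" "\<mu>s j = Law \<iota>" by blast
    interpret labelling \<iota> by (rule \<iota>(1))
    interpret particle_data f g k lamf Lamf lbf Lipf lamg Lamg lbg lg \<iota>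
      by unfold_locales (use assms laws in auto)
    \<comment> \<open>The labels are the atoms themselves, so the configuration is the identity; the
      two solutions exchange their roles for the reverse inequality.\<close>
    show ?thesis
      using regular_solution_le[OF assms(7,8,1) t, of "\<lambda>x. x"] regular_solution_le[OF assms(8,7,1) t, of "\<lambda>x. x"]
      unfolding \<iota>(2) by simp
  qed
  from L[OF assms(7) t m] L[OF assms(8) t m] lim have
    "(\<lambda>k. v1 t (\<mu>s k)) \<longlonglongrightarrow> v1 t m" "(\<lambda>k. v2 t (\<mu>s k)) \<longlonglongrightarrow> v2 t m" by blast+
  then show "v1 t m = v2 t m" unfolding eq by (rule LIMSEQ_unique)
qed

end
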